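(* For each of the following three triples $(G,V,u)$, the $32$-dimensional Hopf algebras $A(G,V,u,B)^*$, $B\in S^2V$, fall into infinitely many twist equivalence classes: (1) $G=\mathbb{Z}_8=\langle a\rangle$, $V=\chi\oplus\chi^3$, $u=a^4$, where $\chi(a^m)=e^{2\pi i m/8}$; (2) $G=\mathbb{Z}_8=\langle a\rangle$, $V=\chi\oplus\chi^5$, $u=a^4$, where $\chi(a^m)=e^{2\pi i m/8}$; (3) $G=\mathbb{Z}_4\times\mathbb{Z}_2=\langle a\rangle\times\langle b\rangle$, $V=(\chi,\chi_+)\oplus(\chi,\chi_-)$, $u=(a^2,1)$, where $\chi(a^m)=e^{2\pi i m/4}$ and $\chi_+,\chi_-$ are respectively the trivial and the non-trivial character of $\mathbb{Z}_2$.
   Context: The ground field is $\mathbb{C}$. $S^2V$ denotes the space of symmetric tensors in $V\otimes V$, and $H^*$ is the dual Hopf algebra. Characters are regarded as one-dimensional representations. A twist for a finite-dimensional Hopf algebra $H$ is an invertible $F\in H\otimes H$ with $(\Delta\otimes\mathrm{id})(F)(F\otimes1)=(\mathrm{id}\otimes\Delta)(F)(1\otimes F)$; $H^F$ is the Hopf algebra with the same algebra structure and counit and coproduct $F^{-1}\Delta(\cdot)F$. Two Hopf algebras $H_1,H_2$ are twist equivalent if $H_2\cong H_1^F$ as Hopf algebras for some twist $F$ for $H_1$. Definition of $A(G,V,u,B)$, for $G$ a finite group, $V$ a finite-dimensional complex representation, $u\in G$ central of order $2$ with $u|_V=-1$, $B\in S^2V$. Let $\mathbb{C}[G\ltimes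 V]:=\mathbb{C}[G]\ltimes\Lambda V$ be the Hopf superalgebra generated by $G$ (even) and $V$ (odd), with $gvg^{-1}=g\cdot v$, $vw=-wv$, $\Delta(g)=g\otimes g$, $\Delta(v)=v\otimes1+1\otimes v$, $\varepsilon(g)=1$, $\varepsilon(v)=0$ (tensor products of superalgebras have the super multiplication). Let $J:=e^B\in\Lambda V\otimes\Lambda V\subset\mathbb{C}[G\ltimes V]^{\otimes2}$. The twisted Hopf superalgebra $\mathbb{C}[G\ltimes V]^J$ has the same multiplication and counit, and coproduct $\Delta^J(x)=J^{-1}\Delta(x)J$. For $x$ homogeneous of parity $p(x)$ write $\Delta^J(x)=\Delta^J_0(x)+\Delta^J_1(x)$, where the second tensor factor of $\Delta^J_0(x)$ is even and that of $\Delta_1^J(x)$ is odd. Then $A(G,V,u,B)$ is the ordinary Hopf algebra which, as an algebra with counit, is $\mathbb{C}[G]\ltimes\Lambda V$ (grading forgotten), with coproduct $\widetilde{\Delta^J}(x)=\Delta^J_0(x)-(-1)^{p(x)}(u\otimes1)\Delta^J_1(x)$. *)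

theory Defs
  imports "HOL-Analysis.Analysis"
begin

section \<open>Finite-dimensional Hopf algebras in coordinates\<close>

text \<open>
  A finite-dimensional complex vector space is \<open>complex ^ 'i\<close>, with basis \<open>axis i 1\<close>; the tensor
  product of \<open>complex ^ 'i\<close> and \<open>complex ^ 'j\<close> is \<open>complex ^ ('i \<times> 'j)\<close>, and the dual of
  \<open>complex ^ 'i\<close> is \<open>complex ^ 'i\<close> with the dual basis. The synonyms below do not attach a sort to
  the index type, unlike the notation \<open>complex ^ 'i\<close>.
\<close>

type_synonym 'i cvec = "(complex, 'i) vec"
type_synonym 'i cmat = "('i cvec, 'i) vec"

abbreviation basis :: "'i::finite \<Rightarrow> 'i cvec"
  where "basis i \<equiv> axis i 1"

definition ten :: "'i::finite cvec \<Rightarrow> 'j::finite cvec \<Rightarrow> ('i \<times> 'j) cvec"  (infixr "\<otimes>" 75)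
  where "x \<otimes> y = (\<chi> p. x $ fst p * y $ snd p)"

definition ten_map :: "('i::finite cvec \<Rightarrow> 'k::finite cvec) \<Rightarrow>
    ('j::finite cvec \<Rightarrow> 'l::finite cvec) \<Rightarrow> ('i \<times> 'j) cvec \<Rightarrow> ('k \<times> 'l) cvec"
  where "ten_map f g X = (\<Sum>p\<in>UNIV. X $ p *s (f (basis (fst p)) \<otimes> g (basis (snd p))))"

definition ten_assoc ::
    "('i::finite \<times> ('j::finite \<times> 'k::finite)) cvec \<Rightarrow> (('i \<times> 'j) \<times> 'k) cvec"
  where "ten_assoc X = (\<chi> p. X $ (fst (fst p), (snd (fst p), snd p)))"

definition ten_mul :: "('i::finite cvec \<Rightarrow> 'i cvec \<Rightarrow> 'i cvec) \<Rightarrow>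
    ('j::finite cvec \<Rightarrow> 'j cvec \<Rightarrow> 'j cvec) \<Rightarrow>
    ('i \<times> 'j) cvec \<Rightarrow> ('i \<times> 'j) cvec \<Rightarrow> ('i \<times> 'j) cvec"
  where "ten_mul m n X Y = (\<Sum>p\<in>UNIV. \<Sum>q\<in>UNIV. (X $ p * Y $ q) *s
    (m (basis (fst p)) (basis (fst q)) \<otimes> n (basis (snd p)) (basis (snd q))))"

definition is_inverse :: "('a \<Rightarrow> 'a \<Rightarrow> 'a) \<Rightarrow> 'a \<Rightarrow> 'a \<Rightarrow> 'a \<Rightarrow> bool"
  where "is_inverse m e x y \<longleftrightarrow> m x y = e \<and> m y x = e"

definition inverse_in :: "('a \<Rightarrow> 'a \<Rightarrow> 'a) \<Rightarrow> 'a \<Rightarrow> 'a \<Rightarrow> 'a"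
  where "inverse_in m e x = (THE y. is_inverse m e x y)"

record ('i::finite) hopf_ops =
  hmul :: "'i cvec \<Rightarrow> 'i cvec \<Rightarrow> 'i cvec"
  hone :: "'i cvec"
  hcomul :: "'i cvec \<Rightarrow> ('i \<times> 'i) cvec"
  hcounit :: "'i cvec \<Rightarrow> complex"

abbreviation hmul2 :: "'i::finite hopf_ops \<Rightarrow> ('i \<times> 'i) cvec \<Rightarrow> ('i \<times> 'i) cvec \<Rightarrow> ('i \<times> 'i) cvec"
  where "hmul2 H \<equiv> ten_mul (hmul H) (hmul H)"

abbreviation hone2 :: "'i::finite hopf_ops \<Rightarrow> ('i \<times> 'i) cvec"
  where "hone2 H \<equiv> hone H \<otimes> hone H"

definition algebra_axioms :: "'i::finite hopf_ops \<Rightarrow> bool"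
  where "algebra_axioms H \<longleftrightarrow>
    (\<forall>x. Vector_Spaces.linear (*s) (*s) (hmul H x)) \<and>
    (\<forall>y. Vector_Spaces.linear (*s) (*s) (\<lambda>x. hmul H x y)) \<and>
    (\<forall>x y z. hmul H (hmul H x y) z = hmul H x (hmul H y z)) \<and>
    (\<forall>x. hmul H (hone H) x = x \<and> hmul H x (hone H) = x)"

definition coalgebra_axioms :: "'i::finite hopf_ops \<Rightarrow> bool"
  where "coalgebra_axioms H \<longleftrightarrow>
    Vector_Spaces.linear (*s) (*s) (hcomul H) \<and>
    Vector_Spaces.linear (*s) (*) (hcounit H) \<and>
    (\<forall>x. ten_map (hcomul H) id (hcomul H x) = ten_assoc (ten_map id (hcomul H) (hcomul H x))) \<and>
    (\<forall>x. (\<Sum>p\<in>UNIV. (hcomul H x $ p * hcounit H (basis (fst p))) *s basis (snd p)) = x) \<and>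
    (\<forall>x. (\<Sum>p\<in>UNIV. (hcomul H x $ p * hcounit H (basis (snd p))) *s basis (fst p)) = x)"

definition is_antipode :: "'i::finite hopf_ops \<Rightarrow> ('i cvec \<Rightarrow> 'i cvec) \<Rightarrow> bool"
  where "is_antipode H S \<longleftrightarrow> Vector_Spaces.linear (*s) (*s) S \<and>
    (\<forall>x. (\<Sum>p\<in>UNIV. hcomul H x $ p *s hmul H (S (basis (fst p))) (basis (snd p)))
          = hcounit H x *s hone H) \<and>
    (\<forall>x. (\<Sum>p\<in>UNIV. hcomul H x $ p *s hmul H (basis (fst p)) (S (basis (snd p))))
          = hcounit H x *s hone H)"

definition hopf_algebra :: "'i::finite hopf_ops \<Rightarrow> bool"
  where "hopf_algebra H \<longleftrightarrow> algebra_axioms H \<and> coalgebra_axioms H \<and>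
    (\<forall>x y. hcomul H (hmul H x y) = hmul2 H (hcomul H x) (hcomul H y)) \<and>
    hcomul H (hone H) = hone2 H \<and>
    (\<forall>x y. hcounit H (hmul H x y) = hcounit H x * hcounit H y) \<and>
    hcounit H (hone H) = 1 \<and>
    (\<exists>S. is_antipode H S)"

text \<open>Compatibility of a Hopf algebra isomorphism with antipodes is automatic.\<close>

definition hopf_iso :: "'i::finite hopf_ops \<Rightarrow> 'j::finite hopf_ops \<Rightarrow> bool"
  where "hopf_iso H K \<longleftrightarrow> (\<exists>f. Vector_Spaces.linear (*s) (*s) f \<and> bij f \<and>
    (\<forall>x y. f (hmul H x y) = hmul K (f x) (f y)) \<and> f (hone H) = hone K \<and>
    (\<forall>x. hcomul K (f x) = ten_map f f (hcomul H x)) \<and> (\<forall>x. hcounit K (f x) = hcounit H x))"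

text \<open>
  The element \<open>\<phi>\<close> of \<open>'i cvec\<close>, viewed in the dual space, is the functional \<open>pairing \<phi>\<close>; the
  dual of a tensor square is identified with the tensor square of the dual by
  \<open>(\<phi> \<otimes> \<psi>) (x \<otimes> y) = \<phi> x * \<psi> y\<close>.
\<close>

definition pairing :: "'i::finite cvec \<Rightarrow> 'i cvec \<Rightarrow> complex"
  where "pairing \<phi> x = (\<Sum>i\<in>UNIV. \<phi> $ i * x $ i)"

definition hopf_dual :: "'i::finite hopf_ops \<Rightarrow> 'i hopf_ops"
  where "hopf_dual H = \<lparr>
    hmul = (\<lambda>\<phi> \<psi>. \<chi> i. pairing (\<phi> \<otimes> \<psi>) (hcomul H (basis i))),
    hone = (\<chi> i. hcounit H (basis i)),
    hcomul = (\<lambda>\<phi>. \<chi> p. pairing \<phi> (hmul H (basis (fst p)) (basis (snd p)))),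
    hcounit = (\<lambda>\<phi>. pairing \<phi> (hone H))\<rparr>"


section \<open>Twists\<close>

definition is_twist :: "'i::finite hopf_ops \<Rightarrow> ('i \<times> 'i) cvec \<Rightarrow> bool"
  where "is_twist H F \<longleftrightarrow> (\<exists>F'. is_inverse (hmul2 H) (hone2 H) F F') \<and>
    ten_mul (hmul2 H) (hmul H) (ten_map (hcomul H) id F) (F \<otimes> hone H) =
    ten_mul (hmul2 H) (hmul H) (ten_assoc (ten_map id (hcomul H) F)) (ten_assoc (hone H \<otimes> F))"

definition twisted :: "'i::finite hopf_ops \<Rightarrow> ('i \<times> 'i) cvec \<Rightarrow> 'i hopf_ops"
  where "twisted H F = H\<lparr>hcomul :=
    (\<lambda>x. hmul2 H (hmul2 H (inverse_in (hmul2 H) (hone2 H) F) (hcomul H x)) F)\<rparr>"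

definition twist_equivalent :: "'i::finite hopf_ops \<Rightarrow> 'j::finite hopf_ops \<Rightarrow> bool"
  where "twist_equivalent H K \<longleftrightarrow> hopf_algebra H \<and> hopf_algebra K \<and>
    (\<exists>F. is_twist H F \<and> hopf_iso K (twisted H F))"

definition twist_rel :: "('i::finite hopf_ops \<times> 'i hopf_ops) set"
  where "twist_rel = {(H, K). twist_equivalent H K}"


section \<open>The Hopf superalgebra of a representation\<close>

text \<open>
  A finite group is a type of class \<open>{finite, group_add}\<close> (written additively, not assumed
  commutative), and a representation on \<open>V = 'n cvec\<close> is a map \<open>\<rho>\<close> into matrices. The order
  on \<open>'n\<close> only serves to write the basis of the exterior algebra: the basis vector indexed by the
  set \<open>{i\<^sub>1 < \<dots> < i\<^sub>k}\<close> is \<open>v\<^bsub>i\<^sub>1\<^esub> \<dots> v\<^bsub>i\<^sub>k\<^esub>\<close>.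
\<close>

definition representation :: "('g::{finite,group_add} \<Rightarrow> 'n::finite cmat) \<Rightarrow> bool"
  where "representation \<rho> \<longleftrightarrow> \<rho> 0 = mat 1 \<and> (\<forall>g h. \<rho> (g + h) = \<rho> g ** \<rho> h)"

definition wedge :: "'n::{finite,linorder} set cvec \<Rightarrow> 'n set cvec \<Rightarrow> 'n set cvec"
  where "wedge x y = (\<Sum>S\<in>UNIV. \<Sum>T\<in>UNIV. if S \<inter> T = {}
    then (x $ S * y $ T * (-1) ^ card {(i, j). i \<in> S \<and> j \<in> T \<and> j < i}) *s basis (S \<union> T) else 0)"

definition ext_vec :: "'n::finite cvec \<Rightarrow> 'n set cvec"
  where "ext_vec v = (\<Sum>i\<in>UNIV. v $ i *s basis {i})"

definition ext_act :: "('g \<Rightarrow> 'n cmat) \<Rightarrow> 'g \<Rightarrow> 'n set cvec \<Rightarrow>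
    'n::{finite,linorder} set cvec"
  where "ext_act \<rho> g x = (\<Sum>S\<in>UNIV. x $ S *s
    foldr wedge (map (\<lambda>i. ext_vec (\<rho> g *v basis i)) (sorted_list_of_set S)) (basis {}))"

text \<open>
  Index \<open>(S, g)\<close> stands for \<open>v\<^sub>S g\<close>; since \<open>g v = (g \<cdot> v) g\<close>, we have
  \<open>(v\<^sub>S g) (v\<^sub>T h) = v\<^sub>S (g \<cdot> v\<^sub>T) (g h)\<close>.
\<close>

definition smash_mul :: "('g::{finite,group_add} \<Rightarrow> 'n cmat) \<Rightarrow>
    ('n::{finite,linorder} set \<times> 'g) cvec \<Rightarrow> ('n set \<times> 'g) cvec \<Rightarrow> ('n set \<times> 'g) cvec"
  where "smash_mul \<rho> x y = (\<Sum>p\<in>UNIV. \<Sum>q\<in>UNIV. (x $ p * y $ q) *s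
    (wedge (basis (fst p)) (ext_act \<rho> (snd p) (basis (fst q))) \<otimes> basis (snd p + snd q)))"

definition grp_elt :: "'g \<Rightarrow> ('n::finite set \<times> 'g::{finite,group_add}) cvec"
  where "grp_elt g = basis ({}, g)"

definition vec_elt :: "'n cvec \<Rightarrow> ('n::finite set \<times> 'g::{finite,group_add}) cvec"
  where "vec_elt v = ext_vec v \<otimes> basis 0"

definition parity :: "'n set \<times> 'g \<Rightarrow> nat"
  where "parity p = card (fst p)"

text \<open>The multiplication of the tensor square as a superalgebra.\<close>

definition super_mul2 :: "('g::{finite,group_add} \<Rightarrow> 'n cmat) \<Rightarrow>
    (('n::{finite,linorder} set \<times> 'g) \<times> ('n set \<times> 'g)) cvec \<Rightarrow>
    (('n set \<times> 'g) \<times> ('n set \<times> 'g)) cvec \<Rightarrow> (('n set \<times> 'g) \<times> ('n set \<times> 'g)) cvec"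
  where "super_mul2 \<rho> X Y = (\<Sum>p\<in>UNIV. \<Sum>q\<in>UNIV.
    ((-1) ^ (parity (snd p) * parity (fst q)) * X $ p * Y $ q) *s
    (smash_mul \<rho> (basis (fst p)) (basis (fst q)) \<otimes> smash_mul \<rho> (basis (snd p)) (basis (snd q))))"

text \<open>
  The algebra map to the super tensor square with \<open>v \<mapsto> v \<otimes> 1 + 1 \<otimes> v\<close> and \<open>g \<mapsto> g \<otimes> g\<close>,
  evaluated on the basis \<open>v\<^bsub>i\<^sub>1\<^esub> \<dots> v\<^bsub>i\<^sub>k\<^esub> g\<close>.
\<close>

definition super_comul :: "('g::{finite,group_add} \<Rightarrow> 'n cmat) \<Rightarrow>
    ('n::{finite,linorder} set \<times> 'g) cvec \<Rightarrow> (('n set \<times> 'g) \<times> ('n set \<times> 'g)) cvec"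
  where "super_comul \<rho> x = (\<Sum>p\<in>UNIV. x $ p *s
    foldr (super_mul2 \<rho>)
      (map (\<lambda>i. vec_elt (basis i) \<otimes> grp_elt 0 + grp_elt 0 \<otimes> vec_elt (basis i))
        (sorted_list_of_set (fst p)))
      (grp_elt (snd p) \<otimes> grp_elt (snd p)))"

definition smash_counit :: "('n::finite set \<times> 'g::{finite,group_add}) cvec \<Rightarrow> complex"
  where "smash_counit x = (\<Sum>g\<in>UNIV. x $ ({}, g))"


section \<open>The Hopf algebras \<open>A(G, V, u, B)\<close>\<close>

definition sym2 :: "(('n::finite \<times> 'n) cvec) set"
  where "sym2 = {B. \<forall>i j. B $ (i, j) = B $ (j, i)}"

text \<open>
  Powers of \<open>B\<close> are taken in the super tensor square; the \<open>k\<close>-th one lies in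
  \<open>\<Lambda>\<^sup>k V \<otimes> \<Lambda>\<^sup>k V\<close>, so the exponential series stops at \<open>k = dim V\<close>.
\<close>

definition exp_twist :: "('g::{finite,group_add} \<Rightarrow> 'n cmat) \<Rightarrow>
    ('n \<times> 'n) cvec \<Rightarrow> (('n::{finite,linorder} set \<times> 'g) \<times> ('n set \<times> 'g)) cvec"
  where "exp_twist \<rho> B = (\<Sum>k\<le>CARD('n). (1 / fact k) *s
    ((super_mul2 \<rho> (ten_map vec_elt vec_elt B)) ^^ k) (grp_elt 0 \<otimes> grp_elt 0))"

definition super_comul_twisted :: "('g::{finite,group_add} \<Rightarrow> 'n cmat) \<Rightarrow>
    ('n \<times> 'n) cvec \<Rightarrow> ('n::{finite,linorder} set \<times> 'g) cvec \<Rightarrow>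
    (('n set \<times> 'g) \<times> ('n set \<times> 'g)) cvec"
  where "super_comul_twisted \<rho> B x =
    super_mul2 \<rho> (super_mul2 \<rho>
      (inverse_in (super_mul2 \<rho>) (grp_elt 0 \<otimes> grp_elt 0) (exp_twist \<rho> B))
      (super_comul \<rho> x)) (exp_twist \<rho> B)"

definition snd_even :: "('i::finite \<times> ('n::finite set \<times> 'g::finite)) cvec \<Rightarrow>
    ('i \<times> ('n set \<times> 'g)) cvec"
  where "snd_even X = (\<chi> p. if even (parity (snd p)) then X $ p else 0)"

definition snd_odd :: "('i::finite \<times> ('n::finite set \<times> 'g::finite)) cvec \<Rightarrow>
    ('i \<times> ('n set \<times> 'g)) cvec"
  where "snd_odd X = (\<chi> p. if odd (parity (snd p)) then X $ p else 0)"

definition A_comul :: "('g::{finite,group_add} \<Rightarrow> 'n cmat) \<Rightarrow> 'g \<Rightarrow>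
    ('n \<times> 'n) cvec \<Rightarrow> ('n::{finite,linorder} set \<times> 'g) cvec \<Rightarrow>
    (('n set \<times> 'g) \<times> ('n set \<times> 'g)) cvec"
  where "A_comul \<rho> u B x = (\<Sum>p\<in>UNIV. x $ p *s
    (snd_even (super_comul_twisted \<rho> B (basis p)) - (-1) ^ parity p *s
      ten_mul (smash_mul \<rho>) (smash_mul \<rho>) (grp_elt u \<otimes> grp_elt 0)
        (snd_odd (super_comul_twisted \<rho> B (basis p)))))"

definition A_hopf :: "('g::{finite,group_add} \<Rightarrow> 'n cmat) \<Rightarrow> 'g \<Rightarrow>
    ('n \<times> 'n) cvec \<Rightarrow> ('n::{finite,linorder} set \<times> 'g) hopf_ops"
  where "A_hopf \<rho> u B = \<lparr>hmul = smash_mul \<rho>, hone = grp_elt 0,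
    hcomul = A_comul \<rho> u B, hcounit = smash_counit\<rparr>"

text \<open>
  The construction is a Hopf algebra under the following assumptions on \<open>(G, V, u)\<close>, with \<open>B\<close> in
  \<open>sym2\<close>; outside them the operations above are only formal.
\<close>

definition admissible :: "('g::{finite,group_add} \<Rightarrow> 'n::finite cmat) \<Rightarrow> 'g \<Rightarrow> bool"
  where "admissible \<rho> u \<longleftrightarrow> representation \<rho> \<and> (\<forall>g. u + g = g + u) \<and>
    u \<noteq> 0 \<and> u + u = 0 \<and> \<rho> u = - mat 1"


section \<open>Characters of cyclic groups\<close>

text \<open>
  The cyclic group of even order \<open>n\<close> is the numeral type \<open>n\<close> under addition, its generator \<open>a\<close>
  being \<open>1\<close>, so that \<open>a\<^sup>m\<close> is \<open>of_nat m\<close>; see \<open>zchar_of_nat\<close>.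
\<close>

definition zchar :: "'a::finite bit0 \<Rightarrow> complex"
  where "zchar g = exp (2 * of_real pi * \<i> * of_int (Rep_bit0 g) / of_nat CARD('a bit0))"

definition char_sum :: "('g \<Rightarrow> complex) \<Rightarrow> ('g \<Rightarrow> complex) \<Rightarrow> 'g \<Rightarrow> complex ^ 2 ^ 2"
  where "char_sum \<alpha> \<beta> g = (\<chi> i j. if i = j then (if i = 1 then \<alpha> g else \<beta> g) else 0)"

lemma zchar_of_nat:
  "zchar (of_nat m :: 'a::finite bit0) = exp (2 * of_real pi * \<i> * of_nat m / of_nat CARD('a bit0))"
proof -
  let ?n = "CARD('a bit0)"
  have n: "(of_nat ?n :: complex) \<noteq> 0" by simp
  have "Rep_bit0 (of_nat m :: 'a bit0) = int m mod int ?n"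
    using bit0.of_nat_eq[where ?'a='a, of m] bit0.Rep_Abs_mod[where ?'a='a, of "int m"]
    by (simp add: Abs_bit0'_def)
  also have "\<dots> = int (m mod ?n)" by (simp add: zmod_int)
  finally have r: "(of_int (Rep_bit0 (of_nat m :: 'a bit0)) :: complex) = of_nat (m mod ?n)" by simp
  have "(of_nat m :: complex) = of_nat (m mod ?n) + of_nat ?n * of_nat (m div ?n)"
    by (metis mod_mult_div_eq of_nat_add of_nat_mult)
  then have "2 * of_real pi * \<i> * of_nat m / of_nat ?n =
     2 * of_real pi * \<i> * of_nat (m mod ?n) / of_nat ?n + \<i> * (of_int (int (m div ?n)) * (of_real pi * 2))"
    using n by (simp add: field_simps del: card_bit0)
  then show ?thesis
    unfolding zchar_def r by (simp only: exp_plus_2pin)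
qed

lemma zchar_add: "zchar (g + h) = zchar g * zchar h"
proof -
  obtain m n where "g = of_nat m" "h = of_nat n"
    by (metis bit0_cases of_int_of_nat_eq zero_le_imp_eq_int)
  then show ?thesis
    by (simp only: zchar_of_nat of_nat_add [symmetric] exp_add [symmetric])
      (simp add: add_divide_distrib distrib_left del: card_bit0)
qed

lemma zchar_0: "zchar 0 = 1"
  using zchar_of_nat[of 0] by simp

lemma representation_char_sum:
  assumes "\<alpha> 0 = 1" "\<beta> 0 = 1" "\<And>g h. \<alpha> (g + h) = \<alpha> g * \<alpha> h" "\<And>g h. \<beta> (g + h) = \<beta> g * \<beta> h"
  shows "representation (char_sum \<alpha> \<beta>)"
  using assms by (simp add: representation_def char_sum_def mat_def matrix_matrix_mult_def vec_eq_iff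
      sum_2 forall_2)

lemma zchar_half:
  "zchar (4 :: 8) = -1" "zchar (2 :: 4) = -1"
proof -
  have "zchar (4 :: 8) = exp (of_real pi * \<i>)" using zchar_of_nat[of 4, where ?'a=4] by simp
  then show "zchar (4 :: 8) = -1" by simp
  have "zchar (2 :: 4) = exp (of_real pi * \<i>)" using zchar_of_nat[of 2, where ?'a=2] by simp
  then show "zchar (2 :: 4) = -1" by simp
qed

lemma admissible_triples:
  "admissible (char_sum zchar (\<lambda>g. zchar g ^ 3)) (4 :: 8)"
  "admissible (char_sum zchar (\<lambda>g. zchar g ^ 5)) (4 :: 8)"
  "admissible (char_sum (\<lambda>(x, y). zchar x) (\<lambda>(x, y). zchar x * zchar y)) ((2, 0) :: 4 \<times> 2)"
  unfolding admissible_def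
  by (auto intro!: representation_char_sum simp: zchar_0 zchar_add power_mult_distrib zchar_half
      char_sum_def mat_def vec_eq_iff forall_2 zero_prod_def algebra_simps)

end

theory Submission
  imports Defs
begin

text \<open>
  Let \<open>H\<close> be the dual of \<open>A(G, V, u, B)\<close> and, for \<open>g\<close> in \<open>G\<close>, let \<open>Q\<^sub>g = gB - B\<close>. As an algebra, \<open>H\<close> is
  generated by the functions on \<open>G\<close> and odd elements \<open>\<xi>\<^sub>i\<close> with Clifford relations given by \<open>Q\<^sub>g\<close>. When
  \<open>Q\<^sub>g\<close> is nondegenerate for all \<open>g\<close> outside \<open>{1, u}\<close>, left and right translation by a skew-primitive
  vector \<open>v\<close> of \<open>A\<close> are inner twisted derivations on that part of \<open>H\<close>, implemented by unique elements
  \<open>c\<^sub>v\<close> and \<open>d\<^sub>v\<close>. The commutators \<open>e(v, w) = [c\<^sub>v, d\<^sub>w]\<close> are functions on \<open>G\<close>: at \<open>g\<close> they form, up to sign,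
  half the inverse matrix of \<open>Q\<^sub>g\<close> with columns scaled by the characters. The cocycle equation of a
  twist, contracted with \<open>u\<close> and the skew-primitive vectors in its outer legs, shows that a twist
  multiplies all \<open>e(v, w)\<close> by one element \<open>\<kappa>\<close>, and that products \<open>e(v, w) e(v', w')\<close> change by a scalar
  only. Hence the values on \<open>G\<close> of the discriminant of the symmetrised form \<open>e\<close> are an invariant of the
  twist equivalence class up to order and a common factor; their ratios are nonconstant in \<open>B\<close>.
\<close>

subsection \<open>Bilinear maps in coordinates\<close>

text \<open>Twists of \<open>H\<close> are not classified. A twist enters only through contractions
  of its cocycle equation, always with a character or a skew-primitive functional, because
  contracting a product then yields at most two terms. The pair {1, u} is exceptional because
  \<open>u\<close> acts on V by -1, hence trivially on the symmetric square, so that gB - B vanishes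
  there. Three ambiguities shape the invariant. An isomorphism changes the skew-primitive vectors by
  a linear map and adds multiples of the trivial one, the difference of the counit and
  \<open>u\<close>. The added terms become central and drop out of the commutators, and the linear
  map acts on the form by congruence, which suggests a determinant. The factor \<kappa> is an
  unknown element of the algebra and not a scalar, so a linear expression in the form is useless,
  while in a quadratic one \<kappa> can be paired with its translate. Finally, an isomorphism need
  not permute the indicator functions of points of G, so the values of the discriminant are
  recovered as a spectrum: the scalars whose subtraction destroys invertibility.\<close>

lemma linear_s_iff: "Vector_Spaces.linear (*s) (*s) f \<longleftrightarrow>
    (\<forall>x y. f (x + y) = f x + f y) \<and> (\<forall>c x. f (c *s x) = c *s f x)"
  for f :: "'i::finite cvec \<Rightarrow> 'j::finite cvec"
  by (simp add: Vector_Spaces.linear_iff vec.vector_space_axioms)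

lemma linear_s_mult_iff: "Vector_Spaces.linear (*s) (*) f \<longleftrightarrow>
    (\<forall>x y. f (x + y) = f x + f y) \<and> (\<forall>c x. f (c *s x) = c * f x)"
  for f :: "'i::finite cvec \<Rightarrow> complex"
proof -
  have "vector_space ((*) :: complex \<Rightarrow> complex \<Rightarrow> complex)"
    by unfold_locales (simp_all add: algebra_simps)
  then show ?thesis
    by (simp add: Vector_Spaces.linear_iff vec.vector_space_axioms)
qed

lemma basis_nth: "basis i $ j = (if j = i then 1 else 0)"
  by (simp add: axis_def)

lemma linear_expand:
  fixes f :: "'i::finite cvec \<Rightarrow> 'j::finite cvec"
  assumes "Vector_Spaces.linear (*s) (*s) f"
  shows "f x = (\<Sum>i\<in>UNIV. x $ i *s f (basis i))"
proof -
  have "f x = f (\<Sum>i\<in>UNIV. x $ i *s basis i)" by (simp only: basis_expansion)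
  also have "\<dots> = (\<Sum>i\<in>UNIV. x $ i *s f (basis i))"
    unfolding vec.linear_sum[OF assms] using assms by (simp only: linear_s_iff)
  finally show ?thesis .
qed

lemma linear_eqI:
  fixes f g :: "'i::finite cvec \<Rightarrow> 'j::finite cvec"
  assumes "Vector_Spaces.linear (*s) (*s) f" "Vector_Spaces.linear (*s) (*s) g"
    and "\<And>i. f (basis i) = g (basis i)"
  shows "f x = g x"
  unfolding linear_expand[OF assms(1), of x] linear_expand[OF assms(2), of x] assms(3) ..

definition bilinear_op :: "('i::finite cvec \<Rightarrow> 'j::finite cvec \<Rightarrow> 'k::finite cvec) \<Rightarrow> bool"
  where "bilinear_op m \<longleftrightarrow> (\<forall>x. Vector_Spaces.linear (*s) (*s) (m x)) \<and>
    (\<forall>y. Vector_Spaces.linear (*s) (*s) (\<lambda>x. m x y))"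

lemma bilinear_opI:
  assumes "\<And>x y z. m (x + y) z = m x z + m y z" "\<And>x y z. m x (y + z) = m x y + m x z"
    and "\<And>c x y. m (c *s x) y = c *s m x y" "\<And>c x y. m x (c *s y) = c *s m x y"
  shows "bilinear_op m"
  using assms by (simp add: bilinear_op_def linear_s_iff)

lemma bilinear_opD:
  assumes "bilinear_op m"
  shows "m (x + y) z = m x z + m y z" "m x (y + z) = m x y + m x z"
    and "m (c *s x) y = c *s m x y" "m x (c *s y) = c *s m x y"
    and "m 0 y = 0" "m x 0 = 0" "m (- x) y = - m x y" "m x (- y) = - m x y"
    and "m (x - y) z = m x z - m y z" "m x (y - z) = m x y - m x z"
proof -
  show a: "m (x + y) z = m x z + m y z" "m x (y + z) = m x y + m x z"
      "m (c *s x) y = c *s m x y" "m x (c *s y) = c *s m x y" for x y z c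
    using assms by (simp_all add: bilinear_op_def linear_s_iff)
  show z: "m 0 y = 0" "m x 0 = 0" for x y
    using a(3)[of 0 0 y] a(4)[of x 0 0] by simp_all
  show n: "m (- x) y = - m x y" "m x (- y) = - m x y" for x y
    using a(3)[of "-1" x y] a(4)[of x "-1" y] by simp_all
  show "m (x - y) z = m x z - m y z" "m x (y - z) = m x y - m x z"
    using a(1)[of x "- y" z] a(2)[of x y "- z"] by (simp_all add: n)
qed

lemma bilinear_assocI:
  fixes m :: "'i::finite cvec \<Rightarrow> 'i cvec \<Rightarrow> 'i cvec"
  assumes b: "bilinear_op m"
    and a: "\<And>i j k. m (m (basis i) (basis j)) (basis k) = m (basis i) (m (basis j) (basis k))"
  shows "m (m x y) z = m x (m y z)"
proof -
  have 1: "m (m (basis i) (basis j)) z = m (basis i) (m (basis j) z)" for i j z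
    by (rule linear_eqI[where f="\<lambda>z. m (m (basis i) (basis j)) z"])
      (simp_all add: linear_s_iff bilinear_opD[OF b] a)
  have 2: "m (m (basis i) y) z = m (basis i) (m y z)" for i y z
    by (rule linear_eqI[where f="\<lambda>y. m (m (basis i) y) z"])
      (simp_all add: linear_s_iff bilinear_opD[OF b] 1)
  show ?thesis
    by (rule linear_eqI[where f="\<lambda>x. m (m x y) z"])
      (simp_all add: linear_s_iff bilinear_opD[OF b] 2)
qed

lemma sum_basis_vec:
  fixes Z :: "'i::finite \<Rightarrow> 'j::finite \<Rightarrow> 'k::finite cvec"
  shows "(\<Sum>i\<in>UNIV. \<Sum>j\<in>UNIV. (basis k $ i * basis l $ j * c i j) *s Z i j) = c k l *s Z k l"
proof -
  have "(\<Sum>j\<in>UNIV. (basis k $ i * basis l $ j * c i j) *s Z i j) = (if i = k then c k l *s Z k l else 0)" for i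
    by (cases "i = k") (simp_all add: basis_nth mult_delta_left if_distrib[where f="\<lambda>a. a *s z" for z] cong: if_cong)
  then show ?thesis by simp
qed

lemma ten_nth: "(x \<otimes> y) $ (i, j) = x $ i * y $ j"
  by (simp add: ten_def)

lemma ten_simps:
  fixes x x' :: "'i::finite cvec" and y y' :: "'j::finite cvec"
  shows "(x + x') \<otimes> y = x \<otimes> y + x' \<otimes> y" "x \<otimes> (y + y') = x \<otimes> y + x \<otimes> y'"
    "(c *s x) \<otimes> y = c *s (x \<otimes> y)" "x \<otimes> (c *s y) = c *s (x \<otimes> y)"
  by (simp_all add: vec_eq_iff ten_def algebra_simps)

lemma ten_basis: "basis i \<otimes> basis j = basis (i, j)"
  by (auto simp: vec_eq_iff ten_def basis_nth)

subsection \<open>The superalgebra of a two-dimensional diagonal representation\<close>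

lemma two_less_one: "(2::2) < 1"
proof -
  have "(2::2) = 0" by simp
  then show ?thesis by (simp only: less_bit0_def bit0.Rep_0 bit0.Rep_1)
qed

lemma UNIV_set2: "(UNIV :: 2 set set) = {{}, {1}, {2}, {1,2}}"
proof -
  have "(UNIV :: 2 set set) = Pow {1,2}" by (simp only: Pow_UNIV UNIV_2[symmetric])
  also have "\<dots> = {{}, {1}, {2}, {1,2}}" by (simp add: Pow_insert) blast
  finally show ?thesis .
qed

lemma set2_cases: "(S :: 2 set) = {} \<or> S = {1} \<or> S = {2} \<or> S = {1,2}"
  using UNIV_set2 by blast

text \<open>In the numeral type \<open>2\<close> one has \<open>2 = 0 < 1\<close>, so the basis vector indexed by \<open>{1, 2}\<close> is \<open>v\<^sub>2 v\<^sub>1\<close>.\<close>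

definition wedge_coeff :: "'n::{finite,linorder} set \<Rightarrow> 'n set \<Rightarrow> complex"
  where "wedge_coeff S T = (if S \<inter> T = {} then (-1) ^ card {(i, j). i \<in> S \<and> j \<in> T \<and> j < i} else 0)"

lemma wedge_expand: "wedge x y = (\<Sum>S\<in>UNIV. \<Sum>T\<in>UNIV. (x $ S * y $ T * wedge_coeff S T) *s basis (S \<union> T))"
  unfolding wedge_def wedge_coeff_def by (intro sum.cong refl) simp

lemma wedge_basis: "wedge (basis S) (basis T) = wedge_coeff S T *s basis (S \<union> T)"
  unfolding wedge_expand by (rule sum_basis_vec)

lemma wedge_bilinear: "bilinear_op wedge"
  by (rule bilinear_opI)
    (simp_all add: wedge_expand algebra_simps vec.scale_left_distrib sum.distrib vec.scale_sum_right)

lemma wedge_coeff_2: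
  "wedge_coeff {} S = 1" "wedge_coeff S {} = 1"
  "wedge_coeff {1} {1::2} = 0" "wedge_coeff {2} {2::2} = 0" "wedge_coeff {1} {2::2} = -1"
  "wedge_coeff {2} {1::2} = 1"
  "wedge_coeff {1} {1,2::2} = 0" "wedge_coeff {2} {1,2::2} = 0" "wedge_coeff {1,2} {1,2::2} = 0"
  "wedge_coeff {1,2} {1::2} = 0" "wedge_coeff {1,2} {2::2} = 0"
proof -
  have 1: "{(i, j). i = (1::2) \<and> j = 2 \<and> j < i} = {(1,2)}" using two_less_one by auto
  have 2: "{(i, j). i = (2::2) \<and> j = 1 \<and> j < i} = {}" using two_less_one by auto
  show "wedge_coeff {1} {2::2} = -1" by (simp add: wedge_coeff_def 1)
  show "wedge_coeff {2} {1::2} = 1" by (simp add: wedge_coeff_def 2)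
qed (simp_all add: wedge_coeff_def)

text \<open>The cocycle identity behind associativity of the exterior algebra. Both sides vanish
  when two of the sets meet, so it can be applied inside larger scalar identities without case
  distinctions.\<close>

lemma wedge_coeff_assoc:
  "wedge_coeff S T * wedge_coeff (S \<union> T) R = wedge_coeff T R * wedge_coeff S (T \<union> R)" for S T R :: "2 set"
  using set2_cases[of S] set2_cases[of T] set2_cases[of R]
  by (elim disjE) (simp_all add: wedge_coeff_2 insert_commute)

lemma wedge_coeff_card: "wedge_coeff S T \<noteq> 0 \<Longrightarrow> card (S \<union> T) = card S + card T"
  by (simp add: wedge_coeff_def card_Un_disjoint split: if_splits)

text \<open>The character by which the group acts on the exterior monomial indexed by
  \<open>S\<close>.\<close>

definition char_set :: "('g \<Rightarrow> complex) \<Rightarrow> ('g \<Rightarrow> complex) \<Rightarrow> 2 set \<Rightarrow> 'g \<Rightarrow> complex"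
  where "char_set \<alpha> \<beta> S g = (if 1 \<in> S then \<alpha> g else 1) * (if 2 \<in> S then \<beta> g else 1)"

text \<open>\<open>char_set\<close> is multiplicative only on disjoint unions; the factor
  \<open>wedge_coeff\<close> is zero in the remaining cases. \<open>wedge_coeff_sign\<close> treats
  parities by the same device.\<close>

lemma char_set_Un: "wedge_coeff S T * char_set \<alpha> \<beta> (S \<union> T) g = wedge_coeff S T * (char_set \<alpha> \<beta> S g * char_set \<alpha> \<beta> T g)"
  using set2_cases[of S] set2_cases[of T]
  by (elim disjE) (simp_all add: wedge_coeff_2 char_set_def)

lemma ext_act_char_sum:
  fixes \<alpha> \<beta> :: "'g::{finite,group_add} \<Rightarrow> complex"
  shows "ext_act (char_sum \<alpha> \<beta>) g (basis S) = char_set \<alpha> \<beta> S g *s basis S"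
proof -
  have e: "ext_vec (char_sum \<alpha> \<beta> g *v basis 1) = \<alpha> g *s basis {1}"
    "ext_vec (char_sum \<alpha> \<beta> g *v basis 2) = \<beta> g *s basis {2}"
    by (simp_all add: ext_vec_def char_sum_def matrix_vector_mult_def sum_2 basis_nth)
  have l: "sorted_list_of_set {1::2,2} = [2,1]" using two_less_one by simp
  have "ext_act (char_sum \<alpha> \<beta>) g (basis S) = (\<Sum>T\<in>UNIV. if T = S then
      foldr wedge (map (\<lambda>i. ext_vec (char_sum \<alpha> \<beta> g *v basis i)) (sorted_list_of_set T)) (basis {}) else 0)"
    unfolding ext_act_def by (intro sum.cong refl) (simp add: basis_nth)
  also have "\<dots> = foldr wedge (map (\<lambda>i. ext_vec (char_sum \<alpha> \<beta> g *v basis i)) (sorted_list_of_set S)) (basis {})"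
    by simp
  also have "\<dots> = char_set \<alpha> \<beta> S g *s basis S"
    using set2_cases[of S]
    by (elim disjE) (simp_all add: e l bilinear_opD[OF wedge_bilinear] wedge_basis wedge_coeff_2 char_set_def
        insert_commute)
  finally show ?thesis .
qed

lemma smash_basis:
  fixes \<alpha> \<beta> :: "'g::{finite,group_add} \<Rightarrow> complex"
  shows "smash_mul (char_sum \<alpha> \<beta>) (basis (S, g)) (basis (T, h)) =
    (wedge_coeff S T * char_set \<alpha> \<beta> T g) *s basis (S \<union> T, g + h)"
proof -
  have "smash_mul (char_sum \<alpha> \<beta>) (basis (S, g)) (basis (T, h)) =
    wedge (basis S) (ext_act (char_sum \<alpha> \<beta>) g (basis T)) \<otimes> basis (g + h)"
    using sum_basis_vec[where k="(S,g)" and l="(T,h)" and c="\<lambda>_ _. 1" and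
      Z="\<lambda>p q. wedge (basis (fst p)) (ext_act (char_sum \<alpha> \<beta>) (snd p) (basis (fst q))) \<otimes> basis (snd p + snd q)"]
    by (simp add: smash_mul_def)
  then show ?thesis
    by (simp add: ext_act_char_sum bilinear_opD[OF wedge_bilinear] wedge_basis ten_simps
        ten_basis mult.commute)
qed

lemma super_mul2_bilinear: "bilinear_op (super_mul2 \<rho>)"
  by (rule bilinear_opI)
    (simp_all add: super_mul2_def algebra_simps vec.scale_left_distrib sum.distrib vec.scale_sum_right)

lemma super_mul2_basis:
  fixes \<alpha> \<beta> :: "'g::{finite,group_add} \<Rightarrow> complex"
  shows "super_mul2 (char_sum \<alpha> \<beta>) (basis ((S, g), (T, h))) (basis ((S', g'), (T', h'))) =
    ((-1) ^ (card T * card S') * (wedge_coeff S S' * char_set \<alpha> \<beta> S' g) * (wedge_coeff T T' * char_set \<alpha> \<beta> T' h))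
      *s basis ((S \<union> S', g + g'), (T \<union> T', h + h'))"
proof -
  have "super_mul2 (char_sum \<alpha> \<beta>) (basis ((S, g), (T, h))) (basis ((S', g'), (T', h'))) =
    (-1) ^ (card T * card S') *s (smash_mul (char_sum \<alpha> \<beta>) (basis (S, g)) (basis (S', g'))
      \<otimes> smash_mul (char_sum \<alpha> \<beta>) (basis (T, h)) (basis (T', h')))"
    using sum_basis_vec[where k="((S, g), (T, h))" and l="((S', g'), (T', h'))" and
      c="\<lambda>p q. (-1) ^ (parity (snd p) * parity (fst q))" and
      Z="\<lambda>p q. smash_mul (char_sum \<alpha> \<beta>) (basis (fst p)) (basis (fst q))
        \<otimes> smash_mul (char_sum \<alpha> \<beta>) (basis (snd p)) (basis (snd q))"]
    by (simp add: super_mul2_def parity_def mult.assoc mult.commute mult.left_commute)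
  then show ?thesis
    by (simp add: smash_basis ten_simps ten_basis mult.assoc mult.commute mult.left_commute)
qed

lemma wedge_coeff_sign:
  "wedge_coeff S T * (-1) ^ (card (S \<union> T) * k) = wedge_coeff S T * ((-1) ^ (card S * k) * (-1) ^ (card T * k))"
  by (cases "wedge_coeff S T = 0") (simp_all add: wedge_coeff_card power_add add_mult_distrib)

text \<open>A structure constant is a Koszul sign times two wedge coefficients times two characters.
  Where the wedge coefficients are nonzero, each kind of factor satisfies a cocycle identity by
  itself, so the calculation only regroups them.\<close>

lemma super_mul2_assoc:
  fixes \<alpha> \<beta> :: "'g::{finite,group_add} \<Rightarrow> complex"
  assumes "\<And>g h. \<alpha> (g + h) = \<alpha> g * \<alpha> h" "\<And>g h. \<beta> (g + h) = \<beta> g * \<beta> h"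
  shows "super_mul2 (char_sum \<alpha> \<beta>) (super_mul2 (char_sum \<alpha> \<beta>) X Y) Z =
    super_mul2 (char_sum \<alpha> \<beta>) X (super_mul2 (char_sum \<alpha> \<beta>) Y Z)"
proof (rule bilinear_assocI[OF super_mul2_bilinear])
  have c: "char_set \<alpha> \<beta> S (g + h) = char_set \<alpha> \<beta> S g * char_set \<alpha> \<beta> S h" for S g h
    by (simp add: char_set_def assms)
  fix i j k :: "(2 set \<times> 'g) \<times> (2 set \<times> 'g)"
  obtain S g T h S' g' T' h' S'' g'' T'' h'' where
    [simp]: "i = ((S, g), (T, h))" "j = ((S', g'), (T', h'))" "k = ((S'', g''), (T'', h''))"
    by (metis prod.exhaust)
  let ?w = "wedge_coeff" and ?c = "char_set \<alpha> \<beta>" and ?s = "\<lambda>T S. (-1) ^ (card T * card S) :: complex"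
  have "(?s T S' * (?w S S' * ?c S' g) * (?w T T' * ?c T' h)) *
      (?s (T \<union> T') S'' * (?w (S \<union> S') S'' * ?c S'' (g + g')) * (?w (T \<union> T') T'' * ?c T'' (h + h')))
    = ?s T S' * ?c S' g * ?c T' h * ?c S'' (g + g') * ?c T'' (h + h') * (?w T T' * ?s (T \<union> T') S'') *
      (?w S S' * ?w (S \<union> S') S'') * ?w (T \<union> T') T''"
    by (simp only: mult_ac)
  also have "\<dots> = ?s T S' * ?s T S'' * ?s T' S'' * ?c S' g * ?c T' h * ?c S'' (g + g') * ?c T'' (h + h') *
      (?w S S' * ?w (S \<union> S') S'') * (?w T T' * ?w (T \<union> T') T'')"
    by (simp only: wedge_coeff_sign) (simp only: mult_ac)
  also have "\<dots> = ?s T S' * ?s T S'' * ?s T' S'' * ?c S' g * ?c T' h * (?c S'' g * ?c S'' g') * (?c T'' h * ?c T'' h') *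
      (?w S' S'' * ?w S (S' \<union> S'')) * (?w T' T'' * ?w T (T' \<union> T''))"
    by (simp only: wedge_coeff_assoc c)
  also have "\<dots> = ?s T' S'' * ?c S'' g' * ?c T'' h' * ?w S (S' \<union> S'') * ?w T (T' \<union> T'')
      * (?w S' S'' * (?s S' T * ?s S'' T)) * (?c S' g * ?c S'' g) * (?w T' T'' * (?c T' h * ?c T'' h))"
    by (simp only: mult_ac)
  also have "\<dots> = ?s T' S'' * ?c S'' g' * ?c T'' h' * ?w S (S' \<union> S'') * ?w T (T' \<union> T'')
      * ?s (S' \<union> S'') T * (?w S' S'' * (?c S' g * ?c S'' g)) * (?w T' T'' * (?c T' h * ?c T'' h))"
    by (simp only: wedge_coeff_sign[symmetric]) (simp only: mult_ac)
  also have "\<dots> = (?s T' S'' * (?w S' S'' * ?c S'' g') * (?w T' T'' * ?c T'' h')) *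
      (?s T (S' \<union> S'') * (?w S (S' \<union> S'') * ?c (S' \<union> S'') g) * (?w T (T' \<union> T'') * ?c (T' \<union> T'') h))"
    by (simp only: char_set_Un[symmetric]) (simp only: mult_ac)
  finally show "super_mul2 (char_sum \<alpha> \<beta>) (super_mul2 (char_sum \<alpha> \<beta>) (basis i) (basis j)) (basis k) =
      super_mul2 (char_sum \<alpha> \<beta>) (basis i) (super_mul2 (char_sum \<alpha> \<beta>) (basis j) (basis k))"
    by (simp add: super_mul2_basis bilinear_opD[OF super_mul2_bilinear] Un_assoc add.assoc)
qed

section \<open>The coproduct twisted by the exponential of B\<close>

locale char_data =
  fixes \<alpha> \<beta> :: "'g::{finite,ab_group_add} \<Rightarrow> complex" and u :: 'g
  assumes \<alpha>_add: "\<alpha> (g + h) = \<alpha> g * \<alpha> h" and \<beta>_add: "\<beta> (g + h) = \<beta> g * \<beta> h"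
    and \<alpha>_0: "\<alpha> 0 = 1" and \<beta>_0: "\<beta> 0 = 1"
    and \<alpha>_u: "\<alpha> u = -1" and \<beta>_u: "\<beta> u = -1" and u_u: "u + u = 0"
begin

abbreviation smul (infixl "\<odot>" 70) where "smul \<equiv> super_mul2 (char_sum \<alpha> \<beta>)"

abbreviation pr :: "2 set \<Rightarrow> 'g \<Rightarrow> 2 set \<Rightarrow> 'g \<Rightarrow> ((2 set \<times> 'g) \<times> (2 set \<times> 'g)) cvec"
  where "pr S g T h \<equiv> basis ((S, g), (T, h))"

text \<open>The exponential of \<open>a v\<^sub>1 \<otimes> v\<^sub>1 + b (v\<^sub>1 \<otimes> v\<^sub>2 + v\<^sub>2 \<otimes> v\<^sub>1) + c v\<^sub>2 \<otimes> v\<^sub>2\<close>.\<close>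

definition expq :: "complex \<Rightarrow> complex \<Rightarrow> complex \<Rightarrow> ((2 set \<times> 'g) \<times> (2 set \<times> 'g)) cvec"
  where "expq a b c = pr {} 0 {} 0 + a *s pr {1} 0 {1} 0 + b *s pr {1} 0 {2} 0 + b *s pr {2} 0 {1} 0
    + c *s pr {2} 0 {2} 0 + (b\<^sup>2 - a * c) *s pr {1,2} 0 {1,2} 0"

lemma char_set_simps:
  "char_set \<alpha> \<beta> {} g = 1" "char_set \<alpha> \<beta> {1} g = \<alpha> g" "char_set \<alpha> \<beta> {2} g = \<beta> g"
  "char_set \<alpha> \<beta> {1,2} g = \<alpha> g * \<beta> g" "char_set \<alpha> \<beta> S 0 = 1"
  by (simp_all add: char_set_def \<alpha>_0 \<beta>_0)

lemma card_12: "card {1::2,2} = 2" by simp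

lemma numeral_times_vec: "numeral n * (v :: 'i::finite cvec) = numeral n *s v"
  by (simp add: vec_eq_iff)

lemmas smul_simps = numeral_times_vec bilinear_opD[OF super_mul2_bilinear] super_mul2_basis wedge_coeff_2 char_set_simps insert_commute
  vec.scale_left_distrib vec.scale_right_distrib vec.scale_left_diff_distrib vec.scale_right_diff_distrib

text \<open>Elements of bidegree (1, 1) commute in the super tensor square, so their exponentials
  multiply by adding exponents.\<close>

lemma expq_mult: "expq a b c \<odot> expq a' b' c' = expq (a + a') (b + b') (c + c')"
  by (simp add: expq_def smul_simps algebra_simps power2_eq_square)

lemma expq_0: "expq 0 0 0 = pr {} 0 {} 0"
  by (simp add: expq_def)

lemma smul_one: "pr {} 0 {} 0 \<odot> X = X" "X \<odot> pr {} 0 {} 0 = X"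
proof -
  have l: "Vector_Spaces.linear (*s) (*s) (\<lambda>X. pr {} 0 {} 0 \<odot> X)"
    "Vector_Spaces.linear (*s) (*s) (\<lambda>X. X \<odot> pr {} 0 {} 0)" "Vector_Spaces.linear (*s) (*s) (\<lambda>X::((2 set \<times> 'g) \<times> (2 set \<times> 'g)) cvec. X)"
    by (simp_all add: linear_s_iff bilinear_opD[OF super_mul2_bilinear])
  have b: "pr {} 0 {} 0 \<odot> basis i = basis i" "basis i \<odot> pr {} 0 {} 0 = basis i" for i
    by (cases i; simp add: smul_simps split_paired_all)+
  show "pr {} 0 {} 0 \<odot> X = X" by (rule linear_eqI[OF l(1) l(3)]) (rule b)
  show "X \<odot> pr {} 0 {} 0 = X" by (rule linear_eqI[OF l(2) l(3)]) (rule b)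
qed

lemma smul_assoc: "(X \<odot> Y) \<odot> Z = X \<odot> (Y \<odot> Z)"
  by (rule super_mul2_assoc[OF \<alpha>_add \<beta>_add])

text \<open>Moving a group-like element past the exponential replaces \<open>B\<close> by its image
  under \<open>g\<close>. This is the source of the matrices gB - B.\<close>

lemma grp_expq: "pr {} g {} g \<odot> expq a b c = expq ((\<alpha> g)\<^sup>2 * a) (\<alpha> g * \<beta> g * b) ((\<beta> g)\<^sup>2 * c) \<odot> pr {} g {} g"
  by (simp add: expq_def smul_simps algebra_simps power2_eq_square)

definition coprim :: "2 \<Rightarrow> ((2 set \<times> 'g) \<times> (2 set \<times> 'g)) cvec"
  where "coprim i = pr {i} 0 {} 0 + pr {} 0 {i} 0"

text \<open>A primitive odd element anticommutes with every exterior generator of either leg, and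
  each term of the exponential contains an even number of these. Hence the twist leaves the
  coproduct of V alone.\<close>

lemma coprim_expq: "coprim i \<odot> expq a b c = expq a b c \<odot> coprim i"
proof -
  have "i = 1 \<or> i = 2" by (rule exhaust_2)
  then show ?thesis
    by (elim disjE) (simp_all add: coprim_def expq_def smul_simps algebra_simps power2_eq_square)
qed

lemma vec_elt_basis: "vec_elt (basis i) = (basis ({i}, 0) :: (2 set \<times> 'g) cvec)"
proof -
  have "i = 1 \<or> i = 2" by (rule exhaust_2)
  then show ?thesis
    by (elim disjE) (simp_all add: vec_elt_def ext_vec_def sum_2 basis_nth ten_basis)
qed

lemma grp_elt_ten: "grp_elt g \<otimes> grp_elt h = pr {} g {} h"
  by (simp add: grp_elt_def ten_basis)

definition bvec :: "complex \<Rightarrow> complex \<Rightarrow> complex \<Rightarrow> (2 \<times> 2) cvec"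
  where "bvec a b c = (\<chi> i. if i = (1,1) then a else if i = (2,2) then c else b)"

lemma sum_pair: "sum f (UNIV :: ('a::finite \<times> 'b::finite) set) = (\<Sum>i\<in>UNIV. \<Sum>j\<in>UNIV. f (i, j))"
  by (simp add: sum.cartesian_product)

lemma sum_22: "sum f (UNIV :: (2 \<times> 2) set) = f (1,1) + f (1,2) + f (2,1) + f (2,2)"
  by (simp add: sum_pair sum_2 add.assoc)

text \<open>The top coefficient comes from half the square of \<open>B\<close>; the Koszul sign of
  the super tensor square turns it into minus the determinant of \<open>B\<close>.\<close>

lemma exp_twist_bvec: "exp_twist (char_sum \<alpha> \<beta>) (bvec a b c) = expq a b c"
proof -
  have B: "ten_map vec_elt vec_elt (bvec a b c) = a *s pr {1} 0 {1} 0 + b *s pr {1} 0 {2} 0 + b *s pr {2} 0 {1} 0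
      + c *s pr {2} 0 {2} 0"
    by (simp add: ten_map_def sum_22 bvec_def vec_elt_basis ten_basis)
  have s: "{..2::nat} = {0,1,2}" by auto
  show ?thesis
    unfolding exp_twist_def B expq_def grp_elt_ten
    by (simp add: s eval_nat_numeral smul_one smul_simps algebra_simps)
qed

definition cop :: "2 set \<Rightarrow> ((2 set \<times> 'g) \<times> (2 set \<times> 'g)) cvec"
  where "cop S = foldr (super_mul2 (char_sum \<alpha> \<beta>)) (map coprim (sorted_list_of_set S)) (pr {} 0 {} 0)"

lemma foldr_smul: "foldr (super_mul2 (char_sum \<alpha> \<beta>)) xs X = foldr (super_mul2 (char_sum \<alpha> \<beta>)) xs (pr {} 0 {} 0) \<odot> X"
  by (induction xs) (simp_all add: smul_one smul_assoc)

lemma super_comul_basis: "super_comul (char_sum \<alpha> \<beta>) (basis (S, g)) = cop S \<odot> pr {} g {} g"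
proof -
  have "super_comul (char_sum \<alpha> \<beta>) (basis (S, g)) = (\<Sum>p\<in>UNIV. if p = (S, g) then
     foldr (super_mul2 (char_sum \<alpha> \<beta>))
      (map (\<lambda>i. vec_elt (basis i) \<otimes> grp_elt 0 + grp_elt 0 \<otimes> vec_elt (basis i))
        (sorted_list_of_set (fst p)))
      (grp_elt (snd p) \<otimes> grp_elt (snd p)) else 0)"
    unfolding super_comul_def by (intro sum.cong refl) (simp add: basis_nth)
  also have "\<dots> = foldr (super_mul2 (char_sum \<alpha> \<beta>)) (map coprim (sorted_list_of_set S)) (pr {} g {} g)"
    by (simp add: vec_elt_basis grp_elt_def ten_basis coprim_def[abs_def])
  finally show ?thesis unfolding cop_def by (simp add: foldr_smul[of _ "pr {} g {} g"])
qed

lemma cop_expq: "cop S \<odot> expq a b c = expq a b c \<odot> cop S"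
proof -
  have "foldr (super_mul2 (char_sum \<alpha> \<beta>)) (map coprim xs) (pr {} 0 {} 0) \<odot> expq a b c =
    expq a b c \<odot> foldr (super_mul2 (char_sum \<alpha> \<beta>)) (map coprim xs) (pr {} 0 {} 0)" for xs
    by (induction xs) (simp_all add: smul_one smul_assoc, metis smul_assoc coprim_expq)
  then show ?thesis by (simp add: cop_def)
qed

lemma inverse_expq: "inverse_in (super_mul2 (char_sum \<alpha> \<beta>)) (pr {} 0 {} 0) (expq a b c) = expq (-a) (-b) (-c)"
  unfolding inverse_in_def
proof (rule the_equality)
  show i: "is_inverse (super_mul2 (char_sum \<alpha> \<beta>)) (pr {} 0 {} 0) (expq a b c) (expq (-a) (-b) (-c))"
    by (simp add: is_inverse_def expq_mult expq_0)
  fix y assume "is_inverse (super_mul2 (char_sum \<alpha> \<beta>)) (pr {} 0 {} 0) (expq a b c) y"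
  then show "y = expq (-a) (-b) (-c)"
    using i by (metis is_inverse_def smul_assoc smul_one)
qed

text \<open>The exponential commutes with \<open>cop S\<close>, so conjugation affects only the
  group-like factor, which acquires the exponential of gB - B.\<close>

lemma super_comul_twisted_basis:
  "super_comul_twisted (char_sum \<alpha> \<beta>) (bvec a b c) (basis (S, g)) =
    cop S \<odot> (expq (((\<alpha> g)\<^sup>2 - 1) * a) ((\<alpha> g * \<beta> g - 1) * b) (((\<beta> g)\<^sup>2 - 1) * c) \<odot> pr {} g {} g)"
proof -
  have "super_comul_twisted (char_sum \<alpha> \<beta>) (bvec a b c) (basis (S, g)) =
    expq (-a) (-b) (-c) \<odot> (cop S \<odot> (pr {} g {} g \<odot> expq a b c))"
    by (simp add: super_comul_twisted_def grp_elt_ten exp_twist_bvec inverse_expq super_comul_basis smul_assoc)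
  also have "\<dots> = cop S \<odot> ((expq (-a) (-b) (-c) \<odot> expq ((\<alpha> g)\<^sup>2 * a) (\<alpha> g * \<beta> g * b) ((\<beta> g)\<^sup>2 * c)) \<odot> pr {} g {} g)"
    by (simp only: grp_expq smul_assoc[symmetric] cop_expq[symmetric])
  finally show ?thesis by (simp add: expq_mult algebra_simps)
qed

end

subsection \<open>The dual Hopf algebra in coordinates\<close>

lemma ten_mul_bilinear: "bilinear_op (ten_mul m n)"
  by (rule bilinear_opI)
    (simp_all add: ten_mul_def algebra_simps vec.scale_left_distrib sum.distrib vec.scale_sum_right)

lemma ten_mul_basis: "ten_mul m n (basis (i, j)) (basis (k, l)) = m (basis i) (basis k) \<otimes> n (basis j) (basis l)"
  using sum_basis_vec[where k="(i, j)" and l="(k, l)" and c="\<lambda>_ _. 1" and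
      Z="\<lambda>p q. m (basis (fst p)) (basis (fst q)) \<otimes> n (basis (snd p)) (basis (snd q))"]
  by (simp add: ten_mul_def)

lemma ten_minus: "(- x) \<otimes> y = - (x \<otimes> y)" "x \<otimes> (- y) = - (x \<otimes> y)"
  by (simp_all add: vec_eq_iff ten_def)

lemma snd_even_simps:
  "snd_even (X + Y) = snd_even X + snd_even Y" "snd_even (X - Y) = snd_even X - snd_even Y"
  "snd_even (c *s X) = c *s snd_even X" "snd_even (- X) = - snd_even X"
  "snd_even (basis (i, (S, g))) = (if even (card S) then basis (i, (S, g)) else 0)"
  by (auto simp: snd_even_def vec_eq_iff basis_nth parity_def)

lemma snd_odd_simps:
  "snd_odd (X + Y) = snd_odd X + snd_odd Y" "snd_odd (X - Y) = snd_odd X - snd_odd Y"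
  "snd_odd (c *s X) = c *s snd_odd X" "snd_odd (- X) = - snd_odd X"
  "snd_odd (basis (i, (S, g))) = (if odd (card S) then basis (i, (S, g)) else 0)"
  by (auto simp: snd_odd_def vec_eq_iff basis_nth parity_def)

lemma pairing_simps:
  "pairing \<phi> (x + y) = pairing \<phi> x + pairing \<phi> y" "pairing \<phi> (x - y) = pairing \<phi> x - pairing \<phi> y"
  "pairing \<phi> (c *s x) = c * pairing \<phi> x" "pairing \<phi> (- x) = - pairing \<phi> x" "pairing \<phi> 0 = 0"
  by (simp_all add: pairing_def algebra_simps sum.distrib sum_subtractf sum_distrib_left sum_negf)

lemma pairing_basis: "pairing \<phi> (basis i) = \<phi> $ i"
  by (simp add: pairing_def basis_nth mult_delta_right)

locale char_quad = char_data \<alpha> \<beta> u for \<alpha> \<beta> :: "'g::{finite,ab_group_add} \<Rightarrow> complex" and u +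
  fixes p q r :: complex
begin

definition H :: "(2 set \<times> 'g) hopf_ops"
  where "H = hopf_dual (A_hopf (char_sum \<alpha> \<beta>) u (bvec p q r))"

text \<open>The entries of the symmetric matrix \<open>gB - B\<close>.\<close>

definition Qa :: "'g \<Rightarrow> complex" where "Qa g = ((\<alpha> g)\<^sup>2 - 1) * p"
definition Qm :: "'g \<Rightarrow> complex" where "Qm g = (\<alpha> g * \<beta> g - 1) * q"
definition Qb :: "'g \<Rightarrow> complex" where "Qb g = ((\<beta> g)\<^sup>2 - 1) * r"

lemma cop_simps:
  "cop {} = pr {} 0 {} 0" "cop {1} = coprim 1" "cop {2} = coprim 2" "cop {1,2} = coprim 2 \<odot> coprim 1"
  using two_less_one by (simp_all add: cop_def smul_one not_le[symmetric])

lemma A_comul_basis: "A_comul (char_sum \<alpha> \<beta>) u B (basis (S, g)) =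
   snd_even (super_comul_twisted (char_sum \<alpha> \<beta>) B (basis (S, g))) - (-1) ^ card S *s
      ten_mul (smash_mul (char_sum \<alpha> \<beta>)) (smash_mul (char_sum \<alpha> \<beta>)) (pr {} u {} 0)
        (snd_odd (super_comul_twisted (char_sum \<alpha> \<beta>) B (basis (S, g))))"
proof -
  have "A_comul (char_sum \<alpha> \<beta>) u B (basis (S, g)) = (\<Sum>p\<in>UNIV. if p = (S, g) then
    snd_even (super_comul_twisted (char_sum \<alpha> \<beta>) B (basis p)) - (-1) ^ parity p *s
      ten_mul (smash_mul (char_sum \<alpha> \<beta>)) (smash_mul (char_sum \<alpha> \<beta>)) (pr {} u {} 0)
        (snd_odd (super_comul_twisted (char_sum \<alpha> \<beta>) B (basis p))) else 0)"
    unfolding A_comul_def grp_elt_ten by (intro sum.cong refl) (simp add: basis_nth)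
  then show ?thesis by (simp add: parity_def)
qed

lemma hmul_H: "hmul H \<phi> \<psi> $ i = pairing (\<phi> \<otimes> \<psi>) (A_comul (char_sum \<alpha> \<beta>) u (bvec p q r) (basis i))"
  by (simp add: H_def hopf_dual_def A_hopf_def)

lemmas dual_simps = hmul_H A_comul_basis super_comul_twisted_basis cop_simps coprim_def expq_def smul_simps
  snd_even_simps snd_odd_simps bilinear_opD[OF ten_mul_bilinear] ten_mul_basis smash_basis ten_simps ten_minus ten_basis
  pairing_simps pairing_basis ten_nth char_set_simps \<alpha>_u \<beta>_u

text \<open>The Clifford product in coordinates. The argument of the first factor is shifted by
  \<open>u\<close> exactly when the second index has odd degree, because the coproduct of A carries
  a factor \<open>u\<close> in its first leg there.\<close>

lemma hmul_nth:
  "hmul H \<phi> \<psi> $ ({}, g) = \<phi> $ ({}, g) * \<psi> $ ({}, g)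
    + Qa g * \<phi> $ ({1}, g + u) * \<psi> $ ({1}, g)
    + Qm g * (\<phi> $ ({1}, g + u) * \<psi> $ ({2}, g) + \<phi> $ ({2}, g + u) * \<psi> $ ({1}, g))
    + Qb g * \<phi> $ ({2}, g + u) * \<psi> $ ({2}, g)
    + ((Qm g)\<^sup>2 - Qa g * Qb g) * \<phi> $ ({1,2}, g) * \<psi> $ ({1,2}, g)"
  "hmul H \<phi> \<psi> $ ({1}, g) = \<phi> $ ({1}, g) * \<psi> $ ({}, g) + \<phi> $ ({}, g + u) * \<psi> $ ({1}, g)
    - \<phi> $ ({1,2}, g + u) * (Qm g * \<psi> $ ({1}, g) + Qb g * \<psi> $ ({2}, g))
    + (Qm g * \<phi> $ ({1}, g) + Qb g * \<phi> $ ({2}, g)) * \<psi> $ ({1,2}, g)"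
  "hmul H \<phi> \<psi> $ ({2}, g) = \<phi> $ ({2}, g) * \<psi> $ ({}, g) + \<phi> $ ({}, g + u) * \<psi> $ ({2}, g)
    + \<phi> $ ({1,2}, g + u) * (Qa g * \<psi> $ ({1}, g) + Qm g * \<psi> $ ({2}, g))
    - (Qa g * \<phi> $ ({1}, g) + Qm g * \<phi> $ ({2}, g)) * \<psi> $ ({1,2}, g)"
  "hmul H \<phi> \<psi> $ ({1,2}, g) = \<phi> $ ({1,2}, g) * \<psi> $ ({}, g) + \<phi> $ ({}, g) * \<psi> $ ({1,2}, g)
    + \<phi> $ ({2}, g + u) * \<psi> $ ({1}, g) - \<phi> $ ({1}, g + u) * \<psi> $ ({2}, g)"
  unfolding Qa_def Qm_def Qb_def
  by (simp_all add: dual_simps add.commute[of u g] card_12 algebra_simps power2_eq_square)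

lemma hcomul_nth: "hcomul H \<phi> $ ((S, g), (T, h)) = wedge_coeff S T * char_set \<alpha> \<beta> T g * \<phi> $ (S \<union> T, g + h)"
  by (simp add: H_def hopf_dual_def A_hopf_def smash_basis pairing_simps pairing_basis)

lemma hone_nth: "hone H $ (S, g) = (if S = {} then 1 else 0)"
  by (simp add: H_def hopf_dual_def A_hopf_def smash_counit_def basis_nth)

lemma hcounit_nth: "hcounit H \<phi> = \<phi> $ ({}, 0)"
  by (simp add: H_def hopf_dual_def A_hopf_def grp_elt_def pairing_basis)

end

section \<open>Equality on bases and slices of tensors\<close>

lemma functional_eqI:
  fixes F G :: "'i::finite cvec \<Rightarrow> complex"
  assumes "\<And>x y. F (x + y) = F x + F y" "\<And>c x. F (c *s x) = c * F x"
    and "\<And>x y. G (x + y) = G x + G y" "\<And>c x. G (c *s x) = c * G x"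
    and "\<And>i. F (basis i) = G (basis i)"
  shows "F x = G x"
proof -
  have "(\<chi> i::'i. F x) = (\<chi> i. G x)"
    by (rule linear_eqI[where f="\<lambda>x. \<chi> i::'i. F x" and g="\<lambda>x. \<chi> i. G x"])
      (simp_all add: linear_s_iff assms vec_eq_iff)
  then show ?thesis by (simp add: vec_eq_iff)
qed

lemma bilinear_eqI:
  fixes m n :: "'i::finite cvec \<Rightarrow> 'i cvec \<Rightarrow> 'k::finite cvec"
  assumes m: "bilinear_op m" and n: "bilinear_op n"
    and b: "\<And>i j. m (basis i) (basis j) = n (basis i) (basis j)"
  shows "m x y = n x y"
proof -
  have "m (basis i) y = n (basis i) y" for i
    using m n by (rule_tac linear_eqI[where f="m (basis i)"]) (simp_all add: bilinear_op_def b)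
  then show ?thesis
    using m n by (rule_tac linear_eqI[where f="\<lambda>x. m x y"]) (simp_all add: bilinear_op_def)
qed

lemma sum_basis1: "(\<Sum>i\<in>UNIV. basis k $ i *s Z i) = (Z k :: 'j::finite cvec)"
proof -
  have "(\<Sum>i\<in>UNIV. basis k $ i *s Z i) = (\<Sum>i\<in>UNIV. if i = k then Z i else 0)"
    by (intro sum.cong refl) (simp add: basis_nth)
  then show ?thesis by simp
qed

text \<open>Fixing one index of a tensor leaves a vector, to which the coordinate formulas of the
  other leg apply.\<close>

definition slice1 :: "'i::finite \<Rightarrow> ('i \<times> 'j::finite) cvec \<Rightarrow> 'j cvec"
  where "slice1 i X = (\<chi> j. X $ (i, j))"

definition slice2 :: "'j::finite \<Rightarrow> ('i::finite \<times> 'j) cvec \<Rightarrow> 'i cvec"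
  where "slice2 j X = (\<chi> i. X $ (i, j))"

lemma slice1_nth: "slice1 i X $ j = X $ (i, j)"
  and slice2_nth: "slice2 j X $ i = X $ (i, j)"
  by (simp_all add: slice1_def slice2_def)

lemma slice1_simps: "slice1 i (X + Y) = slice1 i X + slice1 i Y" "slice1 i (c *s X) = c *s slice1 i X"
  and slice2_simps: "slice2 j (X + Y) = slice2 j X + slice2 j Y" "slice2 j (c *s X) = c *s slice2 j X"
  by (simp_all add: slice1_def slice2_def vec_eq_iff)

lemma slice1_ten: "slice1 i (x \<otimes> y) = x $ i *s y"
  and slice2_ten: "slice2 j (x \<otimes> y) = y $ j *s x"
  by (simp_all add: slice1_def slice2_def ten_def vec_eq_iff)

lemma slice1_basis: "slice1 i (basis (k, l)) = basis k $ i *s basis l"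
  and slice2_basis: "slice2 j (basis (k, l)) = basis l $ j *s basis k"
  by (simp_all add: slice1_ten[of i "basis k" "basis l", unfolded ten_basis] slice2_ten[of j "basis k" "basis l", unfolded ten_basis])

lemma ten_map_linear: "Vector_Spaces.linear (*s) (*s) (ten_map f g)"
  by (simp add: linear_s_iff ten_map_def vec.scale_left_distrib sum.distrib vec.scale_sum_right)

lemma ten_map_basis: "ten_map f g (basis (i, j)) = f (basis i) \<otimes> g (basis j)"
  unfolding ten_map_def by (simp only: sum_basis1 fst_conv snd_conv)

lemma ten_map_id_right:
  fixes f :: "'i::finite cvec \<Rightarrow> 'k::finite cvec" and X :: "('i \<times> 'j::finite) cvec"
  assumes "Vector_Spaces.linear (*s) (*s) f"
  shows "slice2 j (ten_map f id X) = f (slice2 j X)"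
proof (rule linear_eqI[where f="\<lambda>X. slice2 j (ten_map f id X)"])
  have f: "f (x + y) = f x + f y" "f (c *s x) = c *s f x" for x y c
    using assms by (simp_all add: linear_s_iff)
  show "Vector_Spaces.linear (*s) (*s) (\<lambda>X. slice2 j (ten_map f id X :: ('k \<times> 'j) cvec))"
    using ten_map_linear[of f "id :: 'j cvec \<Rightarrow> _"] by (simp add: linear_s_iff slice2_simps)
  show "Vector_Spaces.linear (*s) (*s) (\<lambda>X. f (slice2 j (X :: ('i \<times> 'j) cvec)))"
    by (simp add: linear_s_iff slice2_simps f)
  show "slice2 j (ten_map f id (basis i)) = f (slice2 j (basis i))" for i :: "'i \<times> 'j"
    by (cases i) (simp add: ten_map_basis slice2_ten slice2_basis f)
qed

lemma ten_map_id_left: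
  fixes f :: "'j::finite cvec \<Rightarrow> 'k::finite cvec" and X :: "('i::finite \<times> 'j::finite) cvec"
  assumes "Vector_Spaces.linear (*s) (*s) f"
  shows "slice1 i (ten_map id f X) = f (slice1 i X)"
proof (rule linear_eqI[where f="\<lambda>X. slice1 i (ten_map id f X)"])
  have f: "f (x + y) = f x + f y" "f (c *s x) = c *s f x" for x y c
    using assms by (simp_all add: linear_s_iff)
  show "Vector_Spaces.linear (*s) (*s) (\<lambda>X. slice1 i (ten_map id f X :: ('i \<times> 'k) cvec))"
    using ten_map_linear[of "id :: 'i cvec \<Rightarrow> _" f] by (simp add: linear_s_iff slice1_simps)
  show "Vector_Spaces.linear (*s) (*s) (\<lambda>X. f (slice1 i (X :: ('i \<times> 'j) cvec)))"
    by (simp add: linear_s_iff slice1_simps f)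
  show "slice1 i (ten_map id f (basis k)) = f (slice1 i (basis k))" for k :: "'i \<times> 'j"
    by (cases k) (simp add: ten_map_basis slice1_ten slice1_basis f)
qed

lemma ten_map_id_nth:
  assumes "Vector_Spaces.linear (*s) (*s) f"
  shows "ten_map f id X $ (k, j) = f (slice2 j X) $ k" "ten_map id f X $ (i, k) = f (slice1 i X) $ k"
  using ten_map_id_right[OF assms, of j X] ten_map_id_left[OF assms, of i X]
  by (metis slice2_nth, metis slice1_nth)

lemma ten_assoc_nth: "ten_assoc X $ ((i, j), k) = X $ (i, (j, k))"
  by (simp add: ten_assoc_def)

section \<open>The Hopf algebra axioms for the dual\<close>

context char_quad
begin

lemma set_21: "{2, 1::2} = {1, 2}" by auto

lemma cvec_eqI:
  assumes "\<And>g. x $ ({}, g) = y $ ({}, g)" "\<And>g. x $ ({1}, g) = y $ ({1}, g)"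
    "\<And>g. x $ ({2}, g) = y $ ({2}, g)" "\<And>g. x $ ({1,2}, g) = y $ ({1,2}, g)"
  shows "x = (y :: (2 set \<times> 'g) cvec)"
proof -
  have "x $ (S, g) = y $ (S, g)" for S g
    using set2_cases[of S] assms by metis
  then show ?thesis by (simp add: vec_eq_iff split_paired_all)
qed

lemma add_u_u: "g + u + u = g" "u + (u + g) = g" "u + u = 0"
  using u_u by (simp_all add: add.assoc add.assoc[symmetric, of u u])

lemma \<alpha>_nz: "\<alpha> g \<noteq> 0" and \<beta>_nz: "\<beta> g \<noteq> 0"
  using \<alpha>_add[of g "- g"] \<beta>_add[of g "- g"] by (auto simp: \<alpha>_0 \<beta>_0)

lemma char_minus: "\<alpha> (- g) = 1 / \<alpha> g" "\<beta> (- g) = 1 / \<beta> g"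
  using \<alpha>_add[of g "- g"] \<beta>_add[of g "- g"] \<alpha>_nz[of g] \<beta>_nz[of g] by (simp_all add: \<alpha>_0 \<beta>_0 field_simps)

lemma Q_add_u: "Qa (g + u) = Qa g" "Qm (g + u) = Qm g" "Qb (g + u) = Qb g"
  "Qa (u + g) = Qa g" "Qm (u + g) = Qm g" "Qb (u + g) = Qb g"
  by (simp_all add: Qa_def Qm_def Qb_def \<alpha>_add \<beta>_add \<alpha>_u \<beta>_u)

text \<open>The entries are built from products of two characters, each equal to -1 at
  \<open>u\<close>, so they vanish at \<open>u\<close> as well as at 0.\<close>

lemma Q_0: "Qa 0 = 0" "Qm 0 = 0" "Qb 0 = 0" "Qa u = 0" "Qm u = 0" "Qb u = 0"
  by (simp_all add: Qa_def Qm_def Qb_def \<alpha>_0 \<beta>_0 \<alpha>_u \<beta>_u)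

lemma hmul_bilinear: "bilinear_op (hmul H)"
  by (rule bilinear_opI; rule cvec_eqI) (simp_all add: hmul_nth algebra_simps)

lemma hmul_assoc: "hmul H (hmul H x y) z = hmul H x (hmul H y z)"
  by (rule cvec_eqI) (simp_all add: hmul_nth Q_add_u add_u_u algebra_simps power2_eq_square)

lemma hmul_one: "hmul H (hone H) x = x" "hmul H x (hone H) = x"
  by (rule cvec_eqI; simp add: hmul_nth hone_nth)+

lemma hcomul_linear: "Vector_Spaces.linear (*s) (*s) (hcomul H)"
  by (simp add: linear_s_iff vec_eq_iff split_paired_all hcomul_nth algebra_simps)

lemma hcounit_linear: "Vector_Spaces.linear (*s) (*) (hcounit H)"
  by (simp add: linear_s_mult_iff hcounit_nth)

lemma algebra_H: "algebra_axioms H"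
  using hmul_bilinear by (simp add: algebra_axioms_def bilinear_op_def hmul_assoc hmul_one)

text \<open>Dual to associativity of the smash product, and therefore a consequence of the same two
  identities for \<open>wedge_coeff\<close> and \<open>char_set\<close>.\<close>

lemma hcomul_coassoc: "ten_map (hcomul H) id (hcomul H x) = ten_assoc (ten_map id (hcomul H) (hcomul H x))"
proof -
  have c: "char_set \<alpha> \<beta> S (g + h) = char_set \<alpha> \<beta> S g * char_set \<alpha> \<beta> S h" for S g h
    by (simp add: char_set_def \<alpha>_add \<beta>_add)
  have "ten_map (hcomul H) id (hcomul H x) $ (((S, g), (T, h)), (R, k)) =
    ten_assoc (ten_map id (hcomul H) (hcomul H x)) $ (((S, g), (T, h)), (R, k))" for S T R g h k
  proof -
    let ?w = "wedge_coeff" and ?c = "char_set \<alpha> \<beta>"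
    let ?x = "x $ (S \<union> T \<union> R, g + h + k)"
    have "?w S T * ?c T g * (?w (S \<union> T) R * ?c R (g + h) * ?x) =
      (?w S T * ?w (S \<union> T) R) * ?c T g * ?c R g * ?c R h * ?x" by (simp add: c)
    also have "\<dots> = ?w S (T \<union> R) * ?c R h * (?w T R * (?c T g * ?c R g)) * ?x"
      unfolding wedge_coeff_assoc by simp
    also have "\<dots> = ?w T R * ?c R h * (?w S (T \<union> R) * ?c (T \<union> R) g * ?x)"
      unfolding char_set_Un[symmetric] by simp
    finally show ?thesis
      by (simp add: ten_map_id_nth[OF hcomul_linear] ten_assoc_nth hcomul_nth slice1_nth slice2_nth Un_assoc add.assoc)
  qed
  then show ?thesis by (simp add: vec_eq_iff split_paired_all)
qed

lemma sum_pair_basis: "(\<Sum>p\<in>UNIV. X $ p * basis (fst p) $ a * basis (snd p) $ b) = X $ (a, b)"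
proof -
  have "(\<Sum>p\<in>UNIV. X $ p * basis (fst p) $ a * basis (snd p) $ b) = (\<Sum>p\<in>UNIV. if p = (a, b) then X $ p else 0)"
    by (intro sum.cong refl) (auto simp: basis_nth)
  then show ?thesis by simp
qed

lemma coalgebra_H: "coalgebra_axioms H"
proof -
  have "(\<Sum>p\<in>UNIV. (hcomul H x $ p * hcounit H (basis (fst p))) *s basis (snd p)) $ (S, g) = x $ (S, g)" for x S g
    using sum_pair_basis[of "hcomul H x" "({}, 0)" "(S, g)"]
    by (simp add: hcounit_nth hcomul_nth wedge_coeff_2 char_set_simps)
  moreover have "(\<Sum>p\<in>UNIV. (hcomul H x $ p * hcounit H (basis (snd p))) *s basis (fst p)) $ (S, g) = x $ (S, g)" for x S g
    using sum_pair_basis[of "hcomul H x" "(S, g)" "({}, 0)"]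
    by (simp add: hcounit_nth hcomul_nth wedge_coeff_2 char_set_simps mult_ac)
  ultimately have "(\<Sum>p\<in>UNIV. (hcomul H x $ p * hcounit H (basis (fst p))) *s basis (snd p)) = x"
    "(\<Sum>p\<in>UNIV. (hcomul H x $ p * hcounit H (basis (snd p))) *s basis (fst p)) = x" for x
    by (metis (no_types, lifting) vec_eq_iff surj_pair)+
  then show ?thesis
    by (simp add: coalgebra_axioms_def hcomul_linear hcounit_linear hcomul_coassoc)
qed

text \<open>\<open>hmul_nth\<close> applied to the first legs only, while the second legs remain
  elements of \<open>H\<close>. This avoids writing out the structure constants of the tensor square
  in full.\<close>

lemma slice1_hmul2:
  "slice1 ({}, g) (hmul2 H X Y) = hmul H (slice1 ({}, g) X) (slice1 ({}, g) Y)
    + Qa g *s hmul H (slice1 ({1}, g + u) X) (slice1 ({1}, g) Y)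
    + Qm g *s (hmul H (slice1 ({1}, g + u) X) (slice1 ({2}, g) Y) + hmul H (slice1 ({2}, g + u) X) (slice1 ({1}, g) Y))
    + Qb g *s hmul H (slice1 ({2}, g + u) X) (slice1 ({2}, g) Y)
    + ((Qm g)\<^sup>2 - Qa g * Qb g) *s hmul H (slice1 ({1,2}, g) X) (slice1 ({1,2}, g) Y)"
  "slice1 ({1}, g) (hmul2 H X Y) = hmul H (slice1 ({1}, g) X) (slice1 ({}, g) Y) + hmul H (slice1 ({}, g + u) X) (slice1 ({1}, g) Y)
    - Qm g *s hmul H (slice1 ({1,2}, g + u) X) (slice1 ({1}, g) Y) - Qb g *s hmul H (slice1 ({1,2}, g + u) X) (slice1 ({2}, g) Y)
    + Qm g *s hmul H (slice1 ({1}, g) X) (slice1 ({1,2}, g) Y) + Qb g *s hmul H (slice1 ({2}, g) X) (slice1 ({1,2}, g) Y)"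
  "slice1 ({2}, g) (hmul2 H X Y) = hmul H (slice1 ({2}, g) X) (slice1 ({}, g) Y) + hmul H (slice1 ({}, g + u) X) (slice1 ({2}, g) Y)
    + Qa g *s hmul H (slice1 ({1,2}, g + u) X) (slice1 ({1}, g) Y) + Qm g *s hmul H (slice1 ({1,2}, g + u) X) (slice1 ({2}, g) Y)
    - Qa g *s hmul H (slice1 ({1}, g) X) (slice1 ({1,2}, g) Y) - Qm g *s hmul H (slice1 ({2}, g) X) (slice1 ({1,2}, g) Y)"
  "slice1 ({1,2}, g) (hmul2 H X Y) = hmul H (slice1 ({1,2}, g) X) (slice1 ({}, g) Y) + hmul H (slice1 ({}, g) X) (slice1 ({1,2}, g) Y)
    + hmul H (slice1 ({2}, g + u) X) (slice1 ({1}, g) Y) - hmul H (slice1 ({1}, g + u) X) (slice1 ({2}, g) Y)"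
  by (rule bilinear_eqI[where m="\<lambda>X Y. slice1 _ (hmul2 H X Y)"];
    (rule bilinear_opI)?;
    simp add: split_paired_all bilinear_opD[OF ten_mul_bilinear] bilinear_opD[OF hmul_bilinear] slice1_simps ten_mul_basis
      slice1_ten slice1_basis hmul_nth vec.scale_left_distrib vec.scale_right_distrib
      vec.scale_left_diff_distrib vec.scale_right_diff_distrib algebra_simps)+

end

lemma functional_pair_eqI:
  fixes F G :: "('i::finite \<times> 'j::finite) cvec \<Rightarrow> complex"
  assumes "\<And>x y. F (x + y) = F x + F y" "\<And>c x. F (c *s x) = c * F x"
    and "\<And>x y. G (x + y) = G x + G y" "\<And>c x. G (c *s x) = c * G x"
    and "\<And>i j. F (basis (i, j)) = G (basis (i, j))"
  shows "F x = G x"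
  by (rule functional_eqI) (use assms in auto)

context char_quad
begin

lemma char_u: "\<alpha> (g + u) = - \<alpha> g" "\<beta> (g + u) = - \<beta> g" "\<alpha> (u + g) = - \<alpha> g" "\<beta> (u + g) = - \<beta> g"
  by (simp_all add: \<alpha>_add \<beta>_add \<alpha>_u \<beta>_u)

lemma hcomul_mult: "hcomul H (hmul H x y) = hmul2 H (hcomul H x) (hcomul H y)"
proof -
  have "slice1 (S, g) (hcomul H (hmul H x y)) = slice1 (S, g) (hmul2 H (hcomul H x) (hcomul H y))" for S g
    using set2_cases[of S]
    by (elim disjE; simp only:; intro cvec_eqI)
      (simp_all add: slice1_hmul2 hmul_nth slice1_nth hcomul_nth wedge_coeff_2 char_set_simps set_21 Qa_def Qm_def Qb_def
        add_u_u add_ac char_u \<alpha>_add \<beta>_add \<alpha>_u \<beta>_u algebra_simps power2_eq_square)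
  then show ?thesis by (simp add: vec_eq_iff split_paired_all slice1_nth)
qed

text \<open>The inverse character cancels the one that \<open>hcomul_nth\<close> puts on the second
  leg, and the shift by \<open>u\<close> in odd degree compensates the shift in
  \<open>hmul_nth\<close>.\<close>

definition antipode :: "(2 set \<times> 'g) cvec \<Rightarrow> (2 set \<times> 'g) cvec"
  where "antipode x = (\<chi> i. inverse (char_set \<alpha> \<beta> (fst i) (snd i)) *
    x $ (fst i, (if odd (card (fst i)) then u else 0) - snd i))"

lemma antipode_nth:
  "antipode x $ ({}, g) = x $ ({}, - g)"
  "antipode x $ ({1}, g) = inverse (\<alpha> g) * x $ ({1}, u - g)"
  "antipode x $ ({2}, g) = inverse (\<beta> g) * x $ ({2}, u - g)"
  "antipode x $ ({1,2}, g) = inverse (\<alpha> g) * inverse (\<beta> g) * x $ ({1,2}, - g)"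
  by (simp_all add: antipode_def char_set_simps card_12)

lemma antipode_linear: "Vector_Spaces.linear (*s) (*s) antipode"
  by (simp add: linear_s_iff antipode_def vec_eq_iff distrib_left)

definition contract :: "((2 set \<times> 'g) cvec \<Rightarrow> (2 set \<times> 'g) cvec \<Rightarrow> (2 set \<times> 'g) cvec) \<Rightarrow>
    ((2 set \<times> 'g) \<times> (2 set \<times> 'g)) cvec \<Rightarrow> (2 set \<times> 'g) cvec"
  where "contract m X = (\<Sum>p\<in>UNIV. X $ p *s m (basis (fst p)) (basis (snd p)))"

lemma contract_simps: "contract m (X + Y) = contract m X + contract m Y" "contract m (c *s X) = c *s contract m X"
  "contract m (basis (i, j)) = m (basis i) (basis j)"
  using sum_basis1[of "(i, j)" "\<lambda>p. m (basis (fst p)) (basis (snd p))"]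
  by (simp_all add: contract_def vec.scale_left_distrib sum.distrib vec.scale_sum_right)

lemma basis_pair: "basis (i, j) $ (k, l) = basis i $ k * basis j $ l"
  by (simp add: basis_nth)

lemma minus_u: "u - (g + u) = - g" "- (g + u) = u - g" "u - (u - g) = g" "g + u - u = g" "- g - u = u - g"
proof -
  have "- u = u" using u_u by (rule minus_unique)
  then show "u - (g + u) = - g" "- (g + u) = u - g" "u - (u - g) = g" "g + u - u = g" "- g - u = u - g" by (simp_all add: algebra_simps)
qed

lemma hmul_antipode_nth:
    "hmul H (antipode x) y $ ({}, g) = x $ ({}, -g) * y $ ({}, g)
      - inverse (\<alpha> g) * Qa g * x $ ({1}, -g) * y $ ({1}, g) - inverse (\<alpha> g) * Qm g * x $ ({1}, -g) * y $ ({2}, g)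
      - inverse (\<beta> g) * Qm g * x $ ({2}, -g) * y $ ({1}, g) - inverse (\<beta> g) * Qb g * x $ ({2}, -g) * y $ ({2}, g)
      + inverse (\<alpha> g) * inverse (\<beta> g) * ((Qm g)\<^sup>2 - Qa g * Qb g) * x $ ({1,2}, -g) * y $ ({1,2}, g)"
    "hmul H (antipode x) y $ ({1}, g) = inverse (\<alpha> g) * x $ ({1}, u - g) * y $ ({}, g) + x $ ({}, u - g) * y $ ({1}, g)
      - inverse (\<alpha> g) * inverse (\<beta> g) * Qm g * x $ ({1,2}, u - g) * y $ ({1}, g) - inverse (\<alpha> g) * inverse (\<beta> g) * Qb g * x $ ({1,2}, u - g) * y $ ({2}, g)
      + inverse (\<alpha> g) * Qm g * x $ ({1}, u - g) * y $ ({1,2}, g) + inverse (\<beta> g) * Qb g * x $ ({2}, u - g) * y $ ({1,2}, g)"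
    "hmul H (antipode x) y $ ({2}, g) = inverse (\<beta> g) * x $ ({2}, u - g) * y $ ({}, g) + x $ ({}, u - g) * y $ ({2}, g)
      + inverse (\<alpha> g) * inverse (\<beta> g) * Qa g * x $ ({1,2}, u - g) * y $ ({1}, g) + inverse (\<alpha> g) * inverse (\<beta> g) * Qm g * x $ ({1,2}, u - g) * y $ ({2}, g)
      - inverse (\<alpha> g) * Qa g * x $ ({1}, u - g) * y $ ({1,2}, g) - inverse (\<beta> g) * Qm g * x $ ({2}, u - g) * y $ ({1,2}, g)"
    "hmul H (antipode x) y $ ({1,2}, g) = inverse (\<alpha> g) * inverse (\<beta> g) * x $ ({1,2}, -g) * y $ ({}, g) + x $ ({}, -g) * y $ ({1,2}, g)
      - inverse (\<beta> g) * x $ ({2}, -g) * y $ ({1}, g) + inverse (\<alpha> g) * x $ ({1}, -g) * y $ ({2}, g)"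
    "hmul H x (antipode y) $ ({}, g) = x $ ({}, g) * y $ ({}, -g)
      + inverse (\<alpha> g) * Qa g * x $ ({1}, g + u) * y $ ({1}, u - g) + inverse (\<beta> g) * Qm g * x $ ({1}, g + u) * y $ ({2}, u - g)
      + inverse (\<alpha> g) * Qm g * x $ ({2}, g + u) * y $ ({1}, u - g) + inverse (\<beta> g) * Qb g * x $ ({2}, g + u) * y $ ({2}, u - g)
      + inverse (\<alpha> g) * inverse (\<beta> g) * ((Qm g)\<^sup>2 - Qa g * Qb g) * x $ ({1,2}, g) * y $ ({1,2}, -g)"
    "hmul H x (antipode y) $ ({1}, g) = x $ ({1}, g) * y $ ({}, -g) + inverse (\<alpha> g) * x $ ({}, g + u) * y $ ({1}, u - g)
      - inverse (\<alpha> g) * Qm g * x $ ({1,2}, g + u) * y $ ({1}, u - g) - inverse (\<beta> g) * Qb g * x $ ({1,2}, g + u) * y $ ({2}, u - g)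
      + inverse (\<alpha> g) * inverse (\<beta> g) * Qm g * x $ ({1}, g) * y $ ({1,2}, -g) + inverse (\<alpha> g) * inverse (\<beta> g) * Qb g * x $ ({2}, g) * y $ ({1,2}, -g)"
    "hmul H x (antipode y) $ ({2}, g) = x $ ({2}, g) * y $ ({}, -g) + inverse (\<beta> g) * x $ ({}, g + u) * y $ ({2}, u - g)
      + inverse (\<alpha> g) * Qa g * x $ ({1,2}, g + u) * y $ ({1}, u - g) + inverse (\<beta> g) * Qm g * x $ ({1,2}, g + u) * y $ ({2}, u - g)
      - inverse (\<alpha> g) * inverse (\<beta> g) * Qa g * x $ ({1}, g) * y $ ({1,2}, -g) - inverse (\<alpha> g) * inverse (\<beta> g) * Qm g * x $ ({2}, g) * y $ ({1,2}, -g)"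
    "hmul H x (antipode y) $ ({1,2}, g) = x $ ({1,2}, g) * y $ ({}, -g) + inverse (\<alpha> g) * inverse (\<beta> g) * x $ ({}, g) * y $ ({1,2}, -g)
      + inverse (\<alpha> g) * x $ ({2}, g + u) * y $ ({1}, u - g) - inverse (\<beta> g) * x $ ({1}, g + u) * y $ ({2}, u - g)"
  by (simp_all add: hmul_nth antipode_nth minus_u char_u inverse_minus_eq) (simp_all add: algebra_simps)

text \<open>The linear extension of \<open>hmul_antipode_nth\<close> from pure tensors, needed
  because a coproduct is not a pure tensor.\<close>

lemma contract_antipode_nth:
    "contract (\<lambda>x y. hmul H (antipode x) y) X $ ({}, g) = X $ (({}, -g), ({}, g))
      - inverse (\<alpha> g) * Qa g * X $ (({1}, -g), ({1}, g)) - inverse (\<alpha> g) * Qm g * X $ (({1}, -g), ({2}, g))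
      - inverse (\<beta> g) * Qm g * X $ (({2}, -g), ({1}, g)) - inverse (\<beta> g) * Qb g * X $ (({2}, -g), ({2}, g))
      + inverse (\<alpha> g) * inverse (\<beta> g) * ((Qm g)\<^sup>2 - Qa g * Qb g) * X $ (({1,2}, -g), ({1,2}, g))"
    "contract (\<lambda>x y. hmul H (antipode x) y) X $ ({1}, g) = inverse (\<alpha> g) * X $ (({1}, u - g), ({}, g)) + X $ (({}, u - g), ({1}, g))
      - inverse (\<alpha> g) * inverse (\<beta> g) * Qm g * X $ (({1,2}, u - g), ({1}, g)) - inverse (\<alpha> g) * inverse (\<beta> g) * Qb g * X $ (({1,2}, u - g), ({2}, g))
      + inverse (\<alpha> g) * Qm g * X $ (({1}, u - g), ({1,2}, g)) + inverse (\<beta> g) * Qb g * X $ (({2}, u - g), ({1,2}, g))"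
    "contract (\<lambda>x y. hmul H (antipode x) y) X $ ({2}, g) = inverse (\<beta> g) * X $ (({2}, u - g), ({}, g)) + X $ (({}, u - g), ({2}, g))
      + inverse (\<alpha> g) * inverse (\<beta> g) * Qa g * X $ (({1,2}, u - g), ({1}, g)) + inverse (\<alpha> g) * inverse (\<beta> g) * Qm g * X $ (({1,2}, u - g), ({2}, g))
      - inverse (\<alpha> g) * Qa g * X $ (({1}, u - g), ({1,2}, g)) - inverse (\<beta> g) * Qm g * X $ (({2}, u - g), ({1,2}, g))"
    "contract (\<lambda>x y. hmul H (antipode x) y) X $ ({1,2}, g) = inverse (\<alpha> g) * inverse (\<beta> g) * X $ (({1,2}, -g), ({}, g)) + X $ (({}, -g), ({1,2}, g))
      - inverse (\<beta> g) * X $ (({2}, -g), ({1}, g)) + inverse (\<alpha> g) * X $ (({1}, -g), ({2}, g))"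
    "contract (\<lambda>x y. hmul H x (antipode y)) X $ ({}, g) = X $ (({}, g), ({}, -g))
      + inverse (\<alpha> g) * Qa g * X $ (({1}, g + u), ({1}, u - g)) + inverse (\<beta> g) * Qm g * X $ (({1}, g + u), ({2}, u - g))
      + inverse (\<alpha> g) * Qm g * X $ (({2}, g + u), ({1}, u - g)) + inverse (\<beta> g) * Qb g * X $ (({2}, g + u), ({2}, u - g))
      + inverse (\<alpha> g) * inverse (\<beta> g) * ((Qm g)\<^sup>2 - Qa g * Qb g) * X $ (({1,2}, g), ({1,2}, -g))"
    "contract (\<lambda>x y. hmul H x (antipode y)) X $ ({1}, g) = X $ (({1}, g), ({}, -g)) + inverse (\<alpha> g) * X $ (({}, g + u), ({1}, u - g))
      - inverse (\<alpha> g) * Qm g * X $ (({1,2}, g + u), ({1}, u - g)) - inverse (\<beta> g) * Qb g * X $ (({1,2}, g + u), ({2}, u - g))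
      + inverse (\<alpha> g) * inverse (\<beta> g) * Qm g * X $ (({1}, g), ({1,2}, -g)) + inverse (\<alpha> g) * inverse (\<beta> g) * Qb g * X $ (({2}, g), ({1,2}, -g))"
    "contract (\<lambda>x y. hmul H x (antipode y)) X $ ({2}, g) = X $ (({2}, g), ({}, -g)) + inverse (\<beta> g) * X $ (({}, g + u), ({2}, u - g))
      + inverse (\<alpha> g) * Qa g * X $ (({1,2}, g + u), ({1}, u - g)) + inverse (\<beta> g) * Qm g * X $ (({1,2}, g + u), ({2}, u - g))
      - inverse (\<alpha> g) * inverse (\<beta> g) * Qa g * X $ (({1}, g), ({1,2}, -g)) - inverse (\<alpha> g) * inverse (\<beta> g) * Qm g * X $ (({2}, g), ({1,2}, -g))"
    "contract (\<lambda>x y. hmul H x (antipode y)) X $ ({1,2}, g) = X $ (({1,2}, g), ({}, -g)) + inverse (\<alpha> g) * inverse (\<beta> g) * X $ (({}, g), ({1,2}, -g))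
      + inverse (\<alpha> g) * X $ (({2}, g + u), ({1}, u - g)) - inverse (\<beta> g) * X $ (({1}, g + u), ({2}, u - g))"
  by (rule functional_pair_eqI[where x=X];
      simp only: contract_simps hmul_antipode_nth basis_pair vector_add_component vector_smult_component; simp add: algebra_simps)+

lemma char_inverse: "\<alpha> (- g) = inverse (\<alpha> g)" "\<beta> (- g) = inverse (\<beta> g)"
  "\<alpha> (u - g) = - inverse (\<alpha> g)" "\<beta> (u - g) = - inverse (\<beta> g)"
  using char_u(3)[of "- g"] char_u(4)[of "- g"] by (simp_all add: char_minus inverse_eq_divide)

lemma cancel_sums: "- g + g = 0" "u - g + g = u" "g + - g = 0" "g + u + (u - g) = 0" "g + (u - g) = u"
  using u_u by (simp_all add: algebra_simps)

lemma antipode_H: "is_antipode H antipode"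
proof -
  have "contract (\<lambda>x y. hmul H (antipode x) y) (hcomul H x) = hcounit H x *s hone H"
    "contract (\<lambda>x y. hmul H x (antipode y)) (hcomul H x) = hcounit H x *s hone H" for x
    by (rule cvec_eqI; simp add: contract_antipode_nth hcomul_nth hcounit_nth hone_nth wedge_coeff_2 char_set_simps
        set_21 char_inverse char_u cancel_sums; simp add: field_simps \<alpha>_nz \<beta>_nz)+
  then show ?thesis
    by (simp add: is_antipode_def antipode_linear contract_def)
qed

lemma hopf_H: "hopf_algebra H"
proof -
  have "hcomul H (hone H) = hone2 H"
    by (auto simp: vec_eq_iff split_paired_all hcomul_nth hone_nth ten_nth wedge_coeff_2 char_set_simps)
  moreover have "hcounit H (hmul H x y) = hcounit H x * hcounit H y" for x y
    by (simp add: hcounit_nth hmul_nth Q_0)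
  moreover have "hcounit H (hone H) = 1"
    by (simp add: hcounit_nth hone_nth)
  ultimately show ?thesis
    using antipode_H by (auto simp: hopf_algebra_def algebra_H coalgebra_H hcomul_mult)
qed

end

subsection \<open>Twists and skew-primitive functionals\<close>

definition functional :: "('i::finite cvec \<Rightarrow> complex) \<Rightarrow> bool"
  where "functional a \<longleftrightarrow> (\<forall>x y. a (x + y) = a x + a y) \<and> (\<forall>c x. a (c *s x) = c * a x)"

lemma functionalD:
  assumes "functional a"
  shows "a (x + y) = a x + a y" "a (c *s x) = c * a x" "a 0 = 0" "a (- x) = - a x" "a (x - y) = a x - a y"
proof -
  show l: "a (x + y) = a x + a y" "a (c *s x) = c * a x" for x y c
    using assms by (simp_all add: functional_def)
  show z: "a 0 = 0" using l(2)[of 0 0] by simp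
  show m: "a (- x) = - a x" for x using l(2)[of "-1" x] by simp
  show "a (x - y) = a x - a y" using l(1)[of x "- y"] by (simp add: m)
qed

definition ap1 :: "('i::finite cvec \<Rightarrow> complex) \<Rightarrow> ('i \<times> 'j::finite) cvec \<Rightarrow> 'j cvec"
  where "ap1 a X = (\<Sum>p\<in>UNIV. X $ p *s (a (basis (fst p)) *s basis (snd p)))"

definition ap2 :: "('j::finite cvec \<Rightarrow> complex) \<Rightarrow> ('i::finite \<times> 'j) cvec \<Rightarrow> 'i cvec"
  where "ap2 a X = (\<Sum>p\<in>UNIV. X $ p *s (a (basis (snd p)) *s basis (fst p)))"

lemma ap1_simps:
  "ap1 a (X + Y) = ap1 a X + ap1 a Y" "ap1 a (c *s X) = c *s ap1 a X"
  "ap1 a (basis (i, j)) = a (basis i) *s basis j"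
  unfolding ap1_def sum_basis1
  by (simp_all add: vec.scale_left_distrib sum.distrib vec.scale_sum_right distrib_right mult.assoc)

lemma ap2_simps:
  "ap2 a (X + Y) = ap2 a X + ap2 a Y" "ap2 a (c *s X) = c *s ap2 a X"
  "ap2 a (basis (i, j)) = a (basis j) *s basis i"
  unfolding ap2_def sum_basis1
  by (simp_all add: vec.scale_left_distrib sum.distrib vec.scale_sum_right distrib_right mult.assoc)

lemma linear_pair_eqI:
  fixes f g :: "('i::finite \<times> 'j::finite) cvec \<Rightarrow> 'k::finite cvec"
  assumes "\<And>x y. f (x + y) = f x + f y" "\<And>c x. f (c *s x) = c *s f x"
    and "\<And>x y. g (x + y) = g x + g y" "\<And>c x. g (c *s x) = c *s g x"
    and "\<And>i j. f (basis (i, j)) = g (basis (i, j))"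
  shows "f x = g x"
  by (rule linear_eqI) (use assms in \<open>auto simp: linear_s_iff\<close>)

lemma ap1_ten: "functional a \<Longrightarrow> ap1 a (x \<otimes> y) = a x *s y"
  by (rule linear_eqI[where f="\<lambda>x. ap1 a (x \<otimes> y)"];
      (simp add: linear_s_iff functional_def ten_simps ap1_simps vec.scale_left_distrib)?;
      rule linear_eqI[where f="\<lambda>y. ap1 a (basis _ \<otimes> y)"])
    (simp_all add: linear_s_iff ten_simps ap1_simps ten_basis vec.scale_right_distrib mult.commute)

lemma ap2_ten: "functional a \<Longrightarrow> ap2 a (x \<otimes> y) = a y *s x"
  by (rule linear_eqI[where f="\<lambda>x. ap2 a (x \<otimes> y)"];
      (simp add: linear_s_iff ten_simps ap2_simps vec.scale_right_distrib mult.commute)?;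
      rule linear_eqI[where f="\<lambda>y. ap2 a (basis _ \<otimes> y)"])
    (simp_all add: linear_s_iff functional_def ten_simps ap2_simps ten_basis vec.scale_left_distrib)

text \<open>The two-term rule covers skew-primitive functionals, and characters when the second term
  is zero. Every contraction of the cocycle equation below is an instance of this lemma or its
  mirror image.\<close>

lemma ap1_ten_mul:
  fixes m :: "'i::finite cvec \<Rightarrow> 'i cvec \<Rightarrow> 'i cvec" and n :: "'j::finite cvec \<Rightarrow> 'j cvec \<Rightarrow> 'j cvec"
  assumes n: "bilinear_op n" and a: "functional a"
    and p: "\<And>x y. a (m x y) = b x * c y + d x * e y"
  shows "ap1 a (ten_mul m n X Y) = n (ap1 b X) (ap1 c Y) + n (ap1 d X) (ap1 e Y)"
  by (rule bilinear_eqI[where m="\<lambda>X Y. ap1 a (ten_mul m n X Y)"]; (rule bilinear_opI)?;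
      (simp add: bilinear_opD[OF ten_mul_bilinear] bilinear_opD[OF n] ap1_simps vec.scale_right_distrib)?)
    (simp add: split_paired_all ten_mul_basis ap1_ten[OF a] ap1_simps p bilinear_opD[OF n] vec.scale_left_distrib mult.commute)

lemma ap2_ten_mul:
  fixes m :: "'i::finite cvec \<Rightarrow> 'i cvec \<Rightarrow> 'i cvec" and n :: "'j::finite cvec \<Rightarrow> 'j cvec \<Rightarrow> 'j cvec"
  assumes m: "bilinear_op m" and a: "functional a"
    and p: "\<And>x y. a (n x y) = b x * c y + d x * e y"
  shows "ap2 a (ten_mul m n X Y) = m (ap2 b X) (ap2 c Y) + m (ap2 d X) (ap2 e Y)"
  by (rule bilinear_eqI[where m="\<lambda>X Y. ap2 a (ten_mul m n X Y)"]; (rule bilinear_opI)?;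
      (simp add: bilinear_opD[OF ten_mul_bilinear] bilinear_opD[OF m] ap2_simps vec.scale_right_distrib)?)
    (simp add: split_paired_all ten_mul_basis ap2_ten[OF a] ap2_simps p bilinear_opD[OF m] vec.scale_left_distrib mult.commute)

lemma ap_mult:
  fixes m :: "'i::finite cvec \<Rightarrow> 'i cvec \<Rightarrow> 'i cvec" and n :: "'j::finite cvec \<Rightarrow> 'j cvec \<Rightarrow> 'j cvec"
  shows "bilinear_op n \<Longrightarrow> functional a \<Longrightarrow> (\<And>x y. a (m x y) = a x * a y) \<Longrightarrow>
      ap1 a (ten_mul m n X Y) = n (ap1 a X) (ap1 a Y)"
    "bilinear_op m \<Longrightarrow> functional b \<Longrightarrow> (\<And>x y. b (n x y) = b x * b y) \<Longrightarrow>
      ap2 b (ten_mul m n X Z) = m (ap2 b X) (ap2 b Z)"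
  using ap1_ten_mul[of n a m a a "\<lambda>_. 0" "\<lambda>_. 0" X Y] ap2_ten_mul[of m b n b b "\<lambda>_. 0" "\<lambda>_. 0" X Z]
  by (simp_all add: bilinear_opD ap1_def[of "\<lambda>_. 0"] ap2_def[of "\<lambda>_. 0"])

lemma ap_swap:
  assumes "functional a" "functional b"
  shows "a (ap2 b X) = b (ap1 a X)"
  by (rule functional_pair_eqI[where F="\<lambda>X. a (ap2 b X)"])
    (simp_all add: ap1_simps ap2_simps functionalD[OF assms(1)] functionalD[OF assms(2)])

lemma linear_s_D:
  assumes "Vector_Spaces.linear (*s) (*s) f"
  shows "f (x + y) = f x + f y" "f (c *s x) = c *s f (x :: 'i::finite cvec)"
  using assms by (simp_all add: linear_s_iff)

lemma ten_map_simps: "ten_map f g (X + Y) = ten_map f g X + ten_map f g Y" "ten_map f g (c *s X) = c *s ten_map f g X"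
  using ten_map_linear[of f g] by (simp_all add: linear_s_iff)

lemma ap_ten_map:
  fixes f :: "'i::finite cvec \<Rightarrow> 'k::finite cvec" and g :: "'j::finite cvec \<Rightarrow> 'l::finite cvec"
  shows "functional a \<Longrightarrow> Vector_Spaces.linear (*s) (*s) g \<Longrightarrow> ap1 a (ten_map f g X) = g (ap1 (\<lambda>x. a (f x)) X)"
    "functional b \<Longrightarrow> Vector_Spaces.linear (*s) (*s) f \<Longrightarrow> ap2 b (ten_map f g X) = f (ap2 (\<lambda>x. b (g x)) X)"
proof -
  show "ap1 a (ten_map f g X) = g (ap1 (\<lambda>x. a (f x)) X)" if "functional a" "Vector_Spaces.linear (*s) (*s) g"
    by (rule linear_pair_eqI[where f="\<lambda>X. ap1 a (ten_map f g X)"])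
      (simp_all add: ten_map_simps ap1_simps linear_s_D[OF that(2)] ten_map_basis ap1_ten[OF that(1)])
  show "ap2 b (ten_map f g X) = f (ap2 (\<lambda>x. b (g x)) X)" if "functional b" "Vector_Spaces.linear (*s) (*s) f"
    by (rule linear_pair_eqI[where f="\<lambda>X. ap2 b (ten_map f g X)"])
      (simp_all add: ten_map_simps ap2_simps linear_s_D[OF that(2)] ten_map_basis ap2_ten[OF that(1)])
qed

lemma ten_assoc_simps: "ten_assoc (X + Y) = ten_assoc X + ten_assoc Y" "ten_assoc (c *s X) = c *s ten_assoc X"
  by (simp_all add: ten_assoc_def vec_eq_iff)

lemma ten_assoc_ten: "ten_assoc (x \<otimes> (y \<otimes> z)) = (x \<otimes> y) \<otimes> z"
  by (simp add: ten_assoc_def vec_eq_iff split_paired_all ten_nth)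

lemma ap2_ten_assoc_ten: "ap2 b (ten_assoc (x \<otimes> Y)) = x \<otimes> ap2 b Y" if "functional b"
  by (rule linear_pair_eqI[where f="\<lambda>Y. ap2 b (ten_assoc (x \<otimes> Y))"])
    (simp_all add: ten_simps ten_assoc_simps ap2_simps flip: ten_basis,
     simp add: ten_assoc_ten ap2_ten[OF that] ten_simps)

text \<open>The functional \<open>\<lambda>X. b (ap1 a X)\<close> is the tensor product of
  \<open>a\<close> and \<open>b\<close>, here applied to the first two of three legs.\<close>

lemma ap1_ten_assoc_ten: "ap1 (\<lambda>X. b (ap1 a X)) (ten_assoc (x \<otimes> Y)) = a x *s ap1 b Y" if "functional b" "functional a"
proof (rule linear_pair_eqI[where f="\<lambda>Y. ap1 (\<lambda>X. b (ap1 a X)) (ten_assoc (x \<otimes> Y))"])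
  have f: "functional (\<lambda>X. b (ap1 a X))"
    using that by (simp add: functional_def ap1_simps)
  show "ap1 (\<lambda>X. b (ap1 a X)) (ten_assoc (x \<otimes> basis (i, j))) = a x *s ap1 b (basis (i, j))" for i j
    by (simp only: ten_basis[symmetric] ten_assoc_ten ap1_ten[OF f] ap1_ten[OF that(1)] ap1_ten[OF that(2)])
      (simp add: functionalD[OF that(1)])
qed (simp_all add: ten_simps ten_assoc_simps ap1_simps vec.scale_right_distrib mult.commute)

lemma ap2_ten_assoc_map:
  fixes D :: "'j::finite cvec \<Rightarrow> ('k::finite \<times> 'l::finite) cvec" and F :: "('i::finite \<times> 'j) cvec"
  assumes "functional b"
  shows "ap2 b (ten_assoc (ten_map id D F)) = ten_map id (\<lambda>x. ap2 b (D x)) F"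
  by (rule linear_pair_eqI[where f="\<lambda>F. ap2 b (ten_assoc (ten_map id D F))"])
    (simp_all add: ten_map_simps ten_assoc_simps ap2_simps ten_map_basis ap2_ten_assoc_ten[OF assms])

lemma ap1_ten_assoc_map:
  fixes D :: "'j::finite cvec \<Rightarrow> ('k::finite \<times> 'l::finite) cvec" and F :: "('i::finite \<times> 'j) cvec"
  assumes "functional b" "functional a" and D: "Vector_Spaces.linear (*s) (*s) D"
  shows "ap1 (\<lambda>X. b (ap1 a X)) (ten_assoc (ten_map id D F)) = ap1 b (D (ap1 a F))"
  by (rule linear_pair_eqI[where f="\<lambda>F. ap1 (\<lambda>X. b (ap1 a X)) (ten_assoc (ten_map id D F))"])
    (simp_all add: ten_map_simps ten_assoc_simps ap1_simps ten_map_basis ap1_ten_assoc_ten[OF assms(1,2)] linear_s_D[OF D])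

lemma ten_mul_ten:
  fixes m :: "'i::finite cvec \<Rightarrow> 'i cvec \<Rightarrow> 'i cvec" and n :: "'j::finite cvec \<Rightarrow> 'j cvec \<Rightarrow> 'j cvec"
  assumes m: "bilinear_op m" and n: "bilinear_op n"
  shows "ten_mul m n (x \<otimes> y) (x' \<otimes> y') = m x x' \<otimes> n y y'"
proof -
  have 1: "ten_mul m n (x \<otimes> y) (basis i \<otimes> basis j) = m x (basis i) \<otimes> n y (basis j)" for i j
  proof -
    have 0: "ten_mul m n (x \<otimes> basis l) (basis i \<otimes> basis j) = m x (basis i) \<otimes> n (basis l) (basis j)" for l
      by (rule linear_eqI[where f="\<lambda>x. ten_mul m n (x \<otimes> basis l) (basis i \<otimes> basis j)"])
        (simp_all add: linear_s_iff ten_simps bilinear_opD[OF ten_mul_bilinear] bilinear_opD[OF m] ten_basis ten_mul_basis)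
    show ?thesis
      by (rule linear_eqI[where f="\<lambda>y. ten_mul m n (x \<otimes> y) (basis i \<otimes> basis j)"])
        (simp_all add: linear_s_iff ten_simps bilinear_opD[OF ten_mul_bilinear] bilinear_opD[OF n] 0)
  qed
  have 2: "ten_mul m n (x \<otimes> y) (x' \<otimes> basis j) = m x x' \<otimes> n y (basis j)" for j
    by (rule linear_eqI[where f="\<lambda>x'. ten_mul m n (x \<otimes> y) (x' \<otimes> basis j)"])
      (simp_all add: linear_s_iff ten_simps bilinear_opD[OF ten_mul_bilinear] bilinear_opD[OF m] 1)
  show ?thesis
    by (rule linear_eqI[where f="\<lambda>y'. ten_mul m n (x \<otimes> y) (x' \<otimes> y')"])
      (simp_all add: linear_s_iff ten_simps bilinear_opD[OF ten_mul_bilinear] bilinear_opD[OF n] 2)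
qed

text \<open>Action of the dual algebra on \<open>H\<close> through one leg of the coproduct: a
  group-like functional acts by an algebra automorphism, a skew-primitive one by a twisted
  derivation.\<close>

definition ltrans :: "'i::finite hopf_ops \<Rightarrow> ('i cvec \<Rightarrow> complex) \<Rightarrow> 'i cvec \<Rightarrow> 'i cvec"
  where "ltrans H a x = ap1 a (hcomul H x)"

definition rtrans :: "'i::finite hopf_ops \<Rightarrow> ('i cvec \<Rightarrow> complex) \<Rightarrow> 'i cvec \<Rightarrow> 'i cvec"
  where "rtrans H a x = ap2 a (hcomul H x)"

locale hopf =
  fixes H :: "'i::finite hopf_ops"
  assumes hopf: "hopf_algebra H"
begin

abbreviation mult (infixl "\<star>" 70) where "x \<star> y \<equiv> hmul H x y"
abbreviation one ("\<one>") where "\<one> \<equiv> hone H"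
abbreviation eps where "eps \<equiv> hcounit H"

lemma mult_bilinear: "bilinear_op (hmul H)"
  and mult_assoc: "(x \<star> y) \<star> z = x \<star> (y \<star> z)"
  and mult_one: "\<one> \<star> x = x" "x \<star> \<one> = x"
  using hopf by (simp_all add: hopf_algebra_def algebra_axioms_def bilinear_op_def)

lemmas mult_simps = bilinear_opD[OF mult_bilinear] mult_assoc mult_one

lemma comul_linear: "Vector_Spaces.linear (*s) (*s) (hcomul H)"
  and eps_functional: "functional eps"
  using hopf by (simp_all add: hopf_algebra_def coalgebra_axioms_def functional_def linear_s_mult_iff)

lemma eps_mult: "eps (x \<star> y) = eps x * eps y" and eps_one: "eps \<one> = 1"
  and comul_mult: "hcomul H (x \<star> y) = hmul2 H (hcomul H x) (hcomul H y)"
  and comul_one: "hcomul H \<one> = hone2 H"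
  using hopf by (simp_all add: hopf_algebra_def)

lemma trans_eps: "ltrans H eps x = x" "rtrans H eps x = x"
  using hopf by (simp_all add: hopf_algebra_def coalgebra_axioms_def ltrans_def rtrans_def ap1_def ap2_def)

lemma trans_linear: "ltrans H a (x + y) = ltrans H a x + ltrans H a y" "ltrans H a (k *s x) = k *s ltrans H a x"
  "rtrans H a (x + y) = rtrans H a x + rtrans H a y" "rtrans H a (k *s x) = k *s rtrans H a x"
  by (simp_all add: ltrans_def rtrans_def linear_s_D[OF comul_linear] ap1_simps ap2_simps)

lemma trans_diff: "ltrans H a (x - y) = ltrans H a x - ltrans H a y" "rtrans H a (x - y) = rtrans H a x - rtrans H a y"
  using trans_linear(1)[of a "x - y" y] trans_linear(3)[of a "x - y" y] by (simp_all add: algebra_simps)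

lemma mult2_assoc: "hmul2 H (hmul2 H X Y) Z = hmul2 H X (hmul2 H Y Z)"
  by (rule bilinear_assocI[OF ten_mul_bilinear])
    (simp add: split_paired_all ten_mul_basis, simp add: ten_basis[symmetric] ten_mul_ten[OF mult_bilinear mult_bilinear] mult_assoc)

lemma mult2_one: "hmul2 H (hone2 H) X = X" "hmul2 H X (hone2 H) = X"
  by (rule linear_pair_eqI[where g="\<lambda>X. X"];
      simp add: bilinear_opD[OF ten_mul_bilinear] flip: ten_basis; simp add: ten_mul_ten[OF mult_bilinear mult_bilinear] mult_one)+

lemma inverse_in_eq:
  assumes "is_inverse (hmul2 H) (hone2 H) F G"
  shows "inverse_in (hmul2 H) (hone2 H) F = G"
  unfolding inverse_in_def
proof (rule the_equality)
  show "is_inverse (hmul2 H) (hone2 H) F G" by (rule assms)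
  fix G' assume "is_inverse (hmul2 H) (hone2 H) F G'"
  then show "G' = G" using assms by (metis is_inverse_def mult2_assoc mult2_one)
qed

end

text \<open>
  A character of \<open>H\<close> is a group-like element of the dual Hopf algebra, here of order at most two; a
  functional satisfying \<open>v_mult\<close> below is a skew-primitive element of the dual.
\<close>

locale character = hopf H for H :: "'i::finite hopf_ops" +
  fixes U :: "'i cvec \<Rightarrow> complex"
  assumes U_functional: "functional U" and U_mult: "U (x \<star> y) = U x * U y" and U_one: "U \<one> = 1"
    and U_square: "U (ltrans H U x) = eps x"
begin

lemma ltrans_U_mult: "ltrans H U (x \<star> y) = ltrans H U x \<star> ltrans H U y"
  and rtrans_U_mult: "rtrans H U (x \<star> y) = rtrans H U x \<star> rtrans H U y"
  by (simp_all add: ltrans_def rtrans_def comul_mult ap_mult mult_bilinear U_functional U_mult)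

lemma trans_U_one: "ltrans H U \<one> = \<one>" "rtrans H U \<one> = \<one>"
  by (simp_all add: ltrans_def rtrans_def comul_one ap1_ten ap2_ten U_functional U_one)

end

text \<open>Results about the character \<open>U\<close> thereby specialise to the counit, which
  yields the normalisation of a twist.\<close>

lemma (in hopf) character_eps: "character H eps"
  by unfold_locales (simp_all add: eps_functional eps_mult eps_one trans_eps)

lemma (in character) U_square': "U (rtrans H U x) = eps x"
  using U_square[of x] ap_swap[OF U_functional U_functional] by (simp add: ltrans_def rtrans_def)

locale skew_functional = character H U for H :: "'i::finite hopf_ops" and U +
  fixes v :: "'i cvec \<Rightarrow> complex"
  assumes v_functional: "functional v" and v_mult: "v (x \<star> y) = v x * eps y + U x * v y"
begin

lemma v_one: "v \<one> = 0"
  using v_mult[of \<one> \<one>] by (simp add: mult_one eps_one U_one)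

end

section \<open>The cocycle equation contracted in its legs\<close>

locale twist_character = character H U for H :: "'i::finite hopf_ops" and U +
  fixes F G
  assumes FG: "hmul2 H F G = hone2 H" and GF: "hmul2 H G F = hone2 H"
    and twist_eq: "ten_mul (hmul2 H) (hmul H) (ten_map (hcomul H) id F) (F \<otimes> \<one>) =
      ten_mul (hmul2 H) (hmul H) (ten_assoc (ten_map id (hcomul H) F)) (ten_assoc (\<one> \<otimes> F))"
begin

lemma trans_linear': "Vector_Spaces.linear (*s) (*s) (ltrans H a)" "Vector_Spaces.linear (*s) (*s) (rtrans H a)"
  by (simp_all add: linear_s_iff trans_linear)

lemma ap2_legs:
  assumes "functional b"
  shows "ap2 b (ten_map (hcomul H) id F) = hcomul H (ap2 b F)" "ap2 b (F \<otimes> \<one>) = b \<one> *s F"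
    "ap2 b (ten_assoc (ten_map id (hcomul H) F)) = ten_map id (rtrans H b) F"
    "ap2 b (ten_assoc (\<one> \<otimes> F)) = \<one> \<otimes> ap2 b F"
  by (simp_all add: ap_ten_map(2)[OF assms comul_linear] ap2_ten[OF assms] ap2_ten_assoc_map[OF assms]
      ap2_ten_assoc_ten[OF assms] rtrans_def[abs_def])

lemma ap1_legs:
  assumes "functional a"
  shows "ap1 a (hcomul H x) = ltrans H a x" "ap1 a (ten_map id (rtrans H b) F) = rtrans H b (ap1 a F)"
    "ap1 a (\<one> \<otimes> y) = a \<one> *s y"
  by (simp_all add: ltrans_def ap_ten_map(1)[OF assms trans_linear'(2)] ap1_ten[OF assms])

text \<open>Only the third leg is contracted, so the remaining equation in the tensor square can
  still be contracted with any functional in either leg.\<close>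

lemma eq_U: "hmul2 H (hcomul H (ap2 U F)) F = hmul2 H (ten_map id (rtrans H U) F) (\<one> \<otimes> ap2 U F)"
  using arg_cong[OF twist_eq, of "ap2 U"]
  by (simp add: ap_mult(2)[OF ten_mul_bilinear U_functional U_mult] ap2_legs[OF U_functional] U_one)

lemma eq_UU: "ltrans H U (ap2 U F) \<star> ap1 U F = rtrans H U (ap1 U F) \<star> ap2 U F"
  using arg_cong[OF eq_U, of "ap1 U"]
  by (simp add: ap_mult(1)[OF mult_bilinear U_functional U_mult] ap1_legs[OF U_functional] U_one)

text \<open>\<open>U\<close> in the second and third legs: since \<open>U\<close> has order at most
  two, the contribution of the coproduct collapses to the counit, and a scalar is all that is left
  of the other factor.\<close>

lemma square_right: "rtrans H U (ap2 U F) \<star> ap2 U F = U (ap2 U F) *s ap2 eps F"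
  using arg_cong[OF eq_U, of "ap2 U"]
  by (simp add: ap_mult(2)[OF mult_bilinear U_functional U_mult] ap_ten_map(2)[OF U_functional] linear_s_iff
      rtrans_def[symmetric] U_square' ap2_ten[OF U_functional] mult_simps)

lemma square_left: "ltrans H U (ap1 U F) \<star> ap1 U F = U (ap1 U F) *s ap1 eps F"
proof -
  \<comment> \<open>\<open>W\<close> is \<open>U\<close> on each of the first two legs. Composed
    with the coproduct it gives the counit, again because \<open>U\<close> squares to the
    counit.\<close>
  define W where "W = (\<lambda>X. U (ap1 U X))"
  have f: "functional W" by (simp add: W_def functional_def ap1_simps functionalD[OF U_functional])
  have m: "W (hmul2 H X Y) = W X * W Y" for X Y
    by (simp add: W_def ap_mult(1)[OF mult_bilinear U_functional U_mult] U_mult)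
  have "ap1 W (ten_map (hcomul H) id F) = id (ap1 (\<lambda>x. W (hcomul H x)) F)"
    by (rule ap_ten_map(1)[OF f]) (simp add: linear_s_iff)
  also have "(\<lambda>x. W (hcomul H x)) = eps"
    by (simp add: W_def U_square ltrans_def[symmetric])
  finally have 1: "ap1 W (ten_map (hcomul H) id F) = ap1 eps F" unfolding id_apply .
  have 2: "ap1 W (ten_assoc (ten_map id (hcomul H) F)) = ltrans H U (ap1 U F)"
    unfolding W_def ltrans_def by (rule ap1_ten_assoc_map[OF U_functional U_functional comul_linear])
  have 3: "ap1 W (ten_assoc (\<one> \<otimes> F)) = ap1 U F"
    unfolding W_def using ap1_ten_assoc_ten[OF U_functional U_functional, of \<one> F] by (simp add: U_one)
  have 4: "ap1 W (F \<otimes> \<one>) = U (ap1 U F) *s \<one>"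
    unfolding ap1_ten[OF f] by (simp add: W_def)
  have 5: "ap1 W (ten_mul (hmul2 H) (hmul H) X Y) = ap1 W X \<star> ap1 W Y" for X Y :: "(('i \<times> 'i) \<times> 'i) cvec"
    by (rule ap_mult(1)[where a=W and m="hmul2 H", OF mult_bilinear f]) (rule m)
  have "ap1 eps F \<star> (U (ap1 U F) *s \<one>) = ltrans H U (ap1 U F) \<star> ap1 U F"
    using arg_cong[OF twist_eq, of "ap1 W"] by (simp only: 5 1 2 3 4)
  then show ?thesis by (simp add: mult_simps)
qed

lemma ap_inverse: "ap1 U F \<star> ap1 U G = \<one>" "ap1 U G \<star> ap1 U F = \<one>" "ap2 U F \<star> ap2 U G = \<one>" "ap2 U G \<star> ap2 U F = \<one>"
  using arg_cong[OF FG, of "ap1 U"] arg_cong[OF GF, of "ap1 U"] arg_cong[OF FG, of "ap2 U"] arg_cong[OF GF, of "ap2 U"]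
  by (simp_all add: ap_mult[OF mult_bilinear U_functional U_mult] ap1_ten ap2_ten U_functional U_one)

lemma twist_eps: "twist_character H eps F G"
  using character_eps FG GF twist_eq by (simp add: twist_character_def twist_character_axioms_def)

text \<open>The twist is not assumed to be normalised. For the counit, the square relations say that
  each contraction is a multiple of its own square root: its square is a scalar times itself. Being
  invertible, it is that scalar, and both scalars are the counit of \<open>H\<close> in both legs of
  \<open>F\<close>.\<close>

lemma scalar:
  obtains s where "s \<noteq> 0" "ap1 eps F = s *s \<one>" "ap2 eps F = s *s \<one>"
proof -
  interpret E: twist_character H eps F G by (rule twist_eps)
  have 1: "ap1 eps F = eps (ap1 eps F) *s \<one>"
    using arg_cong[OF E.square_left, of "\<lambda>x. x \<star> ap1 eps G"] by (simp add: trans_eps mult_simps E.ap_inverse)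
  have 2: "ap2 eps F = eps (ap2 eps F) *s \<one>"
    using arg_cong[OF E.square_right, of "\<lambda>x. x \<star> ap2 eps G"] by (simp add: trans_eps mult_simps E.ap_inverse)
  have "eps (ap1 eps F) * eps (ap1 eps G) = 1"
    using E.ap_inverse(1) by (metis eps_mult eps_one)
  then have "eps (ap1 eps F) \<noteq> 0" by auto
  then show ?thesis
    using that 1 2 ap_swap[OF eps_functional eps_functional, of F] by metis
qed

end

locale twist_skew = twist_character H U F G + skew_functional H U v for H :: "'i::finite hopf_ops" and U F G v
begin

text \<open>The first leg is paired with \<open>v\<close> and the third with \<open>U\<close>. The
  derivation rule of \<open>v\<close> produces the translation by \<open>v\<close>, and
  \<open>v \<one> = 0\<close> removes the second term on the right.\<close>

lemma eq_vU: "ltrans H v (ap2 U F) \<star> ap1 eps F + ltrans H U (ap2 U F) \<star> ap1 v F = rtrans H U (ap1 v F) \<star> ap2 U F"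
  using arg_cong[OF eq_U, of "ap1 v"]
  by (simp add: ap1_ten_mul[OF mult_bilinear v_functional v_mult] ap1_legs v_functional U_functional eps_functional
      v_one eps_one mult_simps)

lemma eq_v: "hmul2 H (hcomul H (ap2 v F)) F =
    hmul2 H (ten_map id (rtrans H v) F) (\<one> \<otimes> ap2 eps F) + hmul2 H (ten_map id (rtrans H U) F) (\<one> \<otimes> ap2 v F)"
  using arg_cong[OF twist_eq, of "ap2 v"]
  by (simp add: ap2_ten_mul[OF ten_mul_bilinear v_functional v_mult] ap2_legs v_functional U_functional eps_functional
      v_one eps_one bilinear_opD[OF ten_mul_bilinear])

lemma eq_Uv: "ltrans H U (ap2 v F) \<star> ap1 U F = rtrans H v (ap1 U F) \<star> ap2 eps F + rtrans H U (ap1 U F) \<star> ap2 v F"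
  using arg_cong[OF eq_v, of "ap1 U"]
  by (simp add: ap1_simps ap_mult(1)[OF mult_bilinear U_functional U_mult] ap1_legs U_functional U_one)

text \<open>These relations eliminate the contractions of the inverse twist with \<open>v\<close> in
  favour of those of the twist itself.\<close>

lemma ap_v_inverse:
  "ap1 v G \<star> ap1 eps F + ap1 U G \<star> ap1 v F = 0" "ap2 v G \<star> ap2 eps F + ap2 U G \<star> ap2 v F = 0"
  using arg_cong[OF GF, of "ap1 v"] arg_cong[OF GF, of "ap2 v"]
  by (simp_all add: ap1_ten_mul[OF mult_bilinear v_functional v_mult] ap2_ten_mul[OF mult_bilinear v_functional v_mult]
      ap1_ten ap2_ten v_functional v_one)

end

lemma (in twist_skew) eq_vv:
  assumes "skew_functional H U w"
  shows "ltrans H w (ap2 v F) \<star> ap1 eps F + ltrans H U (ap2 v F) \<star> ap1 w F =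
    rtrans H v (ap1 w F) \<star> ap2 eps F + rtrans H U (ap1 w F) \<star> ap2 v F"
proof -
  interpret w: skew_functional H U w by (rule assms)
  show ?thesis
    using arg_cong[OF eq_v, of "ap1 w"]
    by (simp add: ap1_simps ap1_ten_mul[OF mult_bilinear w.v_functional w.v_mult] ap1_legs w.v_functional
      U_functional eps_functional w.v_one eps_one mult_simps)
qed

section \<open>Inner twisted derivations and the commutator form\<close>

text \<open>
  In the application \<open>z\<close> is the indicator function of the complement of \<open>{1, u}\<close> in \<open>G\<close>.
\<close>

locale skew_data = character H U for H :: "'i::finite hopf_ops" and U +
  fixes V :: "'n::finite \<Rightarrow> 'i cvec \<Rightarrow> complex" and z :: "'i cvec" and c d :: "'n \<Rightarrow> 'i cvec"
  assumes V_skew: "skew_functional H U (V k)"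
    and trans_square: "ltrans H U (ltrans H U x) = x" "rtrans H U (rtrans H U x) = x"
      "rtrans H U (ltrans H U x) = ltrans H U (rtrans H U x)"
    and z_idem: "z \<star> z = z" and z_central: "x \<star> z = z \<star> x"
    and z_trans: "ltrans H U z = z" "rtrans H U z = z"
    and c_z: "z \<star> c k = c k" and d_z: "z \<star> d k = d k"
    and c_trans: "rtrans H U (c k) = c k" and d_trans: "ltrans H U (d k) = d k"
    and V_inner_l: "z \<star> ltrans H (V k) x = c k \<star> x - ltrans H U x \<star> c k"
    and V_inner_r: "z \<star> rtrans H (V k) x = d k \<star> x - rtrans H U x \<star> d k"
    and unique_l: "(\<And>y. q \<star> y = ltrans H U y \<star> q) \<Longrightarrow> z \<star> q = q \<Longrightarrow> q = 0"
    and unique_r: "(\<And>y. q \<star> y = rtrans H U y \<star> q) \<Longrightarrow> z \<star> q = q \<Longrightarrow> q = 0"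
    and comm_trans: "ltrans H U (rtrans H U (c k \<star> d l - d l \<star> c k)) = c k \<star> d l - d l \<star> c k"
begin

definition e :: "'n \<Rightarrow> 'n \<Rightarrow> 'i cvec"
  where "e k l = c k \<star> d l - d l \<star> c k"

lemma z_left: "x \<star> (z \<star> y) = z \<star> (x \<star> y)"
  by (metis mult_assoc z_central)

lemma z_z: "z \<star> (z \<star> y) = z \<star> y"
  by (metis mult_assoc z_idem)

end

locale skew_twist = skew_data H U V z c d + twist_character H U F G
  for H :: "'i::finite hopf_ops" and U and V :: "'n::finite \<Rightarrow> 'i cvec \<Rightarrow> complex" and z c d F G
begin

abbreviation "\<tau> \<equiv> ltrans H U"
abbreviation "\<sigma> \<equiv> rtrans H U"
abbreviation "lam \<equiv> ap1 U F"
abbreviation "lam' \<equiv> ap1 U G"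
abbreviation "rho \<equiv> ap2 U F"
abbreviation "rho' \<equiv> ap2 U G"

definition sc :: complex where "sc = eps (ap1 eps F)"

lemma sc: "sc \<noteq> 0" "ap1 eps F = sc *s \<one>" "ap2 eps F = sc *s \<one>"
proof -
  obtain s where s: "s \<noteq> 0" "ap1 eps F = s *s \<one>" "ap2 eps F = s *s \<one>" by (rule scalar)
  then have "sc = s" by (simp add: sc_def functionalD[OF eps_functional] eps_one)
  then show "sc \<noteq> 0" "ap1 eps F = sc *s \<one>" "ap2 eps F = sc *s \<one>" using s by simp_all
qed

lemma skew: "twist_skew H U F G (V k)"
  using V_skew[of k] FG GF twist_eq
  by (simp add: twist_skew_def twist_character_def twist_character_axioms_def skew_functional_def)

text \<open>Chosen to absorb the derivation terms of the contracted equations: multiplied by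
  \<open>z\<close>, translation by \<open>V k\<close> becomes a twisted commutator with
  \<open>c k\<close> or \<open>d k\<close>, and the leftover terms combine to give
  \<open>m_rel\<close> and \<open>n_rel\<close>.\<close>

definition m :: "'n \<Rightarrow> 'i cvec" where "m k = sc *s c k - z \<star> ap1 (V k) F"
definition n :: "'n \<Rightarrow> 'i cvec" where "n k = sc *s d k - z \<star> ap2 (V k) F"

lemmas U_trans = ltrans_U_mult rtrans_U_mult trans_diff trans_linear z_trans

lemma m_rel: "\<tau> rho \<star> m k = \<sigma> (m k) \<star> rho"
proof -
  let ?u = "ap1 (V k) F"
  have "sc *s ltrans H (V k) rho + \<tau> rho \<star> ?u = \<sigma> ?u \<star> rho"
    using twist_skew.eq_vU[OF skew, of k] by (simp add: sc mult_simps)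
  then have "z \<star> (sc *s ltrans H (V k) rho + \<tau> rho \<star> ?u) = z \<star> (\<sigma> ?u \<star> rho)" by simp
  then have "sc *s (c k \<star> rho - \<tau> rho \<star> c k) + z \<star> (\<tau> rho \<star> ?u) = z \<star> (\<sigma> ?u \<star> rho)"
    by (simp add: mult_simps V_inner_l)
  then have 1: "z \<star> (\<tau> rho \<star> ?u) = z \<star> (\<sigma> ?u \<star> rho) - sc *s (c k \<star> rho - \<tau> rho \<star> c k)"
    by (metis add_diff_cancel_left')
  show ?thesis
    by (simp add: m_def mult_simps U_trans c_trans z_left[of "\<tau> rho"] 1 vec.scale_right_diff_distrib)
qed

lemma n_rel: "\<sigma> lam \<star> n k = \<tau> (n k) \<star> lam"
proof -
  let ?t = "ap2 (V k) F"
  have "\<tau> ?t \<star> lam = sc *s rtrans H (V k) lam + \<sigma> lam \<star> ?t"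
    using twist_skew.eq_Uv[OF skew, of k] by (simp add: sc mult_simps)
  then have "z \<star> (\<tau> ?t \<star> lam) = z \<star> (sc *s rtrans H (V k) lam + \<sigma> lam \<star> ?t)" by simp
  then have "z \<star> (\<tau> ?t \<star> lam) = sc *s (d k \<star> lam - \<sigma> lam \<star> d k) + z \<star> (\<sigma> lam \<star> ?t)"
    by (simp add: mult_simps V_inner_r)
  then have 1: "z \<star> (\<sigma> lam \<star> ?t) = z \<star> (\<tau> ?t \<star> lam) - sc *s (d k \<star> lam - \<sigma> lam \<star> d k)"
    by (metis add_diff_cancel_left')
  show ?thesis
    by (simp add: n_def mult_simps U_trans d_trans z_left[of "\<sigma> lam"] 1 vec.scale_right_diff_distrib)
qed

lemma c_right: "c k \<star> (z \<star> x) = c k \<star> x" and d_right: "d k \<star> (z \<star> x) = d k \<star> x"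
  using c_z d_z by (metis mult_assoc z_left)+

text \<open>
  The cocycle equation with skew-primitive vectors in both outer legs relates the commutators
  \<open>e k l\<close> to the elements \<open>m k\<close>, \<open>n l\<close>, which implement the translations after twisting.
\<close>

lemma mn_rel: "(sc * sc) *s e k l = \<sigma> (m k) \<star> n l - \<tau> (n l) \<star> m k"
proof -
  let ?u = "ap1 (V k) F" and ?t = "ap2 (V l) F"
  have "sc *s ltrans H (V k) ?t + \<tau> ?t \<star> ?u = sc *s rtrans H (V l) ?u + \<sigma> ?u \<star> ?t"
    using twist_skew.eq_vv[OF skew V_skew, of k l] by (simp add: sc mult_simps)
  then have "z \<star> (sc *s ltrans H (V k) ?t + \<tau> ?t \<star> ?u) = z \<star> (sc *s rtrans H (V l) ?u + \<sigma> ?u \<star> ?t)" by simp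
  then have 0: "sc *s (c k \<star> ?t - \<tau> ?t \<star> c k) + z \<star> (\<tau> ?t \<star> ?u) = sc *s (d l \<star> ?u - \<sigma> ?u \<star> d l) + z \<star> (\<sigma> ?u \<star> ?t)"
    by (simp add: mult_simps V_inner_r V_inner_l)
  have 1: "\<sigma> (m k) = sc *s c k - z \<star> \<sigma> ?u" "\<tau> (n l) = sc *s d l - z \<star> \<tau> ?t"
    by (simp_all add: m_def n_def U_trans c_trans d_trans)
  have 2: "z \<star> (\<sigma> ?u \<star> d l) = \<sigma> ?u \<star> d l" "z \<star> (\<tau> ?t \<star> c k) = \<tau> ?t \<star> c k"
    using z_left c_z d_z by metis+
  have 3: "\<sigma> (m k) \<star> n l = (sc * sc) *s (c k \<star> d l) - sc *s (c k \<star> ?t) - sc *s (\<sigma> ?u \<star> d l) + z \<star> (\<sigma> ?u \<star> ?t)"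
    unfolding 1 n_def
    by (simp add: mult_simps 2 c_right z_left[of "\<sigma> ?u"] z_z vec.scale_right_diff_distrib)
  have 4: "\<tau> (n l) \<star> m k = (sc * sc) *s (d l \<star> c k) - sc *s (d l \<star> ?u) - sc *s (\<tau> ?t \<star> c k) + z \<star> (\<tau> ?t \<star> ?u)"
    unfolding 1 m_def
    by (simp add: mult_simps 2 d_right z_left[of "\<tau> ?t"] z_z vec.scale_right_diff_distrib)
  have 5: "z \<star> (\<sigma> ?u \<star> ?t) = sc *s (c k \<star> ?t - \<tau> ?t \<star> c k) + z \<star> (\<tau> ?t \<star> ?u) - sc *s (d l \<star> ?u - \<sigma> ?u \<star> d l)"
    unfolding 0 by simp
  show ?thesis
    unfolding 3 4 5 e_def by (simp add: vec.scale_right_diff_distrib algebra_simps)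
qed

text \<open>The contraction of the cocycle equation with \<open>U\<close> in both outer legs. It has
  two factorisations, by \<open>eq_UU\<close>, and both are used.\<close>

definition kappa :: "'i cvec" where "kappa = \<tau> rho \<star> lam"

lemma kappa: "kappa = \<sigma> lam \<star> rho"
  using eq_UU by (simp add: kappa_def)

lemma cancel: "lam \<star> (lam' \<star> x) = x" "lam' \<star> (lam \<star> x) = x" "rho \<star> (rho' \<star> x) = x" "rho' \<star> (rho \<star> x) = x"
  by (simp_all add: ap_inverse mult_one flip: mult_assoc)

text \<open>In one product of \<open>mn_rel\<close> the relation \<open>m_rel\<close> extracts the
  first factorisation of \<open>kappa\<close>, in the other \<open>n_rel\<close> extracts the
  second. The common left factor leaves an honest commutator.\<close>

lemma e_kappa: "(sc * sc) *s e k l = kappa \<star> ((lam' \<star> m k) \<star> (rho' \<star> n l) - (rho' \<star> n l) \<star> (lam' \<star> m k))"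
proof -
  have 1: "\<sigma> (m k) \<star> n l = kappa \<star> ((lam' \<star> m k) \<star> (rho' \<star> n l))"
    by (simp add: kappa_def mult_assoc cancel) (metis m_rel mult_assoc cancel(3))
  have 2: "\<tau> (n l) \<star> m k = kappa \<star> ((rho' \<star> n l) \<star> (lam' \<star> m k))"
    by (simp add: kappa mult_assoc cancel) (metis n_rel mult_assoc cancel(1))
  show ?thesis unfolding mn_rel 1 2 by (simp add: mult_simps)
qed

text \<open>With opposite factorisations in the two places, the translate of \<open>lam\<close>
  meets \<open>lam\<close> in the middle; \<open>square_left\<close> makes this a scalar, and then
  \<open>square_right\<close> applies to \<open>rho\<close>.\<close>

lemma kappa_square: "\<tau> (\<sigma> kappa) \<star> kappa = (U lam * U lam * sc * sc) *s \<one>"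
proof -
  have l: "\<tau> lam \<star> lam = (U lam * sc) *s \<one>" using square_left by (simp add: sc)
  have r: "\<sigma> rho \<star> rho = (U lam * sc) *s \<one>"
    using square_right ap_swap[OF U_functional U_functional, of F] by (simp add: sc)
  have "\<tau> (\<sigma> kappa) = \<sigma> rho \<star> \<sigma> (\<tau> lam)"
    by (simp add: kappa_def U_trans trans_square)
  then have "\<tau> (\<sigma> kappa) \<star> kappa = \<sigma> rho \<star> (\<sigma> (\<tau> lam \<star> lam) \<star> rho)"
    by (simp add: kappa U_trans mult_assoc)
  also have "\<dots> = (U lam * U lam * sc * sc) *s \<one>"
    by (simp add: l r U_trans trans_U_one mult_simps mult_ac)
  finally show ?thesis .
qed

text \<open>After the contractions of \<open>G\<close> with \<open>V k\<close> are eliminated, the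
  formulas have the shape of \<open>V_inner_l\<close> and \<open>V_inner_r\<close> with
  \<open>c k\<close> and \<open>d k\<close> replaced by \<open>lam' \<star> m k\<close> and
  \<open>rho' \<star> n k\<close>.\<close>

lemma twisted_inner:
  defines "P \<equiv> \<lambda>x. hmul2 H (hmul2 H G (hcomul H x)) F"
  shows "z \<star> ap1 (V k) (P x) = (lam' \<star> m k) \<star> x - ap1 U (P x) \<star> (lam' \<star> m k)"
    "z \<star> ap2 (V k) (P x) = (rho' \<star> n k) \<star> x - ap2 U (P x) \<star> (rho' \<star> n k)"
    "ap1 U (P x) = lam' \<star> (\<tau> x \<star> lam)" "ap2 U (P x) = rho' \<star> (\<sigma> x \<star> rho)"
proof -
  interpret v: twist_skew H U F G "V k" by (rule skew)
  let ?u = "ap1 (V k) F" and ?t = "ap2 (V k) F"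
  note s1 = ap1_ten_mul[OF mult_bilinear v.v_functional v.v_mult] ap_mult(1)[OF mult_bilinear U_functional U_mult]
    ap_mult(1)[OF mult_bilinear eps_functional eps_mult] ltrans_def[symmetric] trans_eps
  note s2 = ap2_ten_mul[OF mult_bilinear v.v_functional v.v_mult] ap_mult(2)[OF mult_bilinear U_functional U_mult]
    ap_mult(2)[OF mult_bilinear eps_functional eps_mult] rtrans_def[symmetric] trans_eps
  show u: "ap1 U (P x) = lam' \<star> (\<tau> x \<star> lam)" "ap2 U (P x) = rho' \<star> (\<sigma> x \<star> rho)"
    by (simp_all add: P_def s1 s2 mult_assoc)
  have g: "sc *s ap1 (V k) G = - (lam' \<star> ?u)" "sc *s ap2 (V k) G = - (rho' \<star> ?t)"
    using v.ap_v_inverse by (simp_all add: sc mult_simps eq_neg_iff_add_eq_0)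
  have "ap1 (V k) (P x) = (sc *s ap1 (V k) G) \<star> x + lam' \<star> (sc *s ltrans H (V k) x + \<tau> x \<star> ?u)"
    by (simp add: P_def s1 sc mult_simps algebra_simps)
  also have "z \<star> \<dots> = lam' \<star> (sc *s (z \<star> ltrans H (V k) x) + z \<star> (\<tau> x \<star> ?u) - z \<star> (?u \<star> x))"
    unfolding g by (simp add: mult_simps z_left[of lam'])
  also have "\<dots> = (lam' \<star> m k) \<star> x - ap1 U (P x) \<star> (lam' \<star> m k)"
    unfolding u V_inner_l m_def
    by (simp add: mult_simps cancel z_left[of "\<tau> x"] vec.scale_right_diff_distrib)
  finally show "z \<star> ap1 (V k) (P x) = (lam' \<star> m k) \<star> x - ap1 U (P x) \<star> (lam' \<star> m k)" .
  have "ap2 (V k) (P x) = (sc *s ap2 (V k) G) \<star> x + rho' \<star> (sc *s rtrans H (V k) x + \<sigma> x \<star> ?t)"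
    by (simp add: P_def s2 sc mult_simps algebra_simps)
  also have "z \<star> \<dots> = rho' \<star> (sc *s (z \<star> rtrans H (V k) x) + z \<star> (\<sigma> x \<star> ?t) - z \<star> (?t \<star> x))"
    unfolding g by (simp add: mult_simps z_left[of rho'])
  also have "\<dots> = (rho' \<star> n k) \<star> x - ap2 U (P x) \<star> (rho' \<star> n k)"
    unfolding u V_inner_r n_def
    by (simp add: mult_simps cancel z_left[of "\<sigma> x"] vec.scale_right_diff_distrib)
  finally show "z \<star> ap2 (V k) (P x) = (rho' \<star> n k) \<star> x - ap2 U (P x) \<star> (rho' \<star> n k)" .
qed

end

section \<open>Transport along an isomorphism onto the twisted algebra\<close>

locale skew_twist_iso = skew_twist H U V z c d F G + K: skew_data K UK VK zK cK dK
  for H K :: "'i::finite hopf_ops" and U UK and V VK :: "'n::finite \<Rightarrow> 'i cvec \<Rightarrow> complex" and z zK c cK d dK F G +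
  fixes f :: "'i cvec \<Rightarrow> 'i cvec" and T :: "'n \<Rightarrow> 'n \<Rightarrow> complex" and t :: "'n \<Rightarrow> complex"
  assumes f_linear: "Vector_Spaces.linear (*s) (*s) f" and f_surj: "surj f"
    and f_mult: "f (hmul K x y) = f x \<star> f y" and f_one: "f (hone K) = \<one>"
    and f_comul: "ten_map f f (hcomul K x) = hmul2 H (hmul2 H G (hcomul H (f x))) F"
    and f_z: "f zK = z" and f_U: "U (f x) = UK x"
    and f_V: "V k (f x) = (\<Sum>j\<in>UNIV. T k j * VK j x) + t k * (hcounit K x - UK x)"
begin

definition CK where "CK k = (\<Sum>j\<in>UNIV. T k j *s cK j)"
definition DK where "DK k = (\<Sum>j\<in>UNIV. T k j *s dK j)"

lemma f_simps: "f (x + y) = f x + f y" "f (a *s x) = a *s f x" "f 0 = 0" "f (x - y) = f x - f y" "f (sum g A) = (\<Sum>i\<in>A. f (g i))"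
proof -
  show l: "f (x + y) = f x + f y" "f (a *s x) = a *s f x" for x y a
    using f_linear by (simp_all add: linear_s_iff)
  show "f 0 = 0" using l(2)[of 0 0] by simp
  show "f (x - y) = f x - f y" using l(1)[of "x - y" y] by (simp add: algebra_simps)
  show "f (sum g A) = (\<Sum>i\<in>A. f (g i))" by (rule vec.linear_sum[OF f_linear])
qed

lemma ap_combination:
  "ap1 (\<lambda>x. V k (f x)) X = (\<Sum>j\<in>UNIV. T k j *s ap1 (VK j) X) + t k *s (ap1 (hcounit K) X - ap1 UK X)"
  "ap2 (\<lambda>x. V k (f x)) X = (\<Sum>j\<in>UNIV. T k j *s ap2 (VK j) X) + t k *s (ap2 (hcounit K) X - ap2 UK X)"
  by (rule linear_pair_eqI[where x=X];
      simp add: ap1_simps ap2_simps f_V sum.distrib vec.scale_right_distrib vec.scale_left_distrib vec.scale_sum_right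
        vec.scale_sum_left vec.scale_left_diff_distrib vec.scale_right_diff_distrib mult_ac algebra_simps)+

lemma V_functional: "functional (V k)"
  using V_skew[of k] by (simp add: skew_functional_def skew_functional_axioms_def)

lemma f_trans:
  "ap1 U (hmul2 H (hmul2 H G (hcomul H (f x))) F) = f (ltrans K UK x)"
  "ap2 U (hmul2 H (hmul2 H G (hcomul H (f x))) F) = f (rtrans K UK x)"
  by (simp_all flip: f_comul add: ap_ten_map U_functional f_linear f_U ltrans_def rtrans_def)

lemma K_sum: "hmul K (sum g A) y = (\<Sum>i\<in>A. hmul K (g i) y)" "hmul K y (sum g A) = (\<Sum>i\<in>A. hmul K y (g i))"
  for g :: "'b \<Rightarrow> 'i cvec"
  by (induction A rule: infinite_finite_induct) (simp_all add: K.mult_simps)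

lemma K_inner: "hmul K zK (\<Sum>j\<in>UNIV. T k j *s ltrans K (VK j) x) = hmul K (CK k) x - hmul K (ltrans K UK x) (CK k)"
  "hmul K zK (\<Sum>j\<in>UNIV. T k j *s rtrans K (VK j) x) = hmul K (DK k) x - hmul K (rtrans K UK x) (DK k)"
  by (simp_all add: K_sum CK_def DK_def K.mult_simps K.V_inner_l K.V_inner_r vec.scale_right_diff_distrib sum_subtractf)

lemma z_CK: "z \<star> f (CK k) = f (CK k)" "z \<star> f (DK k) = f (DK k)"
  by (simp_all add: f_z[symmetric] f_mult[symmetric] CK_def DK_def K_sum K.mult_simps K.c_z K.d_z)

lemma z_m: "z \<star> m k = m k" "z \<star> n k = n k"
  by (simp_all add: m_def n_def mult_simps c_z d_z z_z)

text \<open>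
  Both sides implement the same twisted derivation, so \<open>unique_l\<close> applies to their difference.
\<close>

lemma C_eq: "lam' \<star> m k = f (CK k) + t k *s z"
proof -
  define q where "q = lam' \<star> m k - (f (CK k) + t k *s z)"
  have q: "q \<star> f x = f (ltrans K UK x) \<star> q" for x
  proof -
    have "z \<star> ap1 (V k) (ten_map f f (hcomul K x)) = z \<star> f ((\<Sum>j\<in>UNIV. T k j *s ltrans K (VK j) x) + t k *s (x - ltrans K UK x))"
      by (simp add: ap_ten_map(1)[OF V_functional f_linear] ap_combination flip: ltrans_def) (simp add: K.trans_eps)
    also have "\<dots> = f (hmul K zK (\<Sum>j\<in>UNIV. T k j *s ltrans K (VK j) x)) + t k *s (z \<star> f x - z \<star> f (ltrans K UK x))"
      by (simp add: f_simps f_mult f_z mult_simps)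
    also have "\<dots> = (f (CK k) + t k *s z) \<star> f x - f (ltrans K UK x) \<star> (f (CK k) + t k *s z)"
      by (simp add: K_inner f_simps f_mult mult_simps z_central[of "f (ltrans K UK x)"] vec.scale_right_diff_distrib)
    finally show ?thesis
      unfolding f_comul twisted_inner(1) f_trans q_def by (simp add: mult_simps algebra_simps)
  qed
  \<comment> \<open>The twisted translation is the original one conjugated by \<open>lam\<close>, so
    multiplication by \<open>lam\<close> brings the relation for \<open>q\<close> into the form
    required by \<open>unique_l\<close>.\<close>
  have "lam \<star> q = 0"
  proof (rule unique_l)
    show "z \<star> (lam \<star> q) = lam \<star> q"
      by (simp add: q_def mult_simps z_left[of lam, symmetric] z_left[of lam', symmetric] z_CK z_m z_idem)
    fix y
    obtain x where x: "y = f x" using f_surj by (metis surjD)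
    have "lam \<star> (q \<star> y) = lam \<star> (f (ltrans K UK x) \<star> q)" by (simp add: q x)
    also have "\<dots> = \<tau> y \<star> (lam \<star> q)"
      unfolding f_trans[symmetric] twisted_inner(3) x by (simp add: mult_assoc cancel)
    finally show "lam \<star> q \<star> y = \<tau> y \<star> (lam \<star> q)" by (simp add: mult_assoc)
  qed
  then have "lam' \<star> (lam \<star> q) = 0" by (simp add: mult_simps)
  then show ?thesis by (simp add: cancel q_def)
qed

lemma D_eq: "rho' \<star> n k = f (DK k) + t k *s z"
proof -
  define q where "q = rho' \<star> n k - (f (DK k) + t k *s z)"
  have q: "q \<star> f x = f (rtrans K UK x) \<star> q" for x
  proof -
    have "z \<star> ap2 (V k) (ten_map f f (hcomul K x)) = z \<star> f ((\<Sum>j\<in>UNIV. T k j *s rtrans K (VK j) x) + t k *s (x - rtrans K UK x))"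
      by (simp add: ap_ten_map(2)[OF V_functional f_linear] ap_combination flip: rtrans_def) (simp add: K.trans_eps)
    also have "\<dots> = f (hmul K zK (\<Sum>j\<in>UNIV. T k j *s rtrans K (VK j) x)) + t k *s (z \<star> f x - z \<star> f (rtrans K UK x))"
      by (simp add: f_simps f_mult f_z mult_simps)
    also have "\<dots> = (f (DK k) + t k *s z) \<star> f x - f (rtrans K UK x) \<star> (f (DK k) + t k *s z)"
      by (simp add: K_inner f_simps f_mult mult_simps z_central[of "f (rtrans K UK x)"] vec.scale_right_diff_distrib)
    finally show ?thesis
      unfolding f_comul twisted_inner(2) f_trans q_def by (simp add: mult_simps algebra_simps)
  qed
  have "rho \<star> q = 0"
  proof (rule unique_r)
    show "z \<star> (rho \<star> q) = rho \<star> q"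
      by (simp add: q_def mult_simps z_left[of rho, symmetric] z_left[of rho', symmetric] z_CK z_m z_idem)
    fix y
    obtain x where x: "y = f x" using f_surj by (metis surjD)
    have "rho \<star> (q \<star> y) = rho \<star> (f (rtrans K UK x) \<star> q)" by (simp add: q x)
    also have "\<dots> = \<sigma> y \<star> (rho \<star> q)"
      unfolding f_trans[symmetric] twisted_inner(4) x by (simp add: mult_assoc cancel)
    finally show "rho \<star> q \<star> y = \<sigma> y \<star> (rho \<star> q)" by (simp add: mult_assoc)
  qed
  then have "rho' \<star> (rho \<star> q) = 0" by (simp add: mult_simps)
  then show ?thesis by (simp add: cancel q_def)
qed

definition EK where "EK k l = hmul K (CK k) (DK l) - hmul K (DK l) (CK k)"

lemma EK_sum: "EK k l = (\<Sum>i\<in>UNIV. \<Sum>j\<in>UNIV. (T k i * T l j) *s K.e i j)"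
proof -
  have "hmul K (CK k) (DK l) = (\<Sum>i\<in>UNIV. \<Sum>j\<in>UNIV. (T k i * T l j) *s hmul K (cK i) (dK j))"
    by (simp add: CK_def DK_def K_sum K.mult_simps vec.scale_sum_right mult.commute) (rule sum.swap)
  moreover have "hmul K (DK l) (CK k) = (\<Sum>i\<in>UNIV. \<Sum>j\<in>UNIV. (T k i * T l j) *s hmul K (dK j) (cK i))"
    by (simp add: CK_def DK_def K_sum K.mult_simps vec.scale_sum_right)
  ultimately show ?thesis
    by (simp add: EK_def K.e_def vec.scale_right_diff_distrib sum_subtractf)
qed

lemma EK_trans: "ltrans K UK (rtrans K UK (EK k l)) = EK k l"
proof -
  have s: "ltrans K UK (sum g A) = (\<Sum>i\<in>A. ltrans K UK (g i))" "rtrans K UK (sum g A) = (\<Sum>i\<in>A. rtrans K UK (g i))"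
    for g :: "'n \<Rightarrow> 'i cvec" and A
    using K.trans_linear(2)[of UK 0 0] K.trans_linear(4)[of UK 0 0]
    by (induction A rule: infinite_finite_induct) (simp_all add: K.trans_linear)
  have "ltrans K UK (rtrans K UK (K.e i j)) = K.e i j" for i j
    unfolding K.e_def by (rule K.comm_trans)
  then show ?thesis
    unfolding EK_sum by (simp add: s K.trans_linear)
qed

text \<open>The trivial parts \<open>t k *s z\<close> are central and disappear from the commutator,
  so only the change of basis \<open>T\<close> remains.\<close>

lemma e_EK: "(sc * sc) *s e k l = kappa \<star> f (EK k l)"
proof -
  have "(lam' \<star> m k) \<star> (rho' \<star> n l) - (rho' \<star> n l) \<star> (lam' \<star> m k) = f (EK k l)"
    unfolding C_eq D_eq EK_def f_simps f_mult by (simp add: mult_simps z_central[of "f _"] algebra_simps)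
  then show ?thesis by (simp add: e_kappa)
qed

text \<open>Through \<open>f\<close>, translating on both sides in \<open>K\<close> becomes
  translating in \<open>H\<close> followed by conjugation with \<open>kappa\<close>. For a fixed
  point of the former this is a commutation rule.\<close>

lemma kappa_commute:
  assumes "ltrans K UK (rtrans K UK x) = x"
  shows "kappa \<star> f x = \<tau> (\<sigma> (f x)) \<star> kappa"
proof -
  have "f x = lam' \<star> (\<tau> (rho' \<star> (\<sigma> (f x) \<star> rho)) \<star> lam)"
    using assms f_trans twisted_inner(3,4) by metis
  then have "kappa \<star> f x = kappa \<star> (lam' \<star> (\<tau> (rho' \<star> (\<sigma> (f x) \<star> rho)) \<star> lam))" by simp
  also have "\<dots> = \<tau> (rho \<star> rho') \<star> (\<tau> (\<sigma> (f x)) \<star> kappa)"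
    by (simp add: kappa_def mult_assoc cancel U_trans)
  finally show ?thesis by (simp add: ap_inverse trans_U_one mult_one)
qed

text \<open>
  \<open>kappa\<close> itself is not controlled, but \<open>\<tau> (\<sigma> kappa) \<star> kappa\<close> is a scalar and \<open>\<tau> \<circ> \<sigma>\<close> fixes \<open>e i j\<close>.
\<close>

theorem e_mult_e: "\<exists>a. \<forall>i j k l. e i j \<star> e k l = a *s f (hmul K (EK i j) (EK k l))"
proof (intro exI allI)
  fix i j k l
  have "(sc * sc) *s e i j = \<tau> (\<sigma> ((sc * sc) *s e i j))"
    unfolding trans_linear e_def comm_trans ..
  also have "\<dots> = \<tau> (\<sigma> kappa) \<star> \<tau> (\<sigma> (f (EK i j)))"
    by (simp add: e_EK U_trans)
  finally have "((sc * sc) *s e i j) \<star> ((sc * sc) *s e k l) = \<tau> (\<sigma> kappa) \<star> (\<tau> (\<sigma> (f (EK i j))) \<star> (kappa \<star> f (EK k l)))"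
    by (simp only: e_EK mult_assoc)
  also have "\<dots> = (\<tau> (\<sigma> kappa) \<star> kappa) \<star> (f (EK i j) \<star> f (EK k l))"
    using kappa_commute[OF EK_trans, of i j] by (simp add: mult_assoc) (metis mult_assoc)
  also have "\<dots> = (U lam * U lam * sc * sc) *s f (hmul K (EK i j) (EK k l))"
    by (simp add: kappa_square mult_simps f_mult)
  finally have "(sc * sc * (sc * sc)) *s (e i j \<star> e k l) = (U lam * U lam * sc * sc) *s f (hmul K (EK i j) (EK k l))"
    by (simp add: mult_simps)
  then have "(1 / (sc * sc * (sc * sc))) *s ((sc * sc * (sc * sc)) *s (e i j \<star> e k l)) =
      (1 / (sc * sc * (sc * sc))) *s ((U lam * U lam * sc * sc) *s f (hmul K (EK i j) (EK k l)))" by simp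
  then show "e i j \<star> e k l = ((1 / (sc * sc * (sc * sc))) * (U lam * U lam * sc * sc)) *s f (hmul K (EK i j) (EK k l))"
    using sc(1) by simp
qed

end

subsection \<open>The discriminant\<close>

lemma ap1_coordinate: "ap1 (\<lambda>x. x $ i) X = slice1 i X"
  by (rule linear_pair_eqI[where f="ap1 (\<lambda>x. x $ i)"]) (simp_all add: ap1_simps slice1_simps slice1_basis)

lemma ap2_coordinate: "ap2 (\<lambda>x. x $ i) X = slice2 i X"
  by (rule linear_pair_eqI[where f="ap2 (\<lambda>x. x $ i)"]) (simp_all add: ap2_simps slice2_simps slice2_basis)

section \<open>The implementing elements in the dual\<close>

locale char_regular = char_quad \<alpha> \<beta> u p q r for \<alpha> \<beta> :: "'g::{finite,ab_group_add} \<Rightarrow> complex" and u p q r +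
  assumes regular: "g \<noteq> 0 \<Longrightarrow> g \<noteq> u \<Longrightarrow> Qa g * Qb g - (Qm g)\<^sup>2 \<noteq> 0"
begin

abbreviation smult (infixl "\<star>" 70) where "x \<star> y \<equiv> hmul H x y"

definition U :: "(2 set \<times> 'g) cvec \<Rightarrow> complex" where "U x = x $ ({}, u)"
definition V :: "2 \<Rightarrow> (2 set \<times> 'g) cvec \<Rightarrow> complex" where "V k x = x $ ({k}, 0)"

definition Dt :: "'g \<Rightarrow> complex" where "Dt g = Qa g * Qb g - (Qm g)\<^sup>2"

text \<open>
  Half the inverse of the matrix of \<open>gB - B\<close>. For \<open>g\<close> equal to \<open>0\<close> or \<open>u\<close> this matrix is zero, and the
  division by zero gives the value \<open>0\<close> that is needed there.
\<close>

definition cf :: "2 \<Rightarrow> 2 \<Rightarrow> 'g \<Rightarrow> complex"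
  where "cf k l g = (if k = l then (if k = 1 then Qb g else Qa g) else - Qm g) / (2 * Dt g)"

definition chr :: "2 \<Rightarrow> 'g \<Rightarrow> complex" where "chr k g = (if k = 1 then \<alpha> g else \<beta> g)"

definition z :: "(2 set \<times> 'g) cvec"
  where "z = (\<chi> i. if fst i = {} \<and> snd i \<noteq> 0 \<and> snd i \<noteq> u then 1 else 0)"

text \<open>In a Clifford algebra the twisted commutator with an odd vector is twice its pairing
  under the form. Half of a row of the inverse matrix therefore implements contraction with
  \<open>V k\<close>.\<close>

definition c :: "2 \<Rightarrow> (2 set \<times> 'g) cvec"
  where "c k = (\<chi> i. if fst i = {1} then cf k 1 (snd i) else if fst i = {2} then cf k 2 (snd i) else 0)"

text \<open>Right translation by \<open>V k\<close> differs from left translation by the factor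
  \<open>chr k\<close> and by the order in the wedge coefficient; see
  \<open>trans_V_nth\<close>.\<close>

definition d :: "2 \<Rightarrow> (2 set \<times> 'g) cvec"
  where "d k = (\<chi> i. - chr k (snd i) * c k $ i)"

lemma set2_neq: "{1::2} \<noteq> {2}" "{2::2} \<noteq> {1}" "{1,2::2} \<noteq> {1}" "{1,2::2} \<noteq> {2}"
  by auto

lemma z_nth: "z $ ({}, g) = (if g = 0 \<or> g = u then 0 else 1)" "z $ ({1}, g) = 0" "z $ ({2}, g) = 0" "z $ ({1,2}, g) = 0"
  by (auto simp: z_def)

lemma c_nth: "c k $ ({}, g) = 0" "c k $ ({1}, g) = cf k 1 g" "c k $ ({2}, g) = cf k 2 g" "c k $ ({1,2}, g) = 0"
  by (simp_all add: c_def set2_neq)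

lemma d_nth: "d k $ ({}, g) = 0" "d k $ ({1}, g) = - chr k g * cf k 1 g" "d k $ ({2}, g) = - chr k g * cf k 2 g" "d k $ ({1,2}, g) = 0"
  by (simp_all add: d_def c_nth)

lemma u_nz: "u \<noteq> 0" using \<alpha>_u \<alpha>_0 by auto

lemma add_u_eq: "g + u = 0 \<longleftrightarrow> g = u" "g + u = u \<longleftrightarrow> g = 0" "u + g = 0 \<longleftrightarrow> g = u" "u + g = u \<longleftrightarrow> g = 0"
  using add_u_u u_nz by (auto simp: add_eq_0_iff)

lemma cf_u: "cf k l (g + u) = cf k l g" "cf k l (u + g) = cf k l g" "cf k l 0 = 0" "cf k l u = 0"
  "cf 2 1 g = cf 1 2 g"
  by (simp_all add: cf_def Dt_def Q_add_u Q_0)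

lemma chr_u: "chr k (g + u) = - chr k g" "chr k (u + g) = - chr k g" "chr 1 g = \<alpha> g" "chr 2 g = \<beta> g"
  by (simp_all add: chr_def char_u)

lemma cf_rel:
  "Qa g * cf 1 1 g + Qm g * cf 1 2 g = (if g = 0 \<or> g = u then 0 else 1/2)"
  "Qm g * cf 1 1 g + Qb g * cf 1 2 g = 0"
  "Qa g * cf 1 2 g + Qm g * cf 2 2 g = 0"
  "Qm g * cf 1 2 g + Qb g * cf 2 2 g = (if g = 0 \<or> g = u then 0 else 1/2)"
  using regular[of g] by (auto simp: cf_def Dt_def Q_0 field_simps power2_eq_square)

lemma trans_U_nth: "ltrans H U x $ (S, g) = (-1) ^ card S * x $ (S, g + u)" "rtrans H U x $ (S, g) = x $ (S, g + u)"
proof -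
  have "char_set \<alpha> \<beta> S u = (-1) ^ card S"
    using set2_cases[of S] by (auto simp: char_set_simps \<alpha>_u \<beta>_u card_12)
  then show "ltrans H U x $ (S, g) = (-1) ^ card S * x $ (S, g + u)" "rtrans H U x $ (S, g) = x $ (S, g + u)"
    by (simp_all add: ltrans_def rtrans_def U_def[abs_def] ap1_coordinate ap2_coordinate slice1_nth slice2_nth hcomul_nth
      wedge_coeff_2 char_set_simps add.commute)
qed

lemma trans_V_nth: "ltrans H (V k) x $ (S, g) = wedge_coeff {k} S * x $ ({k} \<union> S, g)"
  "rtrans H (V k) x $ (S, g) = wedge_coeff S {k} * chr k g * x $ (S \<union> {k}, g)"
proof -
  have "char_set \<alpha> \<beta> {k} g = chr k g"
    using exhaust_2[of k] by (auto simp: char_set_simps chr_def)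
  then show "ltrans H (V k) x $ (S, g) = wedge_coeff {k} S * x $ ({k} \<union> S, g)"
    "rtrans H (V k) x $ (S, g) = wedge_coeff S {k} * chr k g * x $ (S \<union> {k}, g)"
    by (simp_all add: ltrans_def rtrans_def V_def[abs_def] ap1_coordinate ap2_coordinate slice1_nth slice2_nth hcomul_nth
      char_set_simps)
qed

lemma character_U: "character H U"
proof
  show "U (ltrans H U x) = hcounit H x" for x
    unfolding U_def hcounit_nth trans_U_nth by (simp add: add_u_u)
qed (use hopf_H in \<open>simp_all add: U_def functional_def hmul_nth hone_nth Q_0\<close>)

lemma skew_V: "skew_functional H U (V k)"
proof -
  interpret character H U by (rule character_U)
  show ?thesis
  proof
    show "functional (V k)" by (simp add: functional_def V_def)
    show "V k (x \<star> y) = V k x * eps y + U x * V k y" for x y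
      using exhaust_2[of k] by (auto simp: V_def U_def hcounit_nth hmul_nth Q_0)
  qed
qed

text \<open>
  A central element on which both translations by \<open>u\<close> act by \<open>-1\<close>, and which is invertible where
  \<open>gB - B\<close> is nondegenerate. It forces the uniqueness of \<open>c\<close> and \<open>d\<close>.
\<close>

definition t0 :: "(2 set \<times> 'g) cvec"
  where "t0 = (\<chi> i. if fst i = {1,2} then \<alpha> (snd i) else 0)"

lemma t0_nth: "t0 $ ({}, g) = 0" "t0 $ ({1}, g) = 0" "t0 $ ({2}, g) = 0" "t0 $ ({1,2}, g) = \<alpha> g"
  using set2_neq by (auto simp: t0_def)

text \<open>The top exterior vector alone anticommutes with odd elements. Its coefficient \<alpha>
  changes sign under the shift by \<open>u\<close> and compensates this.\<close>

lemma t0_central: "x \<star> t0 = t0 \<star> x"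
  by (rule cvec_eqI) (simp_all add: hmul_nth t0_nth char_u)

lemma z_mult: "(z \<star> x) $ (S, g) = (if g = 0 \<or> g = u then 0 else x $ (S, g))"
  using set2_cases[of S] by (auto simp: hmul_nth z_nth add_u_eq)

text \<open>At a point where gB - B is nondegenerate, multiplication by \<open>t0\<close> exchanges
  the two even components up to nonzero factors and acts on the odd ones by that matrix, up to
  order, sign and a factor.\<close>

lemma t0_regular:
  assumes "w \<star> t0 = 0" "z \<star> w = w"
  shows "w = 0"
proof -
  have "w $ (S, g) = 0" for S g
  proof (cases "g = 0 \<or> g = u")
    case True
    then show ?thesis using z_mult[of w S g] assms(2) by auto
  next
    case False
    have D: "Qa g * Qb g - (Qm g)\<^sup>2 \<noteq> 0" using regular False by auto
    have "(w \<star> t0) $ ({}, g) = 0" "(w \<star> t0) $ ({1}, g) = 0" "(w \<star> t0) $ ({2}, g) = 0" "(w \<star> t0) $ ({1,2}, g) = 0"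
      using assms(1) by simp_all
    then have *: "w $ ({1,2}, g) = 0" "Qm g * w $ ({1}, g) + Qb g * w $ ({2}, g) = 0"
      "Qa g * w $ ({1}, g) + Qm g * w $ ({2}, g) = 0" "w $ ({}, g) = 0"
      using D by (simp_all add: hmul_nth t0_nth \<alpha>_nz)
    \<comment> \<open>Cramer's rule for the two equations between the odd components.\<close>
    have "(Qa g * Qb g - (Qm g)\<^sup>2) * w $ ({1}, g) =
       Qb g * (Qa g * w $ ({1}, g) + Qm g * w $ ({2}, g)) - Qm g * (Qm g * w $ ({1}, g) + Qb g * w $ ({2}, g))"
      by (simp add: algebra_simps power2_eq_square)
    then have 1: "w $ ({1}, g) = 0" using D * by simp
    have "(Qa g * Qb g - (Qm g)\<^sup>2) * w $ ({2}, g) =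
       Qa g * (Qm g * w $ ({1}, g) + Qb g * w $ ({2}, g)) - Qm g * (Qa g * w $ ({1}, g) + Qm g * w $ ({2}, g))"
      by (simp add: algebra_simps power2_eq_square)
    then have "w $ ({2}, g) = 0" using D * by simp
    then show ?thesis using * 1 set2_cases[of S] by auto
  qed
  then show ?thesis by (simp add: vec_eq_iff split_paired_all)
qed

lemma cf_rel':
  "Qa g * cf k 1 g + Qm g * cf k 2 g = (if k = 1 \<and> g \<noteq> 0 \<and> g \<noteq> u then 1/2 else 0)"
  "Qm g * cf k 1 g + Qb g * cf k 2 g = (if k = 2 \<and> g \<noteq> 0 \<and> g \<noteq> u then 1/2 else 0)"
  using exhaust_2[of k] cf_rel[of g] by (auto simp: cf_u)

text \<open>Under the shift by \<open>u\<close> the coordinates of \<open>c k\<close> are invariant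
  and those of \<open>d l\<close> change sign. The plain commutator therefore behaves like a
  Clifford anticommutator: its degree-two part cancels and its scalar part doubles.\<close>

lemma comm_cd: "(c k \<star> d l - d l \<star> c k) $ ({}, g) = - chr l g * cf k l g"
  "(c k \<star> d l - d l \<star> c k) $ ({1}, g) = 0" "(c k \<star> d l - d l \<star> c k) $ ({2}, g) = 0"
  "(c k \<star> d l - d l \<star> c k) $ ({1,2}, g) = 0"
proof -
  have "(c k \<star> d l - d l \<star> c k) $ ({}, g) = - chr l g * 2 * (cf k 1 g * (Qa g * cf l 1 g + Qm g * cf l 2 g)
      + cf k 2 g * (Qm g * cf l 1 g + Qb g * cf l 2 g))"
    by (simp add: hmul_nth c_nth d_nth cf_u chr_u algebra_simps)
  also have "\<dots> = - chr l g * cf k l g"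
    unfolding cf_rel' using exhaust_2[of l] by (auto simp: cf_u)
  finally show "(c k \<star> d l - d l \<star> c k) $ ({}, g) = - chr l g * cf k l g" .
qed (simp_all add: hmul_nth c_nth d_nth cf_u chr_u algebra_simps)

lemmas inner_simps = trans_U_nth hmul_nth c_nth d_nth cf_u card_12 add_u_u Q_add_u chr_u algebra_simps

lemma inner_l_nth:
  "(c k \<star> x - ltrans H U x \<star> c k) $ ({}, g) =
    2 * (Qa g * cf k 1 g + Qm g * cf k 2 g) * x $ ({1}, g) + 2 * (Qm g * cf k 1 g + Qb g * cf k 2 g) * x $ ({2}, g)"
  "(c k \<star> x - ltrans H U x \<star> c k) $ ({1}, g) = 2 * (Qm g * cf k 1 g + Qb g * cf k 2 g) * x $ ({1,2}, g)"
  "(c k \<star> x - ltrans H U x \<star> c k) $ ({2}, g) = - 2 * (Qa g * cf k 1 g + Qm g * cf k 2 g) * x $ ({1,2}, g)"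
  "(c k \<star> x - ltrans H U x \<star> c k) $ ({1,2}, g) = 0"
  by (simp_all add: inner_simps)

lemma inner_r_nth:
  "(d k \<star> x - rtrans H U x \<star> d k) $ ({}, g) =
    chr k g * (2 * (Qa g * cf k 1 g + Qm g * cf k 2 g) * x $ ({1}, g) + 2 * (Qm g * cf k 1 g + Qb g * cf k 2 g) * x $ ({2}, g))"
  "(d k \<star> x - rtrans H U x \<star> d k) $ ({1}, g) = - chr k g * (2 * (Qm g * cf k 1 g + Qb g * cf k 2 g) * x $ ({1,2}, g))"
  "(d k \<star> x - rtrans H U x \<star> d k) $ ({2}, g) = chr k g * (2 * (Qa g * cf k 1 g + Qm g * cf k 2 g) * x $ ({1,2}, g))"
  "(d k \<star> x - rtrans H U x \<star> d k) $ ({1,2}, g) = 0"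
  by (simp_all add: inner_simps)

lemma inner_l: "z \<star> ltrans H (V k) x = c k \<star> x - ltrans H U x \<star> c k"
  and inner_r: "z \<star> rtrans H (V k) x = d k \<star> x - rtrans H U x \<star> d k"
  using exhaust_2[of k]
  by (elim disjE; intro cvec_eqI; simp only: inner_l_nth inner_r_nth cf_rel' z_mult trans_V_nth; simp add: wedge_coeff_2 set_21)+

lemma skew_data: "skew_data H U V z c d"
proof -
  interpret character H U by (rule character_U)
  show ?thesis
  proof (intro skew_data.intro skew_data_axioms.intro)
    show "character H U" by (rule character_U)
    show "skew_functional H U (V k)" for k by (rule skew_V)
    show "ltrans H U (ltrans H U x) = x" "rtrans H U (rtrans H U x) = x"
      "rtrans H U (ltrans H U x) = ltrans H U (rtrans H U x)" for x
      by (simp_all add: vec_eq_iff split_paired_all trans_U_nth add_u_u flip: power_add mult_2 mult.assoc)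
    show "z \<star> z = z" by (rule cvec_eqI) (simp_all add: z_mult z_nth)
    show "x \<star> z = z \<star> x" for x by (rule cvec_eqI) (simp_all add: hmul_nth z_nth add_u_eq)
    show "ltrans H U z = z" "rtrans H U z = z"
      by (rule cvec_eqI; simp add: trans_U_nth z_nth add_u_eq)+
    show "z \<star> c k = c k" "z \<star> d k = d k" for k
      by (rule cvec_eqI; simp add: z_mult c_nth d_nth cf_u; auto simp: cf_u)+
    show "rtrans H U (c k) = c k" "ltrans H U (d k) = d k" for k
      by (rule cvec_eqI; simp add: trans_U_nth c_nth d_nth cf_u chr_u)+
    show "w = 0" if "\<And>y. w \<star> y = ltrans H U y \<star> w" "z \<star> w = w" for w
    proof (rule t0_regular)
      have "ltrans H U t0 = - t0" by (rule cvec_eqI) (simp_all add: trans_U_nth t0_nth char_u)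
      then have "w \<star> t0 = - (w \<star> t0)" using that(1)[of t0] t0_central[of w] by (simp add: mult_simps)
      then show "w \<star> t0 = 0" by (simp add: vec_eq_iff eq_neg_iff_add_eq_0)
    qed (rule that(2))
    show "w = 0" if "\<And>y. w \<star> y = rtrans H U y \<star> w" "z \<star> w = w" for w
    proof (rule t0_regular)
      have "rtrans H U t0 = - t0" by (rule cvec_eqI) (simp_all add: trans_U_nth t0_nth char_u)
      then have "w \<star> t0 = - (w \<star> t0)" using that(1)[of t0] t0_central[of w] by (simp add: mult_simps)
      then show "w \<star> t0 = 0" by (simp add: vec_eq_iff eq_neg_iff_add_eq_0)
    qed (rule that(2))
    show "ltrans H U (rtrans H U (c k \<star> d l - d l \<star> c k)) = c k \<star> d l - d l \<star> c k" for k l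
      by (rule cvec_eqI) (simp_all only: trans_U_nth comm_cd, simp_all add: cf_u chr_u)
    show "z \<star> ltrans H (V k) x = c k \<star> x - ltrans H U x \<star> c k" for k x by (rule inner_l)
    show "z \<star> rtrans H (V k) x = d k \<star> x - rtrans H U x \<star> d k" for k x by (rule inner_r)
  qed
qed

end

section \<open>Characters, skew-primitive functionals and central idempotents of the dual\<close>

context char_regular
begin

lemma basis_mult_nth:
  "(basis ({}, g) \<star> x) $ (S, k) = (if (if odd (card S) then k + u else k) = g then x $ (S, k) else 0)"
  "(x \<star> basis ({}, g)) $ (S, k) = (if k = g then x $ (S, k) else 0)"
  using set2_cases[of S] by (auto simp: hmul_nth basis_nth card_12)

lemma basis_mult:
  "basis ({}, g) \<star> basis (S, h) = (if g = (if odd (card S) then h + u else h) then basis (S, h) else 0)"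
  "basis (S, h) \<star> basis ({}, g) = (if g = h then basis (S, h) else 0)"
  by (auto simp: vec_eq_iff split_paired_all basis_mult_nth basis_nth)

lemma odd_mult:
  "basis ({1}, h + u) \<star> basis ({1}, h) = Qa h *s basis ({}, h)"
  "basis ({2}, h + u) \<star> basis ({2}, h) = Qb h *s basis ({}, h)"
  "basis ({1}, h + u) \<star> basis ({2}, h) = Qm h *s basis ({}, h) - basis ({1,2}, h)"
  "basis ({2}, h + u) \<star> basis ({1}, h) = Qm h *s basis ({}, h) + basis ({1,2}, h)"
  by (rule cvec_eqI; simp add: hmul_nth basis_nth set2_neq)+

lemma one_expand: "hone H = (\<Sum>g\<in>UNIV. basis ({}, g))"
  by (simp add: vec_eq_iff split_paired_all hone_nth basis_nth if_distrib cong: if_cong)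

lemma functional_sum: "functional a \<Longrightarrow> a (sum g A) = (\<Sum>i\<in>A. a (g i))"
  by (induction A rule: infinite_finite_induct) (simp_all add: functionalD)

lemma u_neq: "h + u \<noteq> h"
  using u_nz by simp

text \<open>A character is concentrated at one group element and kills odd vectors, hence their
  products. The Clifford relations then force gB - B to vanish there, and regularity leaves only 0
  and \<open>u\<close>.\<close>

lemma character_cases:
  assumes f: "functional \<psi>" and m: "\<And>x y. \<psi> (x \<star> y) = \<psi> x * \<psi> y" and o: "\<psi> (hone H) = 1"
  shows "\<psi> = hcounit H \<or> \<psi> = U"
proof -
  have "(\<Sum>g\<in>UNIV. \<psi> (basis ({}, g))) = 1"
    using o f by (simp add: one_expand functional_sum)
  then obtain g where g: "\<psi> (basis ({}, g)) \<noteq> 0" by (metis sum.neutral zero_neq_one)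
  have "\<psi> (basis ({}, g)) * \<psi> (basis ({}, g)) = \<psi> (basis ({}, g))"
    unfolding m[symmetric] by (simp add: basis_mult)
  then have "\<psi> (basis ({}, g)) = 1" using g by simp
  moreover have "\<psi> (basis ({}, g)) * \<psi> (basis ({}, h)) = 0" if "h \<noteq> g" for h
    unfolding m[symmetric] using that by (simp add: basis_mult functionalD[OF f])
  ultimately have g': "\<psi> (basis ({}, h)) = (if h = g then 1 else 0)" for h by auto
  \<comment> \<open>An odd basis vector is fixed by different indicator functions on the left and on
    the right, and the character is nonzero on at most one of them.\<close>
  have i: "\<psi> (basis ({i}, h)) = 0" for i h
    using m[of "basis ({}, h + u)" "basis ({i}, h)"] m[of "basis ({i}, h)" "basis ({}, h)"] u_neq[of h]
    by (auto simp: basis_mult g' split: if_splits)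
  have t: "\<psi> (basis ({1,2}, h)) = 0" for h
    using m[of "basis ({1}, h + u)" "basis ({2}, h)"] m[of "basis ({2}, h + u)" "basis ({1}, h)"]
    by (simp add: odd_mult i functionalD[OF f])
  have "Qa g = 0" "Qb g = 0" "Qm g = 0"
    using m[of "basis ({1}, g + u)" "basis ({1}, g)"] m[of "basis ({2}, g + u)" "basis ({2}, g)"]
      m[of "basis ({1}, g + u)" "basis ({2}, g)"]
    by (simp_all add: odd_mult i t g' functionalD[OF f])
  then have "g = 0 \<or> g = u" using regular[of g] by auto
  moreover have "\<psi> x = x $ ({}, g)" for x
  proof (rule functional_pair_eqI[where G="\<lambda>x. x $ ({}, g)"])
    show "\<psi> (basis (S, h)) = basis (S, h) $ ({}, g)" for S h
      using set2_cases[of S] by (auto simp: basis_nth g' i t)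
  qed (simp_all add: functionalD[OF f])
  ultimately show ?thesis by (auto simp: U_def hcounit_nth)
qed

text \<open>Indicator functions are idempotent, so the product rule kills them away from 0 and
  \<open>u\<close>; the values at 0 and \<open>u\<close> are opposite, which accounts for the
  trivial part. Odd vectors survive only at 0, where they give the functionals
  \<open>V j\<close>.\<close>

lemma skew_cases:
  assumes f: "functional D" and m: "\<And>x y. D (x \<star> y) = D x * hcounit H y + U x * D y"
  shows "\<exists>T t. \<forall>x. D x = (\<Sum>j\<in>UNIV. T j * V j x) + t * (hcounit H x - U x)"
proof -
  have c: "hcounit H (basis (S, g)) = (if S = {} \<and> g = 0 then 1 else 0)" "U (basis (S, g)) = (if S = {} \<and> g = u then 1 else 0)" for S g
    by (auto simp: hcounit_nth U_def basis_nth)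
  have 1: "D (basis ({}, g)) = 0" if "g \<noteq> 0" "g \<noteq> u" for g
    using m[of "basis ({}, g)" "basis ({}, g)"] that by (simp add: basis_mult c)
  have "hone H \<star> hone H = hone H" by (simp add: hmul_one)
  then have "D (hone H) = 0"
    using m[of "hone H" "hone H"] by (simp add: hcounit_nth U_def hone_nth)
  then have "(\<Sum>g\<in>UNIV. D (basis ({}, g))) = 0"
    using f by (simp add: one_expand functional_sum)
  moreover have "(\<Sum>g\<in>UNIV. D (basis ({}, g))) = (\<Sum>g\<in>{0, u}. D (basis ({}, g)))"
    by (rule sum.mono_neutral_right) (auto simp: 1)
  ultimately have 2: "D (basis ({}, u)) = - D (basis ({}, 0))"
    using u_nz by (simp add: eq_neg_iff_add_eq_0 add.commute)
  have 3: "D (basis ({i}, h)) = 0" if "h \<noteq> 0" for i h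
    using m[of "basis ({}, h + u)" "basis ({i}, h)"] that by (simp add: basis_mult c)
  \<comment> \<open>\<open>D\<close> may be nonzero on the indicator functions of 0 and
    \<open>u\<close>, but \<open>Qm\<close> vanishes at these points.\<close>
  have Q: "Qm h * D (basis ({}, h)) = 0" for h
    using 1[of h] Q_0 by (cases "h = 0 \<or> h = u") auto
  have 4: "D (basis ({1,2}, h)) = 0" for h
    using m[of "basis ({2}, h + u)" "basis ({1}, h)"] Q[of h] by (auto simp add: odd_mult c functionalD[OF f])
  have "D x = (\<Sum>j\<in>UNIV. D (basis ({j}, 0)) * V j x) + D (basis ({}, 0)) * (hcounit H x - U x)" for x
  proof (rule functional_pair_eqI[where F=D])
    show "D (basis (S, h)) = (\<Sum>j\<in>UNIV. D (basis ({j}, 0)) * V j (basis (S, h))) +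
        D (basis ({}, 0)) * (hcounit H (basis (S, h)) - U (basis (S, h)))" for S h
      using set2_cases[of S] u_nz 1[of h] 2 3[of h] 4[of h]
      by (elim disjE; cases "h = 0"; cases "h = u"; simp add: c V_def basis_nth sum_2 set2_neq)
  qed (simp_all add: functionalD[OF f] V_def U_def hcounit_nth sum.distrib sum_distrib_left algebra_simps)
  then show ?thesis
    by (intro exI[of _ "\<lambda>j. D (basis ({j}, 0))"] exI[of _ "D (basis ({}, 0))"] allI)
qed

text \<open>Since \<open>z\<close> is itself such an idempotent, this makes it the largest one, a
  description that every isomorphism of the algebras with counit preserves.\<close>

lemma central_idempotent:
  assumes i: "y \<star> y = y" and c: "\<And>x. y \<star> x = x \<star> y" and e: "hcounit H y = 0"
  shows "z \<star> y = y"
proof -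
  have 0: "y $ ({}, 0) = 0" using e by (simp add: hcounit_nth)
  have n: "(y \<star> y) $ (S, g) = y $ (S, g)" for S g by (simp add: i)
  have "y $ ({}, u) * y $ ({}, u) = y $ ({}, u)"
    using n[of "{}" u] by (simp add: hmul_nth Q_0)
  \<comment> \<open>The odd basis vector at 0 has left support \<open>u\<close> and right support 0,
    so a central element takes equal values at these two points.\<close>
  moreover have "y $ ({}, u) \<noteq> 1"
  proof
    assume "y $ ({}, u) = 1"
    then show False
      using arg_cong[OF c[of "basis ({1}, 0)"], of "\<lambda>x. x $ ({1}, 0)"] 0
      by (simp add: hmul_nth Q_0 basis_nth)
  qed
  ultimately have u: "y $ ({}, u) = 0" by simp
  have k: "y $ ({1}, 0) = 0" "y $ ({2}, 0) = 0" "y $ ({1}, u) = 0" "y $ ({2}, u) = 0"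
    using n[of "{1}" 0] n[of "{2}" 0] n[of "{1}" u] n[of "{2}" u] 0 u by (simp_all add: hmul_nth Q_0 u_u)
  have t: "y $ ({1,2}, 0) = 0" "y $ ({1,2}, u) = 0"
    using n[of "{1,2}" 0] n[of "{1,2}" u] 0 u k by (simp_all add: hmul_nth Q_0 u_u)
  show ?thesis
    by (rule cvec_eqI) (auto simp: z_mult 0 u k t)
qed

section \<open>The discriminant of the commutator form\<close>

lemma fn_mult:
  assumes "\<And>S g. S \<noteq> {} \<Longrightarrow> x $ (S, g) = 0"
  shows "(x \<star> y) $ ({}, g) = x $ ({}, g) * y $ ({}, g)"
    "(\<And>S g. S \<noteq> {} \<Longrightarrow> y $ (S, g) = 0) \<Longrightarrow> S \<noteq> {} \<Longrightarrow> (x \<star> y) $ (S, g) = 0"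
  using assms set2_cases[of S] by (auto simp: hmul_nth)

text \<open>Four times the determinant of the symmetric part of the form at \<open>g\<close>; the
  signs in \<open>ecomm_nth\<close> cancel.\<close>

definition disc :: "'g \<Rightarrow> complex"
  where "disc g = 4 * (\<alpha> g * cf 1 1 g) * (\<beta> g * cf 2 2 g) - (\<beta> g * cf 1 2 g + \<alpha> g * cf 1 2 g)\<^sup>2"

definition disc_vec :: "(2 set \<times> 'g) cvec"
  where "disc_vec = (\<chi> i. if fst i = {} then disc (snd i) else 0)"

text \<open>The square is expanded into products of two entries so that \<open>e_mult_e\<close>
  applies to each term with the same scalar.\<close>

definition disc_form :: "(2 \<Rightarrow> 2 \<Rightarrow> (2 set \<times> 'g) cvec) \<Rightarrow> (2 set \<times> 'g) cvec"
  where "disc_form e = 4 *s (e 1 1 \<star> e 2 2) - (e 1 2 \<star> e 1 2 + e 1 2 \<star> e 2 1 + e 2 1 \<star> e 1 2 + e 2 1 \<star> e 2 1)"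

definition ecomm :: "2 \<Rightarrow> 2 \<Rightarrow> (2 set \<times> 'g) cvec"
  where "ecomm k l = c k \<star> d l - d l \<star> c k"

lemma ecomm_nth: "ecomm k l $ ({}, g) = - chr l g * cf k l g" "S \<noteq> {} \<Longrightarrow> ecomm k l $ (S, g) = 0"
  using set2_cases[of S] comm_cd[of k l g] by (auto simp: ecomm_def)

lemma disc_form_nth:
  assumes "\<And>k l S g. S \<noteq> {} \<Longrightarrow> e k l $ (S, g) = 0"
  shows "disc_form e $ ({}, g) = 4 * e 1 1 $ ({}, g) * e 2 2 $ ({}, g) - (e 1 2 $ ({}, g) + e 2 1 $ ({}, g))\<^sup>2"
    "S \<noteq> {} \<Longrightarrow> disc_form e $ (S, g) = 0"
  by (simp_all add: disc_form_def fn_mult assms power2_eq_square algebra_simps)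

lemma disc_form_ecomm: "disc_form ecomm = disc_vec"
proof -
  have "disc_form ecomm $ (S, g) = disc_vec $ (S, g)" for S g
    by (cases "S = {}")
      (simp_all add: disc_form_nth ecomm_nth disc_vec_def disc_def chr_u cf_u power2_eq_square algebra_simps)
  then show ?thesis by (simp add: vec_eq_iff split_paired_all)
qed

text \<open>\<open>T\<close> acts on the form, and so on its symmetric part, by congruence; the
  determinant is multiplied by the square of that of \<open>T\<close>.\<close>

lemma disc_form_combination:
  assumes E: "\<And>k l. E k l = (\<Sum>i\<in>UNIV. \<Sum>j\<in>UNIV. (T k i * T l j) *s ecomm i j)"
  shows "disc_form E = (T 1 1 * T 2 2 - T 1 2 * T 2 1)\<^sup>2 *s disc_vec"
proof -
  have 0: "S \<noteq> {} \<Longrightarrow> E k l $ (S, g) = 0" for k l S g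
    by (simp add: E ecomm_nth)
  have 1: "E k l $ ({}, g) = T k 1 * T l 1 * ecomm 1 1 $ ({}, g) + T k 1 * T l 2 * ecomm 1 2 $ ({}, g)
     + T k 2 * T l 1 * ecomm 2 1 $ ({}, g) + T k 2 * T l 2 * ecomm 2 2 $ ({}, g)" for k l g
    by (simp add: E sum_2)
  have "disc_form E $ (S, g) = ((T 1 1 * T 2 2 - T 1 2 * T 2 1)\<^sup>2 *s disc_form ecomm) $ (S, g)" for S g
    by (cases "S = {}") (simp_all add: disc_form_nth 0 1 ecomm_nth(2) power2_eq_square algebra_simps)
  then show ?thesis unfolding disc_form_ecomm by (simp add: vec_eq_iff split_paired_all)
qed

end

text \<open>\<open>f\<close> relates the two discriminant elements up to a scalar. Values at points
  are compared by invertibility on the part cut out by \<open>z\<close>, which makes sense although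
  \<open>f\<close> need not carry functions on the group to functions.\<close>

lemma twist_equivalent_disc:
  fixes \<alpha> \<beta> :: "'g::{finite,ab_group_add} \<Rightarrow> complex"
  assumes A: "char_regular \<alpha> \<beta> u p q r" and B: "char_regular \<alpha> \<beta> u p' q' r'"
    and te: "twist_equivalent (char_quad.H \<alpha> \<beta> u p q r) (char_quad.H \<alpha> \<beta> u p' q' r')"
  shows "\<exists>a. \<forall>g. g \<noteq> 0 \<longrightarrow> g \<noteq> u \<longrightarrow> (\<exists>h. h \<noteq> 0 \<and> h \<noteq> u \<and>
    char_regular.disc \<alpha> \<beta> p q r g = a * char_regular.disc \<alpha> \<beta> p' q' r' h)"
proof -
  interpret A: char_regular \<alpha> \<beta> u p q r by (rule A)
  interpret B: char_regular \<alpha> \<beta> u p' q' r' by (rule B)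
  interpret AS: skew_data A.H A.U A.V A.z A.c A.d by (rule A.skew_data)
  interpret BS: skew_data B.H B.U B.V B.z B.c B.d by (rule B.skew_data)
  obtain F where tw: "is_twist A.H F" and iso: "hopf_iso B.H (twisted A.H F)"
    using te by (auto simp: twist_equivalent_def)
  obtain G where G: "is_inverse (hmul2 A.H) (hone2 A.H) F G"
    using tw by (auto simp: is_twist_def)
  have T: "twisted A.H F = A.H\<lparr>hcomul := (\<lambda>x. hmul2 A.H (hmul2 A.H G (hcomul A.H x)) F)\<rparr>"
    by (simp add: twisted_def AS.inverse_in_eq[OF G])
  obtain f where f: "Vector_Spaces.linear (*s) (*s) f" "bij f"
      "\<And>x y. f (hmul B.H x y) = hmul A.H (f x) (f y)" "f (hone B.H) = hone A.H"
      "\<And>x. ten_map f f (hcomul B.H x) = hmul2 A.H (hmul2 A.H G (hcomul A.H (f x))) F"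
      "\<And>x. hcounit A.H (f x) = hcounit B.H x"
    using iso unfolding hopf_iso_def T by auto
  have fs: "f (x + y) = f x + f y" "f (k *s x) = k *s f x" for x y k
    using f(1) by (simp_all add: linear_s_iff)
  have fd: "f (x - y) = f x - f y" for x y
    using fs(1)[of "x - y" y] by (simp add: algebra_simps)
  have "functional (\<lambda>x. A.U (f x))" "\<And>k. functional (\<lambda>x. A.V k (f x))"
    using AS.U_functional A.skew_V by (auto simp: functional_def fs skew_functional_def skew_functional_axioms_def)
  note func = this
  have Vm: "A.V k (hmul A.H x y) = A.V k x * hcounit A.H y + A.U x * A.V k y" for k x y
    using A.skew_V[of k] by (simp add: skew_functional_def skew_functional_axioms_def)
  have "(\<lambda>x. A.U (f x)) = hcounit B.H \<or> (\<lambda>x. A.U (f x)) = B.U"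
    by (rule B.character_cases) (use func in \<open>simp_all add: f AS.U_mult AS.U_one\<close>)
  moreover have "(\<lambda>x. A.U (f x)) \<noteq> hcounit B.H"
  proof
    assume *: "(\<lambda>x. A.U (f x)) = hcounit B.H"
    have "A.U y = hcounit A.H y" for y
    proof -
      obtain x where "y = f x" using f(2) by (metis bij_pointE)
      then show ?thesis using fun_cong[OF *, of x] f(6) by simp
    qed
    from this[of "basis ({}, 0)"] show False
      using A.u_nz by (simp add: A.U_def A.hcounit_nth basis_nth)
  qed
  ultimately have fU: "A.U (f x) = B.U x" for x by metis
  have "\<exists>T t. \<forall>x. A.V k (f x) = (\<Sum>j\<in>UNIV. T j * B.V j x) + t * (hcounit B.H x - B.U x)" for k
    by (rule B.skew_cases) (use func in \<open>simp_all add: f Vm fU\<close>)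
  then obtain T t where fV: "\<And>k x. A.V k (f x) = (\<Sum>j\<in>UNIV. T k j * B.V j x) + t k * (hcounit B.H x - B.U x)"
    by metis
  have eps_z: "hcounit A.H A.z = 0" "hcounit B.H B.z = 0"
    by (simp_all add: A.hcounit_nth B.hcounit_nth A.z_nth B.z_nth)
  have fz: "f B.z = A.z"
  proof -
    have 1: "hmul A.H A.z (f B.z) = f B.z"
    proof (rule A.central_idempotent)
      show "hmul A.H (f B.z) (f B.z) = f B.z" by (simp add: f(3)[symmetric] BS.z_idem)
      show "hmul A.H (f B.z) x = hmul A.H x (f B.z)" for x
      proof -
        obtain y where "x = f y" using f(2) by (metis bij_pointE)
        then show ?thesis by (simp add: f(3)[symmetric] BS.z_central[of y])
      qed
      show "hcounit A.H (f B.z) = 0" by (simp add: f(6) eps_z)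
    qed
    obtain w where w: "f w = A.z" using f(2) by (metis bij_pointE)
    have inj: "f x = f y \<Longrightarrow> x = y" for x y using f(2) by (simp add: bij_def inj_eq)
    have "hmul B.H B.z w = w"
    proof (rule B.central_idempotent)
      show "hmul B.H w w = w" by (rule inj) (simp add: f(3) w AS.z_idem)
      show "hmul B.H w x = hmul B.H x w" for x by (rule inj) (simp add: f(3) w AS.z_central)
      show "hcounit B.H w = 0" using f(6)[of w] by (simp add: w eps_z)
    qed
    then have "hmul A.H (f B.z) A.z = A.z" using f(3)[of B.z w] by (simp add: w)
    then show ?thesis using 1 AS.z_central[of "f B.z"] by simp
  qed
  interpret S: skew_twist_iso A.H B.H A.U B.U A.V B.V A.z B.z A.c B.c A.d B.d F G f T t
  proof (intro skew_twist_iso.intro skew_twist.intro twist_character.intro skew_twist_iso_axioms.intro twist_character_axioms.intro)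
    show "ten_mul (hmul2 A.H) (hmul A.H) (ten_map (hcomul A.H) id F) (F \<otimes> hone A.H) =
      ten_mul (hmul2 A.H) (hmul A.H) (ten_assoc (ten_map id (hcomul A.H) F)) (ten_assoc (hone A.H \<otimes> F))"
      using tw by (simp add: is_twist_def)
  qed (use G f fU fV fz in \<open>simp_all add: is_inverse_def A.skew_data B.skew_data A.character_U bij_is_surj\<close>)
  obtain a where a: "\<And>i j k l. hmul A.H (AS.e i j) (AS.e k l) = a *s f (hmul B.H (S.EK i j) (S.EK k l))"
    using S.e_mult_e by blast
  have eA: "AS.e = A.ecomm" and eB: "BS.e = B.ecomm"
    by (intro ext; simp add: AS.e_def BS.e_def A.ecomm_def B.ecomm_def)+
  let ?D = "(T 1 1 * T 2 2 - T 1 2 * T 2 1)\<^sup>2"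
  have "A.disc_form A.ecomm = a *s f (B.disc_form S.EK)"
    unfolding A.disc_form_def B.disc_form_def eA[symmetric] a
    by (simp add: fs fd vec.scale_right_distrib vec.scale_right_diff_distrib mult.commute)
  moreover have "B.disc_form S.EK = ?D *s B.disc_vec"
    by (rule B.disc_form_combination) (simp only: S.EK_sum eB)
  ultimately have d: "A.disc_vec = (a * ?D) *s f B.disc_vec"
    by (simp add: A.disc_form_ecomm fs)
  show ?thesis
  proof (rule exI[of _ "a * ?D"], intro allI impI)
    fix g assume g: "g \<noteq> 0" "g \<noteq> u"
    let ?C = "a * ?D"
    show "\<exists>h. h \<noteq> 0 \<and> h \<noteq> u \<and> A.disc g = ?C * B.disc h"
    proof (cases "?C = 0")
      \<comment> \<open>A zero scalar forces the discriminant on the left to vanish everywhere, so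
        \<open>g\<close> itself is a witness.\<close>
      case True
      then have "A.disc_vec $ ({}, g) = 0" by (simp add: d)
      then show ?thesis using g True by (auto simp: A.disc_vec_def)
    next
      case False
      define x where "x = A.disc g / ?C"
      have "\<exists>h. h \<noteq> 0 \<and> h \<noteq> u \<and> B.disc h = x"
      proof (rule ccontr)
        assume n: "\<nexists>h. h \<noteq> 0 \<and> h \<noteq> u \<and> B.disc h = x"
        \<comment> \<open>If \<open>x\<close> were not a value, \<open>k\<close> would be an inverse
          of the discriminant minus \<open>x\<close> relative to \<open>z\<close>. Its image under
          \<open>f\<close> would then invert an element that vanishes at \<open>g\<close>.\<close>
        define k :: "(2 set \<times> 'g) cvec" where "k = (\<chi> i. if fst i = {} \<and> snd i \<noteq> 0 \<and> snd i \<noteq> u then 1 / (B.disc (snd i) - x) else 0)"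
        have kn: "k $ ({}, h) = (if h \<noteq> 0 \<and> h \<noteq> u then 1 / (B.disc h - x) else 0)" "S \<noteq> {} \<Longrightarrow> k $ (S, h) = 0" for S h
          by (simp_all add: k_def)
        define w where "w = B.disc_vec - x *s B.z"
        have dn: "w $ ({}, h) = B.disc h - (if h = 0 \<or> h = u then 0 else x)"
          "S \<noteq> {} \<Longrightarrow> w $ (S, h) = 0" for S h
          by (simp_all add: w_def B.disc_vec_def B.z_def)
        have zn: "S \<noteq> {} \<Longrightarrow> B.z $ (S, h) = 0" for S h
          by (simp add: B.z_def)
        have "hmul B.H w k $ (S, h) = B.z $ (S, h)" for S h
          using n by (cases "S = {}") (auto simp: B.fn_mult dn kn B.z_nth(1) zn)
        then have "hmul B.H (B.disc_vec - x *s B.z) k = B.z"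
          by (simp add: vec_eq_iff split_paired_all w_def)
        then have "hmul A.H (f B.disc_vec - x *s A.z) (f k) = A.z"
          by (metis f(3) fs(2) fd fz)
        moreover have "f B.disc_vec = (1 / ?C) *s A.disc_vec"
          using False by (simp add: d)
        ultimately have "hmul A.H ((1 / ?C) *s A.disc_vec - x *s A.z) (f k) $ ({}, g) = A.z $ ({}, g)" by simp
        moreover have "hmul A.H ((1 / ?C) *s A.disc_vec - x *s A.z) (f k) $ ({}, g) = 0"
          by (subst A.fn_mult(1)) (use g in \<open>simp_all add: A.disc_vec_def A.z_def x_def\<close>)
        ultimately show False using g by (simp add: A.z_nth)
      qed
      then show ?thesis using False by (auto simp: x_def field_simps)
    qed
  qed
qed

subsection \<open>The three families\<close>

lemma (in hopf) twist_equivalent_refl: "twist_equivalent H H"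
proof -
  let ?o = "hone2 H"
  have i: "is_inverse (hmul2 H) ?o ?o ?o"
    by (simp add: is_inverse_def mult2_one)
  have 1: "ten_map (hcomul H) id ?o = ?o \<otimes> \<one>"
    by (simp add: vec_eq_iff split_paired_all ten_map_id_nth[OF comul_linear] slice2_ten linear_s_D[OF comul_linear]
        comul_one ten_nth)
  have 2: "ten_assoc (ten_map id (hcomul H) ?o) = ?o \<otimes> \<one>"
    by (simp add: vec_eq_iff split_paired_all ten_map_id_nth[OF comul_linear] slice1_ten linear_s_D[OF comul_linear]
        comul_one ten_nth ten_assoc_nth)
  have "is_twist H ?o"
    using i unfolding is_twist_def 1 2 ten_assoc_ten by blast
  moreover have "twisted H ?o = H"
    by (simp add: twisted_def inverse_in_eq[OF i] mult2_one)
  moreover have "hopf_iso H H"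
  proof -
    have "ten_map id id X = X" for X :: "('i \<times> 'i) cvec"
      by (rule linear_pair_eqI[where f="ten_map id id"]) (simp_all add: ten_map_simps ten_map_basis ten_basis)
    then show ?thesis
      unfolding hopf_iso_def by (intro exI[of _ id]) (simp add: linear_s_iff)
  qed
  ultimately show ?thesis
    using hopf by (auto simp: twist_equivalent_def)
qed

text \<open>Each \<open>K n\<close> lies in its own class by reflexivity, so equal classes of
  \<open>K m\<close> and \<open>K n\<close> give a twist equivalence between them.\<close>

lemma infinite_twist_classes:
  fixes K :: "nat \<Rightarrow> 'i::finite hopf_ops"
  assumes "range K \<subseteq> A" "\<And>n. hopf_algebra (K n)" "\<And>m n. twist_equivalent (K m) (K n) \<Longrightarrow> m = n"
  shows "infinite (A // twist_rel)"
proof -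
  have "inj (\<lambda>n. twist_rel `` {K n})"
  proof (rule injI)
    fix m n assume e: "twist_rel `` {K m} = twist_rel `` {K n}"
    have "K n \<in> twist_rel `` {K n}"
      using hopf.twist_equivalent_refl[OF hopf.intro[OF assms(2)]] by (simp add: twist_rel_def)
    then have "K n \<in> twist_rel `` {K m}" by (simp only: e)
    then show "m = n"
      using assms(3) by (simp add: twist_rel_def)
  qed
  then have "infinite (range (\<lambda>n. twist_rel `` {K n}))"
    by (rule range_inj_infinite)
  moreover have "range (\<lambda>n. twist_rel `` {K n}) \<subseteq> A // twist_rel"
    using assms(1) by (auto simp: quotient_def)
  ultimately show ?thesis by (rule infinite_super[rotated])
qed

text \<open>The inverse matrix is cleared, which shows dependence on \<open>g\<close> only through
  the squares and the product of the characters. Where the determinant is zero both sides are 0 by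
  division by zero.\<close>

lemma (in char_regular) disc_eq:
  "disc g = (4 * (\<alpha> g * \<beta> g) * (Qa g * Qb g) - ((\<alpha> g)\<^sup>2 + (\<beta> g)\<^sup>2 + 2 * (\<alpha> g * \<beta> g)) * (Qm g)\<^sup>2)
    / (4 * (Qa g * Qb g - (Qm g)\<^sup>2)\<^sup>2)"
  unfolding disc_def cf_def Dt_def[symmetric]
  by (cases "Dt g = 0") (simp_all add: field_simps power2_eq_square)

text \<open>Rescaling the two basis vectors normalises nonzero entries \<open>q\<close>,
  \<open>r\<close> of \<open>B\<close> to 1 and leaves one parameter \<open>s\<close>. The unknown
  scalar cancels in the ratio of the two nonzero values. Matching the values crosswise would give
  \<open>\<rho> m * \<rho> n = 1\<close>, which the bound on absolute values excludes.\<close>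

lemma infinite_family:
  fixes \<alpha> \<beta> :: "'g::{finite,ab_group_add} \<Rightarrow> complex" and s x y :: "nat \<Rightarrow> complex" and \<rho> :: "nat \<Rightarrow> real"
  assumes R: "\<And>n. char_regular \<alpha> \<beta> u (s n) 1 1"
    and v: "\<And>n g. g \<noteq> 0 \<Longrightarrow> g \<noteq> u \<Longrightarrow> char_regular.disc \<alpha> \<beta> (s n) 1 1 g \<in> {x n, y n, 0}"
    and g: "g \<noteq> 0" "g \<noteq> u" "\<And>n. char_regular.disc \<alpha> \<beta> (s n) 1 1 g = x n"
    and h: "h \<noteq> 0" "h \<noteq> u" "\<And>n. char_regular.disc \<alpha> \<beta> (s n) 1 1 h = y n"
    and y: "\<And>n. y n \<noteq> 0" "\<And>n. x n = of_real (\<rho> n) * y n" and \<rho>: "\<And>n. \<bar>\<rho> n\<bar> > 1" "inj \<rho>"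
  shows "infinite ({hopf_dual (A_hopf (char_sum \<alpha> \<beta>) u B) |B. B \<in> sym2} // twist_rel)"
proof (rule infinite_twist_classes[where K="\<lambda>n. char_quad.H \<alpha> \<beta> u (s n) 1 1"])
  have q: "char_quad \<alpha> \<beta> u" using R[of 0] by (simp add: char_regular_def)
  have d: "char_data \<alpha> \<beta> u" using q by (simp add: char_quad_def)
  show "hopf_algebra (char_quad.H \<alpha> \<beta> u (s n) 1 1)" for n
    by (rule char_quad.hopf_H[OF q])
  show "range (\<lambda>n. char_quad.H \<alpha> \<beta> u (s n) 1 1) \<subseteq> {hopf_dual (A_hopf (char_sum \<alpha> \<beta>) u B) |B. B \<in> sym2}"
    by (auto simp: char_quad.H_def[OF q] sym2_def char_data.bvec_def[OF d] intro!: exI[of _ "char_data.bvec _ 1 1"])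
  fix m n assume "twist_equivalent (char_quad.H \<alpha> \<beta> u (s m) 1 1) (char_quad.H \<alpha> \<beta> u (s n) 1 1)"
  then obtain a where a: "\<And>g. g \<noteq> 0 \<Longrightarrow> g \<noteq> u \<Longrightarrow> \<exists>h. h \<noteq> 0 \<and> h \<noteq> u \<and>
      char_regular.disc \<alpha> \<beta> (s m) 1 1 g = a * char_regular.disc \<alpha> \<beta> (s n) 1 1 h"
    using twist_equivalent_disc[OF R R] by blast
  obtain X where X: "x m = a * X" "X \<in> {x n, y n, 0}" using a[OF g(1,2)] g(3) v by metis
  obtain Y where Y: "y m = a * Y" "Y \<in> {x n, y n, 0}" using a[OF h(1,2)] h(3) v by metis
  have nz: "a \<noteq> 0" "Y \<noteq> 0" using y(1)[of m] Y by auto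
  have XY: "X = of_real (\<rho> m) * Y" using X(1) Y(1) y(2)[of m] nz by simp
  have r: "\<rho> m \<noteq> 0" "\<rho> n \<noteq> 0" "\<bar>\<rho> m\<bar> > 1" "\<bar>\<rho> n\<bar> > 1" using \<rho>(1)[of m] \<rho>(1)[of n] by auto
  have "X \<noteq> 0" using XY nz r by simp
  then have "(X = x n \<or> X = y n) \<and> (Y = x n \<or> Y = y n)" using X(2) Y(2) nz by auto
  moreover have "X \<noteq> Y" using XY nz r by auto
  moreover have "\<not> (X = y n \<and> Y = x n)"
  proof
    assume "X = y n \<and> Y = x n"
    then have "y n = of_real (\<rho> m) * (of_real (\<rho> n) * y n)" using XY y(2)[of n] by metis
    then have "y n = of_real (\<rho> m * \<rho> n) * y n" by (simp add: mult.assoc)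
    then have "complex_of_real (\<rho> m * \<rho> n) = 1" using y(1)[of n] by simp
    then have "\<rho> m * \<rho> n = 1" by (metis of_real_eq_1_iff)
    then have "\<bar>\<rho> m\<bar> * \<bar>\<rho> n\<bar> = 1" by (simp add: abs_mult[symmetric])
    moreover have "1 < \<bar>\<rho> m\<bar> * \<bar>\<rho> n\<bar>" using r by (simp add: less_1_mult)
    ultimately show False by simp
  qed
  ultimately have "x n = of_real (\<rho> m) * y n" using XY by auto
  then have "\<rho> m = \<rho> n" using y(1)[of n] y(2)[of n] by simp
  then show "m = n" using \<rho>(2) by (simp add: inj_eq)
qed

text \<open>
  The determinant and the discriminant at \<open>g\<close> for \<open>B = s v\<^sub>1 v\<^sub>1 + v\<^sub>1 v\<^sub>2 + v\<^sub>2 v\<^sub>1 + v\<^sub>2 v\<^sub>2\<close>, in terms of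
  \<open>\<alpha>(g)\<^sup>2\<close>, \<open>\<beta>(g)\<^sup>2\<close> and \<open>\<alpha>(g) \<beta>(g)\<close>.
\<close>

definition pdet :: "complex \<Rightarrow> complex \<times> complex \<times> complex \<Rightarrow> complex"
  where "pdet s = (\<lambda>(A, B, M). (A - 1) * s * (B - 1) - (M - 1)\<^sup>2)"

definition pdisc :: "complex \<Rightarrow> complex \<times> complex \<times> complex \<Rightarrow> complex"
  where "pdisc s = (\<lambda>(A, B, M). (4 * M * ((A - 1) * s * (B - 1)) - (A + B + 2 * M) * (M - 1)\<^sup>2)
    / (4 * ((A - 1) * s * (B - 1) - (M - 1)\<^sup>2)\<^sup>2))"

text \<open>All group elements outside {0, u} yield at most three triples of character values. The
  third triple adds no new nonzero value of the discriminant, so two values remain to be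
  compared.\<close>

lemma infinite_family_values:
  fixes \<alpha> \<beta> :: "'g::{finite,ab_group_add} \<Rightarrow> complex" and s :: "nat \<Rightarrow> complex" and \<rho> :: "nat \<Rightarrow> real"
  defines "v \<equiv> \<lambda>g. ((\<alpha> g)\<^sup>2, (\<beta> g)\<^sup>2, \<alpha> g * \<beta> g)"
  assumes D: "char_data \<alpha> \<beta> u"
    and v: "\<And>g. g \<noteq> 0 \<Longrightarrow> g \<noteq> u \<Longrightarrow> v g \<in> {t1, t2, t3}"
    and d: "\<And>n. pdet (s n) t1 \<noteq> 0" "\<And>n. pdet (s n) t2 \<noteq> 0" "\<And>n. pdet (s n) t3 \<noteq> 0"
    and g: "g \<noteq> 0" "g \<noteq> u" "v g = t1" and h: "h \<noteq> 0" "h \<noteq> u" "v h = t2"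
    and t3: "\<And>n. pdisc (s n) t3 \<in> {pdisc (s n) t1, 0}"
    and y: "\<And>n. pdisc (s n) t2 \<noteq> 0" "\<And>n. pdisc (s n) t1 = of_real (\<rho> n) * pdisc (s n) t2"
    and \<rho>: "\<And>n. \<bar>\<rho> n\<bar> > 1" "inj \<rho>"
  shows "infinite ({hopf_dual (A_hopf (char_sum \<alpha> \<beta>) u B) |B. B \<in> sym2} // twist_rel)"
proof -
  interpret q: char_quad \<alpha> \<beta> u "s n" 1 1 for n using D by (simp add: char_quad_def)
  have Q: "q.Qa n g * q.Qb g - (q.Qm g)\<^sup>2 = pdet (s n) (v g)" for n g
    by (simp add: q.Qa_def q.Qb_def q.Qm_def pdet_def v_def)
  have R: "char_regular \<alpha> \<beta> u (s n) 1 1" for n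
  proof
    show "q.Qa n g * q.Qb g - (q.Qm g)\<^sup>2 \<noteq> 0" if "g \<noteq> 0" "g \<noteq> u" for g
      unfolding Q using v[OF that] d by auto
  qed
  interpret q: char_regular \<alpha> \<beta> u "s n" 1 1 for n by (rule R)
  have e: "q.disc n g = pdisc (s n) (v g)" for n g
    by (simp add: q.disc_eq q.Qa_def q.Qb_def q.Qm_def pdisc_def v_def mult.assoc)
  show ?thesis
  proof (rule infinite_family[OF R, where x="\<lambda>n. pdisc (s n) t1" and y="\<lambda>n. pdisc (s n) t2" and \<rho>=\<rho> and g=g and h=h])
    show "q.disc n g \<in> {pdisc (s n) t1, pdisc (s n) t2, 0}" if "g \<noteq> 0" "g \<noteq> u" for n g
      using v[OF that] t3[of n] unfolding e by auto
  qed (use g h y \<rho> in \<open>simp_all add: e\<close>)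
qed

section \<open>Explicit values of characters and discriminants\<close>

lemma zchar_powers: "zchar (of_nat m :: 8) = zchar (1 :: 8) ^ m" "zchar (of_nat m :: 4) = zchar (1 :: 4) ^ m" "zchar (of_nat m :: 2) = zchar (1 :: 2) ^ m"
  by (induction m) (simp_all add: zchar_0 zchar_add)

lemma zchar_1: "zchar (1 :: 8) ^ 2 = \<i>" "zchar (1 :: 4) = \<i>" "zchar (1 :: 2) = -1"
proof -
  have i: "exp (\<i> * of_real pi / 2) = \<i>"
    using cis_pi_half by (simp add: cis_conv_exp mult.commute)
  have "zchar (1 :: 8) ^ 2 = exp (\<i> * of_real pi / 4) ^ 2" using zchar_of_nat[of 1, where ?'a=4] by (simp add: mult.commute)
  also have "\<dots> = exp (\<i> * of_real pi / 2)" by (simp add: exp_of_nat_mult[symmetric])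
  finally show "zchar (1 :: 8) ^ 2 = \<i>" by (simp only: i)
  have "zchar (1 :: 4) = exp (\<i> * of_real pi / 2)" using zchar_of_nat[of 1, where ?'a=2] by (simp add: mult.commute)
  then show "zchar (1 :: 4) = \<i>" by (simp only: i)
  have "zchar (1 :: 2) = exp (of_real pi * \<i>)" using zchar_of_nat[of 1, where ?'a=1] by simp
  then show "zchar (1 :: 2) = -1" by simp
qed

lemma bit0_of_nat_cases:
  obtains m where "m < CARD('a::finite bit0)" "g = (of_nat m :: 'a bit0)"
proof (cases g rule: bit0_cases)
  case (of_int k)
  then show ?thesis using that[of "nat k"] by (simp add: nat_less_iff)
qed

text \<open>In both cyclic cases the triple of character values is a function of this
  square.\<close>

lemma zchar8_square:
  assumes "g \<noteq> (0 :: 8)" "g \<noteq> 4"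
  shows "(zchar g)\<^sup>2 \<in> {\<i>, -1, -\<i>}"
proof -
  obtain m where m: "m < 8" "g = of_nat m" using bit0_of_nat_cases[where ?'a=4, of g] by auto
  have z: "(zchar g)\<^sup>2 = \<i> ^ m"
    unfolding m zchar_powers by (simp add: power_mult[symmetric] mult.commute[of m] power_mult zchar_1)
  have "m \<in> {0,1,2,3,4,5,6,7}" using m(1) by auto
  then show ?thesis
    using assms m(2) unfolding z by (elim insertE) (simp_all add: eval_nat_numeral)
qed

lemma pdet_values:
  "pdet s (\<i>, -\<i>, -1) = 2 * s - 4" "pdet s (-\<i>, \<i>, -1) = 2 * s - 4" "pdet s (-1, -1, 1) = 4 * s"
  "pdet s (\<i>, \<i>, -\<i>) = - 2 * \<i> * (s + 1)" "pdet s (-\<i>, -\<i>, \<i>) = 2 * \<i> * (s + 1)" "pdet s (-1, -1, -1) = 4 * s - 4"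
  "pdet s (1, 1, -1) = - 4"
  by (simp_all add: pdet_def algebra_simps power2_eq_square)

lemma pdisc_eq: "pdisc s (A, B, M) = (4 * M * ((A - 1) * s * (B - 1)) - (A + B + 2 * M) * (M - 1)\<^sup>2) / (4 * (pdet s (A, B, M))\<^sup>2)"
  by (simp add: pdisc_def pdet_def)

text \<open>The zero at (1, 1, -1) has two causes: the diagonal term contains A - 1 = 0, and the
  mixed term contains A + B + 2M = 0.\<close>

lemma pdisc_values:
  "pdisc s (\<i>, -\<i>, -1) = (8 - 8 * s) / (4 * (2 * s - 4)\<^sup>2)"
  "pdisc s (-\<i>, \<i>, -1) = (8 - 8 * s) / (4 * (2 * s - 4)\<^sup>2)"
  "pdisc s (-1, -1, 1) = 1 / (4 * s)"
  "pdisc s (\<i>, \<i>, -\<i>) = s / (2 * (s + 1)\<^sup>2)"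
  "pdisc s (-\<i>, -\<i>, \<i>) = s / (2 * (s + 1)\<^sup>2)"
  "pdisc s (-1, -1, -1) = (16 - 16 * s) / (4 * (4 * s - 4)\<^sup>2)"
  "pdisc s (1, 1, -1) = 0"
proof -
  have n: "(\<i> - 1) * s * (- \<i> - 1) = 2 * s" "(- \<i> - 1) * s * (\<i> - 1) = 2 * s" "(- 1 - 1) * s * (- 1 - 1) = 4 * s"
    "(\<i> - 1) * s * (\<i> - 1) = - 2 * \<i> * s" "(- \<i> - 1) * s * (- \<i> - 1) = 2 * \<i> * s"
    by (simp_all add: algebra_simps)
  show "pdisc s (\<i>, -\<i>, -1) = (8 - 8 * s) / (4 * (2 * s - 4)\<^sup>2)" "pdisc s (-\<i>, \<i>, -1) = (8 - 8 * s) / (4 * (2 * s - 4)\<^sup>2)"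
    "pdisc s (-1, -1, -1) = (16 - 16 * s) / (4 * (4 * s - 4)\<^sup>2)" "pdisc s (1, 1, -1) = 0"
    unfolding pdisc_eq pdet_values n by (simp_all add: power2_eq_square)
  show "pdisc s (-1, -1, 1) = 1 / (4 * s)"
    unfolding pdisc_eq pdet_values n by (simp add: power2_eq_square)
  show "pdisc s (\<i>, \<i>, -\<i>) = s / (2 * (s + 1)\<^sup>2)" "pdisc s (-\<i>, -\<i>, \<i>) = s / (2 * (s + 1)\<^sup>2)"
    unfolding pdisc_eq pdet_values n by (simp_all add: power2_eq_square)
qed

text \<open>With t = 1/(n + 1) the absolute value is 2 + 6t + 4t^2, which is strictly increasing for
  positive t.\<close>

lemma inj_ratio: "inj (\<lambda>n. - (2 * (real n + 3) * (real n + 2) / (real n + 1)\<^sup>2))"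
proof (rule injI)
  fix m n assume e: "- (2 * (real m + 3) * (real m + 2) / (real m + 1)\<^sup>2) = - (2 * (real n + 3) * (real n + 2) / (real n + 1)\<^sup>2)"
  have "2 * (y + 2) * (y + 1) / y\<^sup>2 = 2 + 6 * (1 / y) + 4 * (1 / y)\<^sup>2" if "y > 0" for y :: real
    using that by (simp add: field_simps power2_eq_square)
  from this[of "real k + 1" for k]
  have t: "2 * (real k + 3) * (real k + 2) / (real k + 1)\<^sup>2 = 2 + 6 * (1 / (real k + 1)) + 4 * (1 / (real k + 1))\<^sup>2" for k
    by (simp add: add.assoc)
  define a b where ab: "a = 1 / (real m + 1)" "b = 1 / (real n + 1)"
  have "(a - b) * (6 + 4 * (a + b)) = 0"
    using e unfolding t ab[symmetric] by (simp add: algebra_simps power2_eq_square)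
  moreover have "a > 0" "b > 0" unfolding ab by simp_all
  ultimately have "a = b" by simp
  then show "m = n" unfolding ab by simp
qed

lemma ratio_gt_1: "\<bar>- (2 * (real n + 3) * (real n + 2) / (real n + 1)\<^sup>2)\<bar> > 1"
proof -
  have "(real n + 1)\<^sup>2 < 2 * (real n + 3) * (real n + 2)"
    by (simp add: power2_eq_square algebra_simps) (intro add_nonneg_pos add_pos_nonneg, simp_all)
  then show ?thesis by (simp add: less_divide_eq abs_mult)
qed

text \<open>As functions of \<open>s\<close> the first two ratios are 2s(1 - s)/(s - 2)^2 and 2s(1 -
  s)/(s + 1)^2, which s -> 1 - s interchanges; hence the parameters n + 3 and -n - 2 give the same
  \<rho>. The third ratio is s/(1 - s). These parameters avoid the zeros of the determinants
  involved.\<close>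

lemma pdisc_ratio:
  fixes n :: nat
  defines "\<rho> \<equiv> - (2 * (real n + 3) * (real n + 2) / (real n + 1)\<^sup>2)"
  shows "pdisc (of_real (real n + 3)) (\<i>, -\<i>, -1) = of_real \<rho> * pdisc (of_real (real n + 3)) (-1, -1, 1)"
    "pdisc (of_real (- real n - 2)) (\<i>, \<i>, -\<i>) = of_real \<rho> * pdisc (of_real (- real n - 2)) (-1, -1, -1)"
    "pdisc (of_real (real n + 3)) (-1, -1, -1) = of_real (- ((real n + 3) / (real n + 2))) * pdisc (of_real (real n + 3)) (-1, -1, 1)"
proof -
  have "(8 - 8 * (y + 2)) / (4 * (2 * (y + 2) - 4)\<^sup>2) = - (2 * (y + 2) * (y + 1) / y\<^sup>2) * (1 / (4 * (y + 2)))" if "y > 0" for y :: real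
  proof -
    have "(- 8 * t) / (4 * (2 * y)\<^sup>2) = - (2 * w * t / y\<^sup>2) * (1 / (4 * w))" if "w \<noteq> 0" "y \<noteq> 0" for t w y :: real
      using that by (simp add: field_simps power2_eq_square)
    from this[of "y + 2" y "y + 1"] show ?thesis using that by (simp add: algebra_simps)
  qed
  from arg_cong[OF this[of "real n + 1"], of complex_of_real]
  show "pdisc (of_real (real n + 3)) (\<i>, -\<i>, -1) = of_real \<rho> * pdisc (of_real (real n + 3)) (-1, -1, 1)"
    unfolding pdisc_values \<rho>_def by (simp add: add.assoc)
  have "(- y - 1) / (2 * (- y - 1 + 1)\<^sup>2) = - (2 * (y + 2) * (y + 1) / y\<^sup>2) * ((16 - 16 * (- y - 1)) / (4 * (4 * (- y - 1) - 4)\<^sup>2))"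
    if "y > 0" for y :: real
  proof -
    have "(- t) / (2 * (- y)\<^sup>2) = - (2 * w * t / y\<^sup>2) * ((16 * w) / (4 * (- 4 * w)\<^sup>2))" if "w \<noteq> 0" "y \<noteq> 0" for t w y :: real
      using that by (simp add: field_simps power2_eq_square)
    moreover have "- y - 1 = - (y + 1)" "- y - 1 + 1 = - y" "4 * (- y - 1) - 4 = - 4 * (y + 2)" "16 - 16 * (- y - 1) = 16 * (y + 2)"
      by (simp_all add: algebra_simps)
    ultimately show ?thesis using that by (metis add_pos_pos less_irrefl zero_less_numeral)
  qed
  from arg_cong[OF this[of "real n + 1"], of complex_of_real]
  show "pdisc (of_real (- real n - 2)) (\<i>, \<i>, -\<i>) = of_real \<rho> * pdisc (of_real (- real n - 2)) (-1, -1, -1)"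
    unfolding pdisc_values \<rho>_def by (simp add: add.assoc diff_diff_eq)
  have "(16 - 16 * (y + 1)) / (4 * (4 * (y + 1) - 4)\<^sup>2) = - ((y + 1) / y) * (1 / (4 * (y + 1)))" if "y > 0" for y :: real
  proof -
    have "(- 16 * y) / (4 * (4 * y)\<^sup>2) = - (t / y) * (1 / (4 * t))" if "t \<noteq> 0" "y \<noteq> 0" for t y :: real
      using that by (simp add: field_simps power2_eq_square)
    from this[of "y + 1" y] show ?thesis using that by (simp add: algebra_simps)
  qed
  from arg_cong[OF this[of "real n + 2"], of complex_of_real]
  show "pdisc (of_real (real n + 3)) (-1, -1, -1) = of_real (- ((real n + 3) / (real n + 2))) * pdisc (of_real (real n + 3)) (-1, -1, 1)"
    unfolding pdisc_values by (simp add: add.assoc)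
qed

lemma of_real_nonzero:
  "2 * complex_of_real (real n + 3) - 4 \<noteq> 0" "4 * complex_of_real (real n + 3) \<noteq> 0"
  "4 * complex_of_real (real n + 3) - 4 \<noteq> 0" "complex_of_real (- real n - 2) + 1 \<noteq> 0"
  "4 * complex_of_real (- real n - 2) - 4 \<noteq> 0" "16 - 16 * complex_of_real (- real n - 2) \<noteq> 0"
  by (simp_all add: complex_eq_iff)

lemma zchar_2: "zchar (2 :: 8) = \<i>"
  using zchar_powers(1)[of 2] by (simp add: zchar_1)

text \<open>The generator and its square realise \<chi>^2 = \<i> and \<chi>^2 = -1. The remaining
  value -\<i> gives the conjugate triple, with the same discriminant.\<close>

lemma infinite_classes_Z8_cube:
  "infinite ({hopf_dual (A_hopf (char_sum zchar (\<lambda>g. zchar g ^ 3)) (4 :: 8) B) | B. B \<in> sym2} // twist_rel)"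
proof (rule infinite_family_values[where s="\<lambda>n. of_real (real n + 3)"
      and \<rho>="\<lambda>n. - (2 * (real n + 3) * (real n + 2) / (real n + 1)\<^sup>2)" and g=1 and h=2
      and ?t1.0="(\<i>, -\<i>, -1)" and ?t2.0="(-1, -1, 1)" and ?t3.0="(-\<i>, \<i>, -1)"])
  have v: "((zchar g)\<^sup>2, (zchar g ^ 3)\<^sup>2, zchar g * zchar g ^ 3) = ((zchar g)\<^sup>2, ((zchar g)\<^sup>2) ^ 3, ((zchar g)\<^sup>2)\<^sup>2)" for g :: 8
    by (simp add: eval_nat_numeral)
  show "char_data zchar (\<lambda>g. zchar g ^ 3) (4 :: 8)"
    by unfold_locales (simp_all add: zchar_add zchar_0 zchar_half power_mult_distrib)
  show "((zchar g)\<^sup>2, (zchar g ^ 3)\<^sup>2, zchar g * zchar g ^ 3) \<in> {(\<i>, -\<i>, -1), (-1, -1, 1), (-\<i>, \<i>, -1)}" if "g \<noteq> 0" "g \<noteq> 4" for g :: 8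
    unfolding v using zchar8_square[OF that] by (elim insertE) (simp_all add: eval_nat_numeral)
  show "((zchar (1::8))\<^sup>2, (zchar (1::8) ^ 3)\<^sup>2, zchar (1::8) * zchar (1::8) ^ 3) = (\<i>, -\<i>, -1)"
    unfolding v by (simp only: zchar_1) (simp add: eval_nat_numeral)
  show "((zchar (2::8))\<^sup>2, (zchar (2::8) ^ 3)\<^sup>2, zchar (2::8) * zchar (2::8) ^ 3) = (-1, -1, 1)"
    unfolding v by (simp add: zchar_2)
  show "pdisc (of_real (real n + 3)) (-1, -1, 1) \<noteq> 0" for n
    unfolding pdisc_values using of_real_nonzero(2)[of n] by (simp only: divide_eq_0_iff) simp
  show "pdisc (of_real (real n + 3)) (-\<i>, \<i>, -1) \<in> {pdisc (of_real (real n + 3)) (\<i>, -\<i>, -1), 0}" for n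
    by (simp add: pdisc_values)
qed (simp_all only: pdet_values of_real_nonzero pdisc_ratio inj_ratio ratio_gt_1, simp_all)

lemma infinite_classes_Z8_fifth:
  "infinite ({hopf_dual (A_hopf (char_sum zchar (\<lambda>g. zchar g ^ 5)) (4 :: 8) B) | B. B \<in> sym2} // twist_rel)"
proof (rule infinite_family_values[where s="\<lambda>n. of_real (- real n - 2)"
      and \<rho>="\<lambda>n. - (2 * (real n + 3) * (real n + 2) / (real n + 1)\<^sup>2)" and g=1 and h=2
      and ?t1.0="(\<i>, \<i>, -\<i>)" and ?t2.0="(-1, -1, -1)" and ?t3.0="(-\<i>, -\<i>, \<i>)"])
  have v: "((zchar g)\<^sup>2, (zchar g ^ 5)\<^sup>2, zchar g * zchar g ^ 5) = ((zchar g)\<^sup>2, ((zchar g)\<^sup>2) ^ 5, ((zchar g)\<^sup>2) ^ 3)" for g :: 8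
    by (simp add: eval_nat_numeral)
  show "char_data zchar (\<lambda>g. zchar g ^ 5) (4 :: 8)"
    by unfold_locales (simp_all add: zchar_add zchar_0 zchar_half power_mult_distrib)
  show "((zchar g)\<^sup>2, (zchar g ^ 5)\<^sup>2, zchar g * zchar g ^ 5) \<in> {(\<i>, \<i>, -\<i>), (-1, -1, -1), (-\<i>, -\<i>, \<i>)}" if "g \<noteq> 0" "g \<noteq> 4" for g :: 8
    unfolding v using zchar8_square[OF that] by (elim insertE) (simp_all add: eval_nat_numeral)
  show "((zchar (1::8))\<^sup>2, (zchar (1::8) ^ 5)\<^sup>2, zchar (1::8) * zchar (1::8) ^ 5) = (\<i>, \<i>, -\<i>)"
    unfolding v by (simp only: zchar_1) (simp add: eval_nat_numeral)
  show "((zchar (2::8))\<^sup>2, (zchar (2::8) ^ 5)\<^sup>2, zchar (2::8) * zchar (2::8) ^ 5) = (-1, -1, -1)"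
    unfolding v by (simp add: zchar_2)
  show "pdisc (of_real (- real n - 2)) (-1, -1, -1) \<noteq> 0" for n
    unfolding pdisc_values using of_real_nonzero(5,6)[of n] by (simp only: divide_eq_0_iff) simp
  show "pdisc (of_real (- real n - 2)) (-\<i>, -\<i>, \<i>) \<in> {pdisc (of_real (- real n - 2)) (\<i>, \<i>, -\<i>), 0}" for n
    by (simp add: pdisc_values)
qed (simp_all only: pdet_values of_real_nonzero pdisc_ratio inj_ratio ratio_gt_1 mult_eq_0_iff, simp_all)

text \<open>The triple (1, 1, -1), attained at (0, 1) and (2, 1), has discriminant 0, so the points
  (1, 0) and (1, 1) supply the two nonzero values.\<close>

lemma infinite_classes_Z4_Z2:
  "infinite ({hopf_dual (A_hopf (char_sum (\<lambda>(x, y). zchar x) (\<lambda>(x, y). zchar x * zchar y))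
          ((2, 0) :: 4 \<times> 2) B) | B. B \<in> sym2} // twist_rel)"
proof (rule infinite_family_values[where s="\<lambda>n. of_real (real n + 3)"
      and \<rho>="\<lambda>n. - ((real n + 3) / (real n + 2))" and g="(1, 0)" and h="(1, 1)"
      and ?t1.0="(-1, -1, -1)" and ?t2.0="(-1, -1, 1)" and ?t3.0="(1, 1, -1)"])
  show "char_data (\<lambda>(x :: 4, y :: 2). zchar x) (\<lambda>(x, y). zchar x * zchar y) (2, 0)"
    by unfold_locales (auto simp: zchar_add zchar_0 zchar_half zero_prod_def)
  show "(((\<lambda>(x, y). zchar x) g)\<^sup>2, ((\<lambda>(x, y). zchar x * zchar y) g)\<^sup>2, (\<lambda>(x, y). zchar x) g * (\<lambda>(x, y). zchar x * zchar y) g)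
    \<in> {(-1, -1, -1), (-1, -1, 1), (1, 1, -1)}" if "g \<noteq> 0" "g \<noteq> (2, 0)" for g :: "4 \<times> 2"
  proof -
    obtain x y where g: "g = (x, y)" by (cases g)
    obtain m where m: "m < 4" "x = of_nat m" using bit0_of_nat_cases[where ?'a=2, of x] by auto
    obtain k where k: "k < 2" "y = of_nat k" using bit0_of_nat_cases[where ?'a=1, of y] by auto
    have z: "zchar x = \<i> ^ m" "zchar y = (-1) ^ k"
      unfolding m(2) k(2) zchar_powers by (simp_all add: zchar_1)
    have "m \<in> {0,1,2,3}" "k \<in> {0,1}" using m(1) k(1) by auto
    then show ?thesis
      using that m(2) k(2) unfolding g prod.case z
      by (elim insertE) (simp_all add: eval_nat_numeral zero_prod_def)
  qed
  show "inj (\<lambda>n. - ((real n + 3) / (real n + 2)))"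
    by (rule injI) (simp add: field_simps)
  show "\<bar>- ((real n + 3) / (real n + 2))\<bar> > 1" for n
    by (simp add: field_simps)
  show "pdisc (of_real (real n + 3)) (-1, -1, 1) \<noteq> 0" for n
    unfolding pdisc_values using of_real_nonzero(2)[of n] by (simp only: divide_eq_0_iff) simp
qed (simp_all only: pdet_values of_real_nonzero pdisc_ratio prod.case, simp_all add: zchar_1 zchar_0 zero_prod_def pdisc_values)

theorem corollary4p3:
  shows "infinite
      ({hopf_dual (A_hopf (char_sum zchar (\<lambda>g. zchar g ^ 3)) (4 :: 8) B) | B. B \<in> sym2} // twist_rel) \<and>
    infinite
      ({hopf_dual (A_hopf (char_sum zchar (\<lambda>g. zchar g ^ 5)) (4 :: 8) B) | B. B \<in> sym2} // twist_rel) \<and>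
    infinite
      ({hopf_dual (A_hopf (char_sum (\<lambda>(x, y). zchar x) (\<lambda>(x, y). zchar x * zchar y))
          ((2, 0) :: 4 \<times> 2) B) | B. B \<in> sym2} // twist_rel)"
  using infinite_classes_Z8_cube infinite_classes_Z8_fifth infinite_classes_Z4_Z2 by blast

end
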